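(* Let $U:\mathbb{R}^d\to\mathbb{R}$ be three times continuously differentiable, and let $L\ge 0$, $m>0$, $\tilde L\ge0$ be such that for all $x,y\in\mathbb{R}^d$, $\|\nabla U(x)-\nabla U(y)\|\le L\|x-y\|$, $U(y)\ge U(x)+\langle\nabla U(x),y-x\rangle+(m/2)\|x-y\|^2$, and $\|\nabla^2U(x)-\nabla^2U(y)\|\le\tilde L\|x-y\|$. Let $(\gamma_k)_{k\ge1}$ be a non-increasing sequence of positive real numbers with $\gamma_1\le 1/(m+L)$. Then for all $x\in\mathbb{R}^d$ and $n\ge 1$, $$W_2^2(\delta_xQ_\gamma^n,\pi)\le u_n^{(1)}(\gamma)\left\{\|x-x^\star\|^2+d/m\right\}+u_n^{(3)}(\gamma),$$ where $u_n^{(1)}(\gamma)=2\prod_{k=1}^n(1-\kappa\gamma_k/2)$ and $$u_n^{(3)}(\gamma)=\sum_{i=1}^n\left[d\gamma_i^3\left\{2L^2+\gamma_iL^4\left(\frac{\gamma_i}{6}+m^{-1}\right)+\kappa^{-1}\left(\frac{4d\tilde L^2}{3}+\gamma_iL^4+\frac{4L^4}{3m}\right)\right\}\prod_{k=i+1}^n\left(1-\frac{\kappa\gamma_k}{2}\right)\right].$$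
   Context: Here $d\ge1$, $\|\cdot\|$ is the Euclidean norm on vectors and the associated operator norm on matrices, and empty products equal $1$. $x^\star$ denotes the unique minimizer of $U$, $\kappa=2mL/(m+L)$, and $\pi$ is the probability measure on $\mathbb{R}^d$ with density proportional to $e^{-U}$. For $\gamma>0$, $R_\gamma$ is the Markov kernel on $\mathbb{R}^d$ such that $R_\gamma(x,\cdot)$ is the Gaussian distribution with mean $x-\gamma\nabla U(x)$ and covariance matrix $2\gamma I_d$. $Q_\gamma^n=R_{\gamma_1}R_{\gamma_2}\cdots R_{\gamma_n}$. $W_2$ is the Wasserstein distance of order $2$ associated with the Euclidean distance. *)

theory Defs
  imports "HOL-Probability.Probability"
begin

text \<open>\<open>Ck k f\<close>: \<open>f\<close> is \<open>k\<close> times continuously differentiable on the whole space. The recursion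
  runs over all directional derivatives \<open>x \<mapsto> Df(x) v\<close>; taking basis vectors for \<open>v\<close>
  gives the partial derivatives.\<close>

fun Ck :: "nat \<Rightarrow> (real ^ 'n \<Rightarrow> real) \<Rightarrow> bool" where
  "Ck 0 f \<longleftrightarrow> continuous_on UNIV f"
| "Ck (Suc k) f \<longleftrightarrow>
     (\<forall>x. f differentiable (at x)) \<and> (\<forall>v. Ck k (\<lambda>x. frechet_derivative f (at x) v))"

definition grad :: "(real ^ 'n \<Rightarrow> real) \<Rightarrow> real ^ 'n \<Rightarrow> real ^ 'n" where
  "grad f x = (THE D. GDERIV f x :> D)"

definition hessian :: "(real ^ 'n \<Rightarrow> real) \<Rightarrow> real ^ 'n \<Rightarrow> real ^ 'n ^ 'n" where
  "hessian f x = jacobian (grad f) (at x)"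

text \<open>The library norm on \<^typ>\<open>real ^ 'n ^ 'n\<close> is the Frobenius norm, not the operator norm.\<close>

definition op_norm :: "real ^ 'n ^ 'n \<Rightarrow> real" where
  "op_norm A = onorm (\<lambda>v. A *v v)"

text \<open>Only meaningful when \<open>U\<close> has exactly one minimizer, as strongly convex functions do.\<close>

definition minimizer :: "(real ^ 'n \<Rightarrow> real) \<Rightarrow> real ^ 'n" where
  "minimizer U = (THE x. \<forall>y. U x \<le> U y)"

text \<open>The probability measure with density proportional to \<open>exp (- U)\<close>, provided that function
  is integrable (otherwise the normalizing constant and hence the measure degenerate to 0).\<close>

definition gibbs :: "(real ^ 'n \<Rightarrow> real) \<Rightarrow> (real ^ 'n) measure" where
  "gibbs U = density lborel (\<lambda>x. ennreal (exp (- U x) / (LINT y|lborel. exp (- U y))))"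

text \<open>Gaussian distribution with mean \<open>\<mu>\<close> and (symmetric positive definite) covariance matrix \<open>S\<close>.\<close>

definition gaussian :: "real ^ 'n \<Rightarrow> real ^ 'n ^ 'n \<Rightarrow> (real ^ 'n) measure" where
  "gaussian \<mu> S = density lborel (\<lambda>y. ennreal
     (exp (- ((y - \<mu>) \<bullet> (matrix_inv S *v (y - \<mu>))) / 2) / sqrt ((2 * pi) ^ CARD('n) * det S)))"

definition ula_kernel :: "(real ^ 'n \<Rightarrow> real) \<Rightarrow> real \<Rightarrow> real ^ 'n \<Rightarrow> (real ^ 'n) measure" where
  "ula_kernel U h x = gaussian (x - h *\<^sub>R grad U x) ((2 * h) *\<^sub>R mat 1)"

text \<open>The composition \<open>R\<^bsub>\<gamma> 1\<^esub> R\<^bsub>\<gamma> 2\<^esub> \<dots> R\<^bsub>\<gamma> n\<^esub>\<close>, where the product of two kernels is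
  \<open>(R S)(x, A) = \<integral> S(y, A) R(x, dy)\<close>, i.e. the Giry monad bind. Step sizes are indexed
  from 1; \<open>\<gamma> 0\<close> is never used.\<close>

primrec ula_iter ::
  "(real ^ 'n \<Rightarrow> real) \<Rightarrow> (nat \<Rightarrow> real) \<Rightarrow> nat \<Rightarrow> real ^ 'n \<Rightarrow> (real ^ 'n) measure" where
  "ula_iter U \<gamma> 0 x = return borel x"
| "ula_iter U \<gamma> (Suc n) x = bind (ula_iter U \<gamma> n x) (ula_kernel U (\<gamma> (Suc n)))"

definition couplings :: "'a measure \<Rightarrow> 'b measure \<Rightarrow> ('a \<times> 'b) measure set" where
  "couplings \<mu> \<nu> =
     {\<zeta>. sets \<zeta> = sets (\<mu> \<Otimes>\<^sub>M \<nu>) \<and> distr \<zeta> \<mu> fst = \<mu> \<and> distr \<zeta> \<nu> snd = \<nu>}"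

definition ennreal_sqrt :: "ennreal \<Rightarrow> ennreal" where
  "ennreal_sqrt t = (if t = \<infinity> then \<infinity> else ennreal (sqrt (enn2real t)))"

definition W2 :: "(real ^ 'n) measure \<Rightarrow> (real ^ 'n) measure \<Rightarrow> ennreal" where
  "W2 \<mu> \<nu> =
     ennreal_sqrt (INF \<zeta>\<in>couplings \<mu> \<nu>. \<integral>\<^sup>+ (x, y). ennreal ((norm (x - y))\<^sup>2) \<partial>\<zeta>)"

definition kappa :: "real \<Rightarrow> real \<Rightarrow> real" where
  "kappa m L = 2 * m * L / (m + L)"

definition u1 :: "real \<Rightarrow> real \<Rightarrow> (nat \<Rightarrow> real) \<Rightarrow> nat \<Rightarrow> real" where
  "u1 m L \<gamma> n = 2 * (\<Prod>k=1..n. 1 - kappa m L * \<gamma> k / 2)"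

text \<open>The argument \<open>d\<close> is the dimension and \<open>L'\<close> the Lipschitz constant of the Hessian.\<close>

definition u3 :: "real \<Rightarrow> real \<Rightarrow> real \<Rightarrow> real \<Rightarrow> (nat \<Rightarrow> real) \<Rightarrow> nat \<Rightarrow> real" where
  "u3 d m L L' \<gamma> n =
     (\<Sum>i=1..n.
        d * \<gamma> i ^ 3 *
        (2 * L\<^sup>2 + \<gamma> i * L ^ 4 * (\<gamma> i / 6 + inverse m)
         + inverse (kappa m L) *
             (4 * d * L'\<^sup>2 / 3 + \<gamma> i * L ^ 4 + 4 * L ^ 4 / (3 * m))) *
        (\<Prod>k=i+1..n. 1 - kappa m L * \<gamma> k / 2))"

end

theory Submission
  imports Defs
begin

text \<open>The Langevin diffusion is replaced by a discrete chain that leaves the Gibbs measure \<open>\<pi>\<close> exactly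
  invariant: the Metropolis-adjusted Langevin chain (MALA) with the small step \<open>h = \<gamma> / N\<close>. One Euler
  step of size \<open>\<gamma>\<close> is driven by the sum of the \<open>N\<close> Gaussian increments of that chain, so each \<open>N\<close>
  yields a genuine coupling of \<open>\<mu> R\<^sub>\<gamma>\<close> and \<open>\<pi>\<close>. Since the Hessian is Lipschitz, a proposal is rejected
  with probability \<open>O(h^(3/2))\<close>, so the rejections displace the chain by \<open>O(h^(5/4))\<close> per step in \<open>L^2\<close>,
  which sums to \<open>o(1)\<close> over \<open>N\<close> steps. For the
  accepted moves the usual synchronous coupling argument applies: co-coercivity of the gradient gives
  the contraction, and the drift of \<open>grad U\<close> along the stationary chain is bounded by
  \<open>h (d L' + L \<parallel>grad U\<parallel>)\<close> in \<open>L^2\<close>, where the reflection symmetry of the Gaussian increments takes the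
  place of Ito's formula. Letting \<open>N\<close> tend to infinity inside the infimum that defines \<open>W2\<close> gives the
  one-step inequality, which is then iterated.\<close>

section \<open>Square-integrable functions\<close>

text \<open>What survives the limit is \<open>remainder\<close>, which up to rejections is -h times
  the sum of grad U(Y_j) - grad U(Y_0) along the chain. It enters the squared distance twice:
  quadratically, and linearly through its inner product with the initial gap \<open>Y0 - X0\<close>.
  A gradient increment over time t has L^2 size of order sqrt t. This is good enough for the
  quadratic term, which becomes of order \<gamma>^3, but in the linear term it would give
  \<gamma>^(3/2), and Young's inequality with weight \<kappa> \<gamma> would leave \<gamma>^2 per
  step, which is too large. So the gradient part of the linear term is not estimated by norms: the
  gap is determined before the increments, hence they count only through their conditional mean, of
  order t. The linear term is then of order \<gamma>^2, and Young's inequality leaves \<gamma>^3.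
  This is the second use of the Lipschitz Hessian, after the rejection estimate. A step may start
  from any square-integrable coupling with \<pi>, optimal or not; it costs an arbitrarily small
  surplus, and over n steps the surpluses add up to at most \<epsilon>.\<close>

definition sqint :: "'a measure \<Rightarrow> ('a \<Rightarrow> 'b::euclidean_space) \<Rightarrow> bool" where
  "sqint M f \<longleftrightarrow> f \<in> borel_measurable M \<and> integrable M (\<lambda>w. (norm (f w))\<^sup>2)"

definition l2 :: "'a measure \<Rightarrow> ('a \<Rightarrow> 'b::euclidean_space) \<Rightarrow> real" where
  "l2 M f = sqrt (LINT w|M. (norm (f w))\<^sup>2)"

lemma l2_nonneg [simp]: "0 \<le> l2 M f"
  by (simp add: l2_def)

lemma l2_power2: "(l2 M f)\<^sup>2 = (LINT w|M. (norm (f w))\<^sup>2)"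
  by (simp add: l2_def)

lemma sqint_measurable: "sqint M f \<Longrightarrow> f \<in> borel_measurable M"
  by (simp add: sqint_def)

lemma sqint_integrable: "sqint M f \<Longrightarrow> integrable M (\<lambda>w. (norm (f w))\<^sup>2)"
  by (simp add: sqint_def)

lemma sqint_dominated:
  assumes "f \<in> borel_measurable M" "sqint M g" "\<And>w. w \<in> space M \<Longrightarrow> norm (f w) \<le> norm (g w)"
  shows "sqint M f" "l2 M f \<le> l2 M g"
proof -
  have le: "(norm (f w))\<^sup>2 \<le> (norm (g w))\<^sup>2" if "w \<in> space M" for w
    using assms(3)[OF that] by (simp add: power_mono)
  show f: "sqint M f"
    unfolding sqint_def
  proof
    have "f \<in> borel_measurable M" by fact
    then show "integrable M (\<lambda>w. (norm (f w))\<^sup>2)"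
      by (intro Bochner_Integration.integrable_bound[OF sqint_integrable[OF assms(2)]]) (use le in auto)
  qed fact
  show "l2 M f \<le> l2 M g"
    unfolding l2_def by (intro real_sqrt_le_mono integral_mono sqint_integrable f assms(2) le)
qed

lemma sqint_scaleR:
  assumes "sqint M f" shows "sqint M (\<lambda>w. c *\<^sub>R f w)" "l2 M (\<lambda>w. c *\<^sub>R f w) = \<bar>c\<bar> * l2 M f"
  using assms by (auto simp: sqint_def l2_def power_mult_distrib real_sqrt_mult)

lemma sqint_add:
  assumes "sqint M f" "sqint M g" shows "sqint M (\<lambda>w. f w + g w)"
  unfolding sqint_def
proof
  have m[measurable]: "f \<in> borel_measurable M" "g \<in> borel_measurable M"
    using assms by (auto simp: sqint_def)
  show "(\<lambda>w. f w + g w) \<in> borel_measurable M" by measurable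
  have le: "(norm (f w + g w))\<^sup>2 \<le> 2 * (norm (f w))\<^sup>2 + 2 * (norm (g w))\<^sup>2" for w
  proof -
    have "(norm (f w + g w))\<^sup>2 \<le> (norm (f w) + norm (g w))\<^sup>2"
      by (intro power_mono norm_triangle_ineq) simp
    also have "\<dots> \<le> 2 * (norm (f w))\<^sup>2 + 2 * (norm (g w))\<^sup>2"
      using sum_squares_bound[of "norm (f w)" "norm (g w)"] by (simp add: power2_sum)
    finally show ?thesis .
  qed
  have "integrable M (\<lambda>w. 2 * (norm (f w))\<^sup>2 + 2 * (norm (g w))\<^sup>2)"
    using assms by (auto simp: sqint_def)
  then show "integrable M (\<lambda>w. (norm (f w + g w))\<^sup>2)"
    by (rule Bochner_Integration.integrable_bound) (use le in auto)
qed

lemma sqint_minus: "sqint M f \<Longrightarrow> sqint M (\<lambda>w. - f w)"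
  using sqint_scaleR(1)[of M f "-1"] by simp

lemma sqint_diff: "sqint M f \<Longrightarrow> sqint M g \<Longrightarrow> sqint M (\<lambda>w. f w - g w)"
  using sqint_add[of M f "\<lambda>w. - g w"] sqint_minus[of M g] by simp

lemma (in finite_measure) sqint_const: "sqint M (\<lambda>_. c)"
  by (simp add: sqint_def)

lemma integrable_inner_sqint:
  assumes "sqint M f" "sqint M g" shows "integrable M (\<lambda>w. f w \<bullet> g w)"
proof (rule Bochner_Integration.integrable_bound)
  have m[measurable]: "f \<in> borel_measurable M" "g \<in> borel_measurable M"
    using assms by (auto simp: sqint_def)
  show "integrable M (\<lambda>w. (norm (f w))\<^sup>2 + (norm (g w))\<^sup>2)"
    using assms by (auto simp: sqint_def)
  show "(\<lambda>w. f w \<bullet> g w) \<in> borel_measurable M" by measurable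
  have "\<bar>f w \<bullet> g w\<bar> \<le> (norm (f w))\<^sup>2 + (norm (g w))\<^sup>2" for w
    using Cauchy_Schwarz_ineq2[of "f w" "g w"] sum_squares_bound[of "norm (f w)" "norm (g w)"]
      mult_nonneg_nonneg[OF norm_ge_zero[of "f w"] norm_ge_zero[of "g w"]] by linarith
  then show "AE w in M. norm (f w \<bullet> g w) \<le> norm ((norm (f w))\<^sup>2 + (norm (g w))\<^sup>2)"
    by simp
qed

lemma l2_power2_add:
  assumes "sqint M f" "sqint M g"
  shows "(l2 M (\<lambda>w. f w + g w))\<^sup>2 = (l2 M f)\<^sup>2 + 2 * (LINT w|M. f w \<bullet> g w) + (l2 M g)\<^sup>2"
proof -
  have "(l2 M (\<lambda>w. f w + g w))\<^sup>2 = (LINT w|M. (norm (f w))\<^sup>2 + 2 * (f w \<bullet> g w) + (norm (g w))\<^sup>2)"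
    unfolding l2_power2 by (simp add: power2_norm_eq_inner algebra_simps inner_commute)
  also have "\<dots> = (l2 M f)\<^sup>2 + 2 * (LINT w|M. f w \<bullet> g w) + (l2 M g)\<^sup>2"
    using assms by (simp add: l2_power2 sqint_integrable integrable_inner_sqint)
  finally show ?thesis .
qed

lemma l2_Cauchy_Schwarz:
  assumes f: "sqint M f" and g: "sqint M g"
  shows "\<bar>LINT w|M. f w \<bullet> g w\<bar> \<le> l2 M f * l2 M g"
proof -
  define I where "I = (LINT w|M. f w \<bullet> g w)"
  \<comment> \<open>The squared norm of f + t g is a nonnegative quadratic in t; its discriminant
    gives the claim.\<close>
  have q: "0 \<le> (l2 M f)\<^sup>2 + 2 * t * I + t\<^sup>2 * (l2 M g)\<^sup>2" for t
    using l2_power2_add[OF f sqint_scaleR(1)[OF g, of t]] sqint_scaleR(2)[OF g, of t]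
      zero_le_power2[of "l2 M (\<lambda>w. f w + t *\<^sub>R g w)"]
    by (simp add: I_def power_mult_distrib mult.assoc)
  have "I\<^sup>2 \<le> (l2 M f * l2 M g)\<^sup>2"
  proof (cases "l2 M g = 0")
    case True
    have "I = 0"
    proof (rule ccontr)
      assume "I \<noteq> 0"
      \<comment> \<open>With \<open>l2 M g = 0\<close> the quadratic is affine in t, and this t
        gives it the value -1.\<close>
      then show False
        using q[of "- ((l2 M f)\<^sup>2 + 1) / (2 * I)"] True by (simp add: field_simps)
    qed
    then show ?thesis by simp
  next
    case False
    then have "0 \<le> (l2 M g)\<^sup>2 * ((l2 M f)\<^sup>2 + 2 * (- I / (l2 M g)\<^sup>2) * I + (- I / (l2 M g)\<^sup>2)\<^sup>2 * (l2 M g)\<^sup>2)"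
      using q[of "- I / (l2 M g)\<^sup>2"] by simp
    also have "\<dots> = (l2 M g)\<^sup>2 * (l2 M f)\<^sup>2 - I\<^sup>2"
      using False by (simp add: field_simps power2_eq_square)
    finally show ?thesis by (simp add: power_mult_distrib mult.commute)
  qed
  then show ?thesis
    using power2_le_iff_abs_le[of "l2 M f * l2 M g" I] by (simp add: I_def)
qed

lemma l2_triangle:
  assumes f: "sqint M f" and g: "sqint M g"
  shows "l2 M (\<lambda>w. f w + g w) \<le> l2 M f + l2 M g"
proof (rule power2_le_imp_le)
  show "(l2 M (\<lambda>w. f w + g w))\<^sup>2 \<le> (l2 M f + l2 M g)\<^sup>2"
    using l2_power2_add[OF f g] l2_Cauchy_Schwarz[OF f g] by (simp add: power2_sum)
qed simp

text \<open>Lets every L^2 statement about the chain be read off the joint law of the few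
  coordinates involved.\<close>

lemma l2_comp:
  assumes T: "T \<in> measurable M N" and D: "distr M N T = N'" and f: "f \<in> borel_measurable N"
  shows "sqint M (\<lambda>w. f (T w)) \<longleftrightarrow> sqint N' f" "l2 M (\<lambda>w. f (T w)) = l2 N' f"
  using assms by (auto simp: sqint_def l2_def integrable_distr_eq integral_distr D[symmetric])

section \<open>Strongly convex potentials with Lipschitz gradient and Hessian\<close>

lemma has_vector_derivative_along_line:
  assumes "(f has_derivative f') (at (y + t *\<^sub>R v))"
  shows "((\<lambda>t. f (y + t *\<^sub>R v)) has_vector_derivative f' v) (at t)"
proof -
  have "((\<lambda>t. f (y + t *\<^sub>R v)) has_derivative (\<lambda>s. f' (s *\<^sub>R v))) (at t)"
    by (rule has_derivative_compose[of "\<lambda>t. y + t *\<^sub>R v" "\<lambda>s. s *\<^sub>R v" t UNIV f f'])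
      (auto intro!: derivative_eq_intros assms)
  then show ?thesis
    using has_derivative_linear[OF assms] by (simp add: has_vector_derivative_def linear_cmul)
qed

lemma has_real_derivative_inner_const:
  assumes "(f has_vector_derivative f') (at t)"
  shows "((\<lambda>t. w \<bullet> f t) has_real_derivative w \<bullet> f') (at t)"
  using bounded_linear.has_vector_derivative[OF bounded_linear_inner_right assms, of w]
  by (simp add: has_real_derivative_iff_has_vector_derivative)

text \<open>\<open>grad\<close> is a definite description, so its value rests on uniqueness of the
  representing vector. The explicit formula is what carries differentiability of the directional
  derivatives in \<open>Ck\<close> over to \<open>grad\<close>.\<close>

lemma GDERIV_grad:
  fixes f :: "real ^ 'n \<Rightarrow> real"
  assumes "f differentiable (at x)"
  shows "GDERIV f x :> grad f x"
    and "grad f x = (\<Sum>b\<in>Basis. frechet_derivative f (at x) b *\<^sub>R b)"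
proof -
  define D where "D = (\<Sum>b\<in>Basis. frechet_derivative f (at x) b *\<^sub>R b)"
  have d: "(f has_derivative frechet_derivative f (at x)) (at x)"
    using assms by (simp add: frechet_derivative_works)
  have "frechet_derivative f (at x) = (\<lambda>h. h \<bullet> D)"
  proof
    fix h
    have "frechet_derivative f (at x) (\<Sum>b\<in>Basis. (h \<bullet> b) *\<^sub>R b)
        = (\<Sum>b\<in>Basis. (h \<bullet> b) * frechet_derivative f (at x) b)"
      using has_derivative_linear[OF d] by (simp add: linear_sum linear_cmul)
    then show "frechet_derivative f (at x) h = h \<bullet> D"
      by (simp add: euclidean_representation D_def inner_sum_right mult.commute)
  qed
  then have g: "GDERIV f x :> D"
    using d by (simp add: gderiv_def)
  have "D' = D" if "GDERIV f x :> D'" for D'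
  proof -
    have "h \<bullet> D' = h \<bullet> D" for h
      using has_derivative_unique[OF that[unfolded gderiv_def] g[unfolded gderiv_def]] by metis
    then show ?thesis by (metis vector_eq_ldot)
  qed
  then have "grad f x = D"
    unfolding grad_def using g by (rule the_equality[rotated])
  then show "GDERIV f x :> grad f x" "grad f x = (\<Sum>b\<in>Basis. frechet_derivative f (at x) b *\<^sub>R b)"
    using g by (simp_all add: D_def)
qed

locale langevin_potential =
  fixes U :: "real ^ 'n \<Rightarrow> real" and L m L' :: real
  assumes smooth: "Ck 3 U"
    and L_nonneg: "L \<ge> 0" and m_pos: "m > 0" and L'_nonneg: "L' \<ge> 0"
    and grad_lipschitz: "\<And>x y. norm (grad U x - grad U y) \<le> L * norm (x - y)"
    and strongly_convex: "\<And>x y. U y \<ge> U x + grad U x \<bullet> (y - x) + (m / 2) * (norm (x - y))\<^sup>2"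
    and hessian_lipschitz: "\<And>x y. op_norm (hessian U x - hessian U y) \<le> L' * norm (x - y)"
begin

abbreviation "g \<equiv> grad U"
abbreviation "xs \<equiv> minimizer U"

lemma U_differentiable: "U differentiable (at x)"
  using smooth by (simp add: numeral_3_eq_3)

lemma U_has_derivative: "(U has_derivative (\<lambda>h. h \<bullet> g x)) (at x)"
  using GDERIV_grad(1)[OF U_differentiable] by (simp add: gderiv_def)

lemma grad_differentiable: "g differentiable (at x)"
proof -
  have "(\<lambda>x. frechet_derivative U (at x) b) differentiable (at x)" for b
    using smooth by (simp add: numeral_3_eq_3)
  then have "(\<lambda>x. \<Sum>b\<in>Basis. frechet_derivative U (at x) b *\<^sub>R b) differentiable (at x)"
    by (intro differentiable_sum ballI differentiable_scaleR) auto
  moreover have "g = (\<lambda>x. \<Sum>b\<in>Basis. frechet_derivative U (at x) b *\<^sub>R b)"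
    using GDERIV_grad(2)[OF U_differentiable] by blast
  ultimately show ?thesis by simp
qed

lemma grad_has_derivative: "(g has_derivative (\<lambda>v. hessian U x *v v)) (at x)"
  unfolding hessian_def using grad_differentiable jacobian_works by blast

lemma U_along_line: "((\<lambda>t. U (y + t *\<^sub>R v)) has_real_derivative (g (y + t *\<^sub>R v) \<bullet> v)) (at t)"
  using has_vector_derivative_along_line[OF U_has_derivative, of y v t]
  by (simp add: has_real_derivative_iff_has_vector_derivative inner_commute)

lemma grad_along_line:
  "((\<lambda>t. w \<bullet> g (y + t *\<^sub>R v)) has_real_derivative (w \<bullet> (hessian U (y + t *\<^sub>R v) *v v))) (at t)"
  by (intro has_real_derivative_inner_const has_vector_derivative_along_line grad_has_derivative)

lemma continuous_grad: "continuous_on UNIV g"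
  using grad_differentiable by (simp add: differentiable_imp_continuous_on differentiable_on_def differentiable_at_withinI)

lemma continuous_U: "continuous_on UNIV U"
  using U_differentiable by (simp add: differentiable_imp_continuous_on differentiable_on_def differentiable_at_withinI)

lemma measurable_grad [measurable]: "g \<in> borel_measurable borel"
  by (rule borel_measurable_continuous_onI[OF continuous_grad])

lemma measurable_U [measurable]: "U \<in> borel_measurable borel"
  by (rule borel_measurable_continuous_onI[OF continuous_U])

section \<open>Taylor and quadrature estimates\<close>

lemma hessian_diff_bound:
  "norm ((hessian U x - hessian U y) *v v) \<le> L' * norm (x - y) * norm v"
proof -
  have "norm ((hessian U x - hessian U y) *v v) \<le> op_norm (hessian U x - hessian U y) * norm v"
    unfolding op_norm_def by (rule onorm) simp
  also have "\<dots> \<le> L' * norm (x - y) * norm v"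
    by (intro mult_right_mono hessian_lipschitz) simp
  finally show ?thesis .
qed

text \<open>Testing against the error vector \<open>w\<close> itself reduces the vector estimate to
  monotonicity of a scalar function along the segment, after which one factor \<open>norm w\<close>
  cancels.\<close>

lemma grad_taylor:
  "norm (g (y + v) - g y - hessian U y *v v) \<le> L' / 2 * (norm v)\<^sup>2"
proof -
  define w where "w = g (y + v) - g y - hessian U y *v v"
  define \<phi> where "\<phi> t = w \<bullet> g (y + t *\<^sub>R v) - t * (w \<bullet> (hessian U y *v v)) - norm w * L' * (norm v)\<^sup>2 * t\<^sup>2 / 2" for t
  have "\<phi> 1 \<le> \<phi> 0"
  proof (rule DERIV_nonpos_imp_nonincreasing, simp)
    fix t :: real assume t: "0 \<le> t" "t \<le> 1"
    let ?d = "w \<bullet> (hessian U (y + t *\<^sub>R v) *v v) - w \<bullet> (hessian U y *v v) - norm w * L' * (norm v)\<^sup>2 * t"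
    have "(\<phi> has_real_derivative ?d) (at t)"
      unfolding \<phi>_def by (auto intro!: derivative_eq_intros grad_along_line)
    moreover have "?d \<le> 0"
    proof -
      have "w \<bullet> (hessian U (y + t *\<^sub>R v) *v v) - w \<bullet> (hessian U y *v v)
          = w \<bullet> ((hessian U (y + t *\<^sub>R v) - hessian U y) *v v)"
        by (simp add: inner_diff_right matrix_vector_mult_diff_rdistrib)
      also have "\<dots> \<le> norm w * (L' * norm (y + t *\<^sub>R v - y) * norm v)"
        by (intro order_trans[OF norm_cauchy_schwarz] mult_left_mono hessian_diff_bound) simp
      finally show ?thesis using t by (simp add: power2_eq_square mult_ac)
    qed
    ultimately show "\<exists>d. (\<phi> has_real_derivative d) (at t) \<and> d \<le> 0" by blast
  qed
  then have "norm w * norm w \<le> norm w * (L' / 2 * (norm v)\<^sup>2)"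
    unfolding \<phi>_def by (simp add: power2_norm_eq_inner[symmetric] power2_eq_square[symmetric])
      (simp add: w_def power2_norm_eq_inner inner_diff_right mult_ac)
  then have "norm w \<le> L' / 2 * (norm v)\<^sup>2"
    using L'_nonneg by (cases "w = 0") auto
  then show ?thesis by (simp add: w_def)
qed

text \<open>The Hessian terms for \<open>v\<close> and \<open>- v\<close> cancel. This is the
  analytic half of the reflection argument in \<open>gradient_drift\<close>.\<close>

lemma grad_symmetric_difference:
  "norm ((1 / 2) *\<^sub>R (g (y + v) + g (y - v)) - g y) \<le> L' / 2 * (norm v)\<^sup>2"
proof -
  have neg: "hessian U y *v (- v) = - (hessian U y *v v)"
    using linear_neg[OF matrix_vector_mul_linear, of "hessian U y" v] by simp
  have "(1 / 2) *\<^sub>R (g (y + v) + g (y - v)) - g y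
     = (1 / 2) *\<^sub>R ((g (y + v) - g y - hessian U y *v v) + (g (y + (- v)) - g y - hessian U y *v (- v)))"
    unfolding neg by (simp add: vec_eq_iff field_simps)
  also have "norm \<dots> \<le> (1 / 2) * (L' / 2 * (norm v)\<^sup>2 + L' / 2 * (norm (- v))\<^sup>2)"
    unfolding norm_scaleR by (intro mult_mono order_trans[OF norm_triangle_ineq] add_mono grad_taylor) auto
  finally show ?thesis by simp
qed

text \<open>The derivative of the quadrature error on the segment from \<open>x\<close> to
  \<open>x + t *\<^sub>R v\<close> is half a Taylor remainder of \<open>g\<close>, expanded at the
  moving endpoint back towards \<open>x\<close>.\<close>

lemma trapezoid_error:
  "\<bar>U (x + v) - U x - (1 / 2) * ((g x + g (x + v)) \<bullet> v)\<bar> \<le> L' / 4 * norm v ^ 3"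
proof -
  define \<phi> where "\<phi> t = U (x + t *\<^sub>R v) - t / 2 * (v \<bullet> g x + v \<bullet> g (x + t *\<^sub>R v))" for t
  define \<phi>' where "\<phi>' t = g (x + t *\<^sub>R v) \<bullet> v - (1 / 2) * (v \<bullet> g x + v \<bullet> g (x + t *\<^sub>R v))
      - t / 2 * (v \<bullet> (hessian U (x + t *\<^sub>R v) *v v))" for t
  have "(\<phi> has_real_derivative \<phi>' t) (at t)" for t
    unfolding \<phi>_def \<phi>'_def
    by (auto intro!: derivative_eq_intros grad_along_line U_along_line simp: algebra_simps)
  then obtain t where t: "0 < t" "t < 1" "\<phi> 1 - \<phi> 0 = (1 - 0) * \<phi>' t"
    using MVT2[of 0 1 \<phi> \<phi>'] by auto
  let ?z = "x + t *\<^sub>R v"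
  have "\<phi>' t = - (1 / 2) * (v \<bullet> (g (?z + (- (t *\<^sub>R v))) - g ?z - hessian U ?z *v (- (t *\<^sub>R v))))"
  proof -
    have "hessian U ?z *v (- (t *\<^sub>R v)) = - (t *\<^sub>R (hessian U ?z *v v))"
      by (simp add: vec_eq_iff matrix_vector_mult_def sum_negf sum_distrib_left mult_ac)
    then show ?thesis by (simp add: \<phi>'_def inner_diff_right inner_add_right inner_commute algebra_simps)
  qed
  also have "\<bar>\<dots>\<bar> \<le> 1 / 2 * (norm v * (L' / 2 * (norm (- (t *\<^sub>R v)))\<^sup>2))"
  proof -
    have "\<bar>v \<bullet> (g (?z + (- (t *\<^sub>R v))) - g ?z - hessian U ?z *v (- (t *\<^sub>R v)))\<bar>
        \<le> norm v * (L' / 2 * (norm (- (t *\<^sub>R v)))\<^sup>2)"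
      by (intro order_trans[OF Cauchy_Schwarz_ineq2] mult_left_mono grad_taylor) simp
    then show ?thesis by simp
  qed
  also have "\<dots> = t\<^sup>2 * (L' / 4 * norm v ^ 3)"
    by (simp add: power2_eq_square power3_eq_cube)
  also have "\<dots> \<le> 1 * (L' / 4 * norm v ^ 3)"
    using t L'_nonneg by (intro mult_right_mono) (auto simp: power_le_one)
  finally have "\<bar>\<phi> 1 - \<phi> 0\<bar> \<le> L' / 4 * norm v ^ 3" using t by simp
  then show ?thesis by (simp add: \<phi>_def inner_add_left inner_commute algebra_simps)
qed

lemma descent: "U (y + v) \<le> U y + g y \<bullet> v + L / 2 * (norm v)\<^sup>2"
proof -
  define \<phi> where "\<phi> t = U (y + t *\<^sub>R v) - t * (g y \<bullet> v) - L / 2 * (norm v)\<^sup>2 * t\<^sup>2" for t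
  have "\<phi> 1 \<le> \<phi> 0"
  proof (rule DERIV_nonpos_imp_nonincreasing, simp)
    fix t :: real assume t: "0 \<le> t" "t \<le> 1"
    let ?d = "g (y + t *\<^sub>R v) \<bullet> v - g y \<bullet> v - L * (norm v)\<^sup>2 * t"
    have "(\<phi> has_real_derivative ?d) (at t)"
      unfolding \<phi>_def by (auto intro!: derivative_eq_intros U_along_line)
    moreover have "(g (y + t *\<^sub>R v) - g y) \<bullet> v \<le> (L * norm (y + t *\<^sub>R v - y)) * norm v"
      by (intro order_trans[OF norm_cauchy_schwarz] mult_right_mono grad_lipschitz) simp
    then have "?d \<le> 0" using t by (simp add: power2_eq_square inner_diff_left mult_ac)
    ultimately show "\<exists>d. (\<phi> has_real_derivative d) (at t) \<and> d \<le> 0" by blast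
  qed
  then show ?thesis by (simp add: \<phi>_def)
qed

section \<open>Convexity, co-coercivity and the minimizer\<close>

lemma strongly_monotone: "m * (norm (x - y))\<^sup>2 \<le> (g x - g y) \<bullet> (x - y)"
  using strongly_convex[of x y] strongly_convex[of y x]
  by (simp add: norm_minus_commute inner_diff_left inner_diff_right)

lemma m_le_L: "m \<le> L"
proof -
  obtain e :: "real ^ 'n" where e: "norm e = 1" using vector_choose_size[of 1] by auto
  have "m * (norm (e - 0))\<^sup>2 \<le> (g e - g 0) \<bullet> (e - 0)" by (rule strongly_monotone)
  also have "\<dots> \<le> (L * norm (e - 0)) * norm (e - 0)"
    by (intro order_trans[OF norm_cauchy_schwarz] mult_right_mono grad_lipschitz) simp
  finally show ?thesis using e by simp
qed

lemma L_pos: "0 < L"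
  using m_le_L m_pos by simp

text \<open>\<open>k\<close> is the gradient of the convex function \<open>F\<close>, whose gradient
  has Lipschitz constant at most L - m. Comparing its supporting plane at one point with its
  quadratic majorant at the other gives co-coercivity. A positive \<open>M\<close> stands in for L -
  m, which may vanish.\<close>

lemma cocoercive_aux:
  assumes "0 < M" "L - m \<le> M"
  shows "(norm ((g x - m *\<^sub>R x) - (g y - m *\<^sub>R y)))\<^sup>2
    \<le> M * (((g x - m *\<^sub>R x) - (g y - m *\<^sub>R y)) \<bullet> (x - y))"
proof -
  define k where "k x = g x - m *\<^sub>R x" for x
  define F where "F x = U x - m / 2 * (norm x)\<^sup>2" for x
  have lower: "F x + k x \<bullet> (z - x) \<le> F z" for x z
    using strongly_convex[of x z]
    by (simp add: F_def k_def power2_norm_eq_inner inner_diff_left inner_diff_right inner_commute field_simps)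
  have upper: "F z \<le> F y + k y \<bullet> (z - y) + M / 2 * (norm (z - y))\<^sup>2" for y z
  proof -
    have "F z \<le> F y + k y \<bullet> (z - y) + (L - m) / 2 * (norm (z - y))\<^sup>2"
      using descent[of y "z - y"]
      by (simp add: F_def k_def power2_norm_eq_inner inner_diff_left inner_diff_right inner_commute field_simps)
    moreover have "(L - m) / 2 * (norm (z - y))\<^sup>2 \<le> M / 2 * (norm (z - y))\<^sup>2"
      using assms by (intro mult_right_mono) auto
    ultimately show ?thesis by linarith
  qed
  have half: "F x - F y + k x \<bullet> (y - x) + (norm (k x - k y))\<^sup>2 / (2 * M) \<le> 0" for x y
  proof -
    \<comment> \<open>The maximizer of
      \<open>(k x - k y) \<bullet> w - M / 2 * (norm w)\<^sup>2\<close>.\<close>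
    define w where "w = (1 / M) *\<^sub>R (k x - k y)"
    have "F x + k x \<bullet> (y + w - x) \<le> F y + k y \<bullet> w + M / 2 * (norm w)\<^sup>2"
      using lower[of x "y + w"] upper[of "y + w" y] by simp
    then have "F x - F y + k x \<bullet> (y - x) + (k x - k y) \<bullet> w - M / 2 * (norm w)\<^sup>2 \<le> 0"
      by (simp add: inner_diff_left inner_diff_right inner_add_right)
    moreover have "(k x - k y) \<bullet> w = (norm (k x - k y))\<^sup>2 / M"
      by (simp add: w_def power2_norm_eq_inner)
    moreover have "M / 2 * (norm w)\<^sup>2 = (norm (k x - k y))\<^sup>2 / (2 * M)"
      using assms by (simp add: w_def power_divide power2_eq_square)
    ultimately show ?thesis using assms by (simp add: field_simps)
  qed
  have "(norm (k x - k y))\<^sup>2 / M \<le> (k x - k y) \<bullet> (x - y)"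
  proof -
    have "(norm (k x - k y))\<^sup>2 / M = 2 * ((norm (k x - k y))\<^sup>2 / (2 * M))" by simp
    then show ?thesis
      using half[of x y] half[of y x]
      by (simp add: norm_minus_commute inner_diff_left inner_diff_right)
  qed
  then show ?thesis using assms by (simp add: k_def field_simps)
qed

text \<open>The two terms on the left have separate uses: the first gives the contraction, the
  second pays for the squared gradient difference in an Euler step.\<close>

lemma cocoercive:
  "m * L * (norm (x - y))\<^sup>2 + (norm (g x - g y))\<^sup>2 \<le> (m + L) * ((g x - g y) \<bullet> (x - y))"
proof -
  define D where "D = g x - g y"
  define w where "w = x - y"
  have eq: "(g x - m *\<^sub>R x) - (g y - m *\<^sub>R y) = D - m *\<^sub>R w"
    by (simp add: D_def w_def algebra_simps)
  have p: "0 \<le> (D - m *\<^sub>R w) \<bullet> w"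
    using strongly_monotone[of x y] by (simp add: D_def w_def inner_diff_left power2_norm_eq_inner)
  have "(norm (D - m *\<^sub>R w))\<^sup>2 \<le> (L - m) * ((D - m *\<^sub>R w) \<bullet> w)"
  proof (rule field_le_epsilon)
    fix e :: real assume e: "0 < e"
    let ?p = "(D - m *\<^sub>R w) \<bullet> w"
    \<comment> \<open>This \<open>M\<close> is positive even when L = m, and exceeds L - m by so
      little that the surplus is at most \<open>e\<close>.\<close>
    have "(norm (D - m *\<^sub>R w))\<^sup>2 \<le> (L - m + e / (?p + 1)) * ?p"
      using cocoercive_aux[of "L - m + e / (?p + 1)" x y] m_le_L e p eq by (simp add: w_def add_nonneg_pos)
    also have "\<dots> \<le> (L - m) * ?p + e"
      using e p by (simp add: field_simps)
    finally show "(norm (D - m *\<^sub>R w))\<^sup>2 \<le> (L - m) * ?p + e" .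
  qed
  then have "m * L * (norm w)\<^sup>2 + (norm D)\<^sup>2 \<le> (m + L) * (D \<bullet> w)"
    by (simp add: power2_norm_eq_inner inner_diff_left inner_diff_right inner_commute algebra_simps)
  then show ?thesis by (simp add: D_def w_def)
qed

lemma minimizer_le: "U xs \<le> U y"
proof -
  \<comment> \<open>Beyond this radius the quadratic term of strong convexity at 0 outweighs the
    linear one, so U is at least \<open>U 0\<close> there.\<close>
  define r where "r = 2 * norm (g 0) / m"
  have r: "0 \<le> r" using m_pos by (simp add: r_def)
  obtain z where z: "z \<in> cball 0 r" "\<And>y. y \<in> cball 0 r \<Longrightarrow> U z \<le> U y"
  proof -
    have "cball (0::real ^ 'n) r \<noteq> {}" using r by simp
    then show ?thesis
      using continuous_attains_inf[OF compact_cball _ continuous_on_subset[OF continuous_U subset_UNIV]] that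
      by blast
  qed
  have zmin: "U z \<le> U y" for y
  proof (cases "y \<in> cball 0 r")
    case False
    have "norm (g 0) = m / 2 * r" using m_pos by (simp add: r_def)
    also have "\<dots> \<le> m / 2 * norm y" using False m_pos by (intro mult_left_mono) auto
    finally have "norm (g 0) * norm y \<le> m / 2 * norm y * norm y"
      by (rule mult_right_mono) simp
    moreover have "- (norm (g 0) * norm y) \<le> g 0 \<bullet> y"
      using Cauchy_Schwarz_ineq2[of "g 0" y] by linarith
    ultimately have "U 0 \<le> U y"
      using strongly_convex[of 0 y] by (simp add: power2_eq_square)
    then show ?thesis using z(2)[of 0] r by simp
  qed (use z in auto)
  have zgrad: "g z = 0"
  proof -
    have "(\<lambda>h. h \<bullet> g z) = (\<lambda>h. 0)"
      by (rule differential_zero_maxmin[OF _ open_UNIV U_has_derivative]) (use zmin in auto)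
    then have "g z \<bullet> g z = 0" by metis
    then show ?thesis by simp
  qed
  have "xs = z"
    unfolding minimizer_def
  proof (rule the_equality)
    fix z' assume "\<forall>y. U z' \<le> U y"
    then have "U z' \<le> U z" by simp
    then have "m / 2 * (norm (z - z'))\<^sup>2 \<le> 0"
      using strongly_convex[of z z'] zgrad by simp
    then show "z' = z" using m_pos by (simp add: mult_le_0_iff)
  qed (use zmin in auto)
  then show ?thesis using zmin by simp
qed

lemma grad_minimizer: "g xs = 0"
proof -
  have "(\<lambda>h. h \<bullet> g xs) = (\<lambda>h. 0)"
    by (rule differential_zero_maxmin[OF _ open_UNIV U_has_derivative]) (use minimizer_le in auto)
  then have "g xs \<bullet> g xs = 0" by metis
  then show ?thesis by simp
qed

lemma norm_grad_le: "norm (g y) \<le> L * norm (y - xs)"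
  using grad_lipschitz[of y xs] grad_minimizer by simp

lemma U_lower: "U xs + m / 2 * (norm (y - xs))\<^sup>2 \<le> U y"
  using strongly_convex[of xs y] grad_minimizer by (simp add: norm_minus_commute)

lemma grad_inner_lower: "m * (norm (y - xs))\<^sup>2 \<le> g y \<bullet> (y - xs)"
  using strongly_monotone[of y xs] grad_minimizer by simp

end

section \<open>Isotropic Gaussian measures\<close>

text \<open>A product over coordinates, so that integrals and convolutions factor into
  one-dimensional ones. \<sigma> is a standard deviation, not a variance.\<close>

definition gauss_density :: "real \<Rightarrow> 'a::euclidean_space \<Rightarrow> real" where
  "gauss_density \<sigma> x = (\<Prod>b\<in>Basis. normal_density 0 \<sigma> (x \<bullet> b))"

definition std_gauss :: "'a::euclidean_space measure" where
  "std_gauss = density lborel (\<lambda>z. ennreal (gauss_density 1 z))"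

lemma gauss_density_nonneg [simp]: "0 \<le> gauss_density \<sigma> x"
  by (simp add: gauss_density_def prod_nonneg)

lemma measurable_gauss_density [measurable]: "gauss_density \<sigma> \<in> borel_measurable borel"
  unfolding gauss_density_def[abs_def] by measurable

lemma gauss_density_eq:
  fixes x :: "'a::euclidean_space"
  shows "gauss_density \<sigma> x = exp (- (norm x)\<^sup>2 / (2 * \<sigma>\<^sup>2)) / sqrt (2 * pi * \<sigma>\<^sup>2) ^ DIM('a)"
proof -
  have "(\<Sum>b\<in>Basis. (x \<bullet> b)\<^sup>2) = (norm x)\<^sup>2"
    unfolding power2_norm_eq_inner euclidean_inner[of x x] by (simp add: power2_eq_square)
  then show ?thesis
    by (simp add: gauss_density_def normal_density_def prod_dividef exp_sum[symmetric]
        sum_divide_distrib[symmetric] sum_negf)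
qed

lemma nn_integral_gauss_density:
  assumes "0 < \<sigma>"
  shows "(\<integral>\<^sup>+x. ennreal (gauss_density \<sigma> (x :: 'a::euclidean_space)) \<partial>lborel) = 1"
proof -
  have "(\<integral>\<^sup>+x. ennreal (gauss_density \<sigma> (x :: 'a)) \<partial>lborel)
      = (\<integral>\<^sup>+x. (\<Prod>b\<in>Basis. ennreal (normal_density 0 \<sigma> ((x :: 'a) \<bullet> b))) \<partial>lborel)"
    by (simp add: gauss_density_def prod_ennreal)
  also have "\<dots> = (\<Prod>b\<in>(Basis :: 'a set). (\<integral>\<^sup>+x. ennreal (normal_density 0 \<sigma> x) \<partial>lborel))"
    by (rule nn_integral_lborel_prod) auto
  also have "\<dots> = 1"
    using assms by (simp add: nn_integral_eq_integral)
  finally show ?thesis .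
qed

lemma nn_integral_lborel_affine:
  fixes f :: "'a::euclidean_space \<Rightarrow> ennreal"
  assumes [measurable]: "f \<in> borel_measurable borel" and "c \<noteq> 0"
  shows "(\<integral>\<^sup>+x. f x \<partial>lborel) = ennreal (\<bar>c\<bar> ^ DIM('a)) * (\<integral>\<^sup>+x. f (t + c *\<^sub>R x) \<partial>lborel)"
  by (subst lborel_affine[OF assms(2), of t])
    (simp add: nn_integral_density nn_integral_distr nn_integral_cmult)

lemma prob_space_std_gauss: "prob_space (std_gauss :: 'a::euclidean_space measure)"
  by (rule prob_spaceI) (simp add: std_gauss_def emeasure_density nn_integral_gauss_density)

lemma sets_std_gauss [simp, measurable_cong]: "sets std_gauss = sets borel"
  and space_std_gauss [simp]: "space std_gauss = UNIV"
  by (simp_all add: std_gauss_def)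

lemma nn_integral_std_gauss:
  "f \<in> borel_measurable borel \<Longrightarrow>
    (\<integral>\<^sup>+z. f z \<partial>std_gauss) = (\<integral>\<^sup>+z. ennreal (gauss_density 1 z) * f z \<partial>lborel)"
  unfolding std_gauss_def by (subst nn_integral_density) auto

lemma gauss_density_scale:
  fixes z :: "'a::euclidean_space"
  assumes "c \<noteq> 0"
  shows "\<bar>c\<bar> ^ DIM('a) * gauss_density \<bar>c\<bar> (c *\<^sub>R z) = gauss_density 1 z"
  using assms
  by (simp add: gauss_density_eq real_sqrt_mult power_mult_distrib)

lemma nn_integral_std_gauss_affine:
  fixes f :: "'a::euclidean_space \<Rightarrow> ennreal"
  assumes [measurable]: "f \<in> borel_measurable borel" and c: "c \<noteq> 0"
  shows "(\<integral>\<^sup>+z. f (t + c *\<^sub>R z) \<partial>std_gauss) = (\<integral>\<^sup>+y. ennreal (gauss_density \<bar>c\<bar> (y - t)) * f y \<partial>lborel)"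
proof -
  have "(\<integral>\<^sup>+y. ennreal (gauss_density \<bar>c\<bar> (y - t)) * f y \<partial>lborel)
      = ennreal (\<bar>c\<bar> ^ DIM('a)) * (\<integral>\<^sup>+z. ennreal (gauss_density \<bar>c\<bar> (c *\<^sub>R z)) * f (t + c *\<^sub>R z) \<partial>lborel)"
    by (subst nn_integral_lborel_affine[OF _ c, of _ t]) auto
  also have "\<dots> = (\<integral>\<^sup>+z. ennreal (gauss_density 1 z) * f (t + c *\<^sub>R z) \<partial>lborel)"
    by (subst nn_integral_cmult[symmetric])
      (auto simp: gauss_density_scale[OF c, symmetric] ennreal_mult mult.assoc)
  also have "\<dots> = (\<integral>\<^sup>+z. f (t + c *\<^sub>R z) \<partial>std_gauss)"
    by (subst nn_integral_std_gauss) auto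
  finally show ?thesis by simp
qed

lemma distr_std_gauss_affine:
  assumes "c \<noteq> 0"
  shows "distr std_gauss borel (\<lambda>z. t + c *\<^sub>R z) = density lborel (\<lambda>y. ennreal (gauss_density \<bar>c\<bar> (y - t)))"
proof (rule measure_eqI)
  fix A assume "A \<in> sets (distr std_gauss borel (\<lambda>z. t + c *\<^sub>R z))"
  then have [measurable]: "A \<in> sets borel" by simp
  have "emeasure (distr std_gauss borel (\<lambda>z. t + c *\<^sub>R z)) A
      = (\<integral>\<^sup>+y. indicator A y \<partial>distr std_gauss borel (\<lambda>z. t + c *\<^sub>R z))"
    by simp
  also have "\<dots> = (\<integral>\<^sup>+z. indicator A (t + c *\<^sub>R z) \<partial>std_gauss)"
    by (rule nn_integral_distr) auto
  also have "\<dots> = emeasure (density lborel (\<lambda>y. ennreal (gauss_density \<bar>c\<bar> (y - t)))) A"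
    by (subst nn_integral_std_gauss_affine[OF _ assms]) (auto simp: emeasure_density)
  finally show "emeasure (distr std_gauss borel (\<lambda>z. t + c *\<^sub>R z)) A
    = emeasure (density lborel (\<lambda>y. ennreal (gauss_density \<bar>c\<bar> (y - t)))) A" .
qed simp

lemma distr_std_gauss_uminus: "distr std_gauss borel uminus = std_gauss"
  using distr_std_gauss_affine[of "-1" 0] by (simp add: std_gauss_def)

lemma gauss_density_convolution:
  assumes "0 < a" "0 < b"
  shows "(\<integral>\<^sup>+u. ennreal (gauss_density a (y - u)) * ennreal (gauss_density b u) \<partial>lborel)
    = ennreal (gauss_density (sqrt (a\<^sup>2 + b\<^sup>2)) (y :: 'a::euclidean_space))"
proof -
  have "(\<integral>\<^sup>+u. ennreal (gauss_density a (y - u)) * ennreal (gauss_density b u) \<partial>lborel)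
     = (\<integral>\<^sup>+u. (\<Prod>i\<in>Basis. ennreal (normal_density 0 a (y \<bullet> i - u \<bullet> i) * normal_density 0 b (u \<bullet> i))) \<partial>lborel)"
    by (simp add: gauss_density_def prod_ennreal ennreal_mult[symmetric] prod_nonneg prod.distrib inner_diff_left)
  also have "\<dots> = (\<Prod>i\<in>Basis. (\<integral>\<^sup>+u. ennreal (normal_density 0 a (y \<bullet> i - u) * normal_density 0 b u) \<partial>lborel))"
    by (rule nn_integral_lborel_prod) auto
  also have "\<dots> = (\<Prod>i\<in>Basis. ennreal (normal_density 0 (sqrt (a\<^sup>2 + b\<^sup>2)) (y \<bullet> i)))"
    using fun_cong[OF conv_normal_density_zero_mean[OF assms]] by simp
  finally show ?thesis by (simp add: gauss_density_def prod_ennreal)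
qed

interpretation std_gauss: prob_space "std_gauss :: 'a::euclidean_space measure"
  by (rule prob_space_std_gauss)

text \<open>\<open>a = 0\<close> is included because the accumulated noise of the chain starts at 0,
  where it has no density.\<close>

lemma nn_integral_std_gauss_sum:
  fixes f :: "'a::euclidean_space \<Rightarrow> ennreal"
  assumes f[measurable]: "f \<in> borel_measurable borel" and a: "0 \<le> a" and b: "0 < b"
  shows "(\<integral>\<^sup>+s. \<integral>\<^sup>+z. f (a *\<^sub>R s + b *\<^sub>R z) \<partial>std_gauss \<partial>std_gauss)
    = (\<integral>\<^sup>+z. f (sqrt (a\<^sup>2 + b\<^sup>2) *\<^sub>R z) \<partial>std_gauss)"
proof (cases "a = 0")
  case True
  then show ?thesis using b by (simp add: std_gauss.emeasure_space_1[simplified])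
next
  case False
  then have a: "0 < a" using a by simp
  define c where "c = sqrt (a\<^sup>2 + b\<^sup>2)"
  have c: "0 < c" unfolding c_def using a b by (simp add: add_pos_pos)
  have "(\<integral>\<^sup>+s. \<integral>\<^sup>+z. f (a *\<^sub>R s + b *\<^sub>R z) \<partial>std_gauss \<partial>std_gauss)
      = (\<integral>\<^sup>+s. \<integral>\<^sup>+y. ennreal (gauss_density b (y - a *\<^sub>R s)) * f y \<partial>lborel \<partial>std_gauss)"
    using nn_integral_std_gauss_affine[OF f, of b] b by simp
  also have "\<dots> = (\<integral>\<^sup>+s. ennreal (gauss_density a s) *
      (\<integral>\<^sup>+y. ennreal (gauss_density b (y - s)) * f y \<partial>lborel) \<partial>lborel)"
    using nn_integral_std_gauss_affine[of "\<lambda>s. \<integral>\<^sup>+y. ennreal (gauss_density b (y - s)) * f y \<partial>lborel" a 0] a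
    by simp
  also have "\<dots> = (\<integral>\<^sup>+s. \<integral>\<^sup>+y. ennreal (gauss_density b (y - s)) * ennreal (gauss_density a s) * f y \<partial>lborel \<partial>lborel)"
    by (subst nn_integral_cmult[symmetric]) (simp_all add: mult_ac)
  also have "\<dots> = (\<integral>\<^sup>+y. \<integral>\<^sup>+s. ennreal (gauss_density b (y - s)) * ennreal (gauss_density a s) * f y \<partial>lborel \<partial>lborel)"
    by (rule lborel_pair.Fubini') simp
  also have "\<dots> = (\<integral>\<^sup>+y. ennreal (gauss_density c y) * f y \<partial>lborel)"
    by (subst nn_integral_multc) (auto simp: gauss_density_convolution[OF b a] c_def add.commute)
  also have "\<dots> = (\<integral>\<^sup>+z. f (c *\<^sub>R z) \<partial>std_gauss)"
    using nn_integral_std_gauss_affine[OF f, of c 0] c by simp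
  finally show ?thesis by (simp add: c_def)
qed

lemma nn_integral_std_gauss_norm2:
  "(\<integral>\<^sup>+z. ennreal ((norm (z :: 'a::euclidean_space))\<^sup>2) \<partial>std_gauss) = ennreal (real DIM('a))"
proof -
  have "(\<integral>\<^sup>+z. ennreal ((norm (z :: 'a))\<^sup>2) \<partial>std_gauss)
      = (\<integral>\<^sup>+z. (\<Sum>b\<in>Basis. ennreal (((z :: 'a) \<bullet> b)\<^sup>2)) \<partial>std_gauss)"
    unfolding power2_norm_eq_inner by (subst euclidean_inner) (simp add: power2_eq_square)
  also have "\<dots> = (\<Sum>b\<in>(Basis :: 'a set). \<integral>\<^sup>+z. ennreal ((z \<bullet> b)\<^sup>2) \<partial>std_gauss)"
    by (rule nn_integral_sum) simp
  also have "\<dots> = (\<Sum>b\<in>(Basis :: 'a set). 1)"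
  proof (rule sum.cong)
    fix b :: 'a assume b: "b \<in> Basis"
    define F where "F i = (\<lambda>t. if i = b then ennreal (std_normal_density t * t\<^sup>2) else ennreal (std_normal_density t))" for i :: 'a
    have "(\<integral>\<^sup>+z. ennreal ((z \<bullet> b)\<^sup>2) \<partial>std_gauss)
        = (\<integral>\<^sup>+z. ennreal (gauss_density 1 z) * ennreal ((z \<bullet> b)\<^sup>2) \<partial>lborel)"
      by (subst nn_integral_std_gauss) auto
    also have "\<dots> = (\<integral>\<^sup>+z. (\<Prod>i\<in>Basis. F i (z \<bullet> i)) \<partial>lborel)"
      by (intro nn_integral_cong)
        (simp add: F_def gauss_density_def prod_ennreal prod.remove[OF finite_Basis b] ennreal_mult prod_nonneg mult_ac)
    also have "\<dots> = (\<Prod>i\<in>Basis. (\<integral>\<^sup>+t. F i t \<partial>lborel))"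
      by (rule nn_integral_lborel_prod) (auto simp: F_def)
    also have "\<dots> = 1"
    proof (rule prod.neutral, rule ballI)
      fix i :: 'a
      have "(\<integral>\<^sup>+t. ennreal (std_normal_density t * t\<^sup>2) \<partial>lborel) = 1"
        using std_normal_moment_even[of 1]
        by (subst nn_integral_eq_integral) (auto simp: has_bochner_integral_iff fact_numeral)
      moreover have "(\<integral>\<^sup>+t. ennreal (std_normal_density t) \<partial>lborel) = 1"
        by (simp add: nn_integral_eq_integral)
      ultimately show "(\<integral>\<^sup>+t. F i t \<partial>lborel) = 1"
        by (cases "i = b") (simp_all add: F_def)
    qed
    finally show "(\<integral>\<^sup>+z. ennreal ((z \<bullet> b)\<^sup>2) \<partial>std_gauss) = 1" .
  qed simp
  finally show ?thesis by (simp add: ennreal_of_nat_eq_real_of_nat)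
qed

lemma sqint_std_gauss: "sqint std_gauss (\<lambda>z. z :: 'a::euclidean_space)"
  and l2_std_gauss: "(l2 std_gauss (\<lambda>z. z :: 'a::euclidean_space))\<^sup>2 = real DIM('a)"
proof -
  have "has_bochner_integral std_gauss (\<lambda>z. (norm (z::'a))\<^sup>2) (real DIM('a))"
    by (rule has_bochner_integral_nn_integral) (simp_all add: nn_integral_std_gauss_norm2)
  then show "sqint std_gauss (\<lambda>z::'a. z)" "(l2 std_gauss (\<lambda>z. z :: 'a))\<^sup>2 = real DIM('a)"
    by (auto simp: sqint_def l2_power2 has_bochner_integral_iff)
qed

section \<open>Polynomial moments under Gaussian decay\<close>

lemma integrable_exp_neg_norm2:
  assumes "0 < b"
  shows "integrable lborel (\<lambda>y :: 'a::euclidean_space. exp (- b * (norm (y - t))\<^sup>2))"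
proof -
  define \<sigma> where "\<sigma> = sqrt (1 / (2 * b))"
  have \<sigma>: "0 < \<sigma>" "\<sigma>\<^sup>2 = 1 / (2 * b)" using assms by (simp_all add: \<sigma>_def)
  have "(\<integral>\<^sup>+y. ennreal (gauss_density \<sigma> (y - t)) \<partial>lborel) = 1"
    using nn_integral_lborel_affine[of "\<lambda>y. ennreal (gauss_density \<sigma> (y - t))" 1 t]
      nn_integral_gauss_density[OF \<sigma>(1), where 'a='a] by simp
  then have "integrable lborel (\<lambda>y. gauss_density \<sigma> (y - t))"
    by (intro integrableI_nonneg) auto
  then have "integrable lborel (\<lambda>y. sqrt (2 * pi * \<sigma>\<^sup>2) ^ DIM('a) * gauss_density \<sigma> (y - t))"
    by simp
  moreover have "sqrt (2 * pi * \<sigma>\<^sup>2) ^ DIM('a) * gauss_density \<sigma> (y - t) = exp (- b * (norm (y - t))\<^sup>2)" for y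
    using \<sigma> assms by (simp add: gauss_density_eq[where \<sigma>=\<sigma>] mult.commute)
  ultimately show ?thesis by simp
qed

text \<open>From 1 + u \<le> exp u and completing a square. It trades a polynomial factor for an
  arbitrarily small part of the Gaussian decay.\<close>

lemma power_le_exp_square:
  assumes "0 \<le> a" "0 < b" "0 \<le> t"
  shows "(1 + a * t) ^ k \<le> exp ((real k * a)\<^sup>2 / (4 * b)) * exp (b * t\<^sup>2)"
proof -
  have "(1 + a * t) ^ k \<le> exp (a * t) ^ k"
    using assms by (intro power_mono) (auto simp: exp_ge_add_one_self)
  also have "\<dots> = exp (real k * (a * t))"
    by (simp add: exp_of_nat_mult)
  also have "\<dots> \<le> exp ((real k * a)\<^sup>2 / (4 * b) + b * t\<^sup>2)"
  proof -
    have "0 \<le> (real k * a - 2 * b * t)\<^sup>2 / (4 * b)" using assms by simp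
    also have "\<dots> = (real k * a)\<^sup>2 / (4 * b) + b * t\<^sup>2 - real k * (a * t)"
      using assms by (simp add: field_simps power2_eq_square)
    finally show ?thesis by simp
  qed
  finally show ?thesis by (simp add: exp_add)
qed

lemma integrable_power_exp_neg_norm2:
  assumes "0 \<le> a" "0 < b"
  shows "integrable lborel (\<lambda>y :: 'a::euclidean_space. (1 + a * norm (y - t)) ^ k * exp (- b * (norm (y - t))\<^sup>2))"
proof (rule Bochner_Integration.integrable_bound)
  show "integrable lborel (\<lambda>y. exp ((real k * a)\<^sup>2 / (4 * (b / 2))) * exp (- (b / 2) * (norm (y - t))\<^sup>2))"
    using assms by (intro integrable_mult_right integrable_exp_neg_norm2) auto
  have "(1 + a * s) ^ k * exp (- b * s\<^sup>2) \<le> exp ((real k * a)\<^sup>2 / (4 * (b / 2))) * exp (- (b / 2) * s\<^sup>2)"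
    if "0 \<le> s" for s
  proof -
    have "(1 + a * s) ^ k * exp (- b * s\<^sup>2)
        \<le> exp ((real k * a)\<^sup>2 / (4 * (b / 2))) * exp (b / 2 * s\<^sup>2) * exp (- b * s\<^sup>2)"
      using assms that by (intro mult_right_mono power_le_exp_square) auto
    also have "\<dots> = exp ((real k * a)\<^sup>2 / (4 * (b / 2))) * exp (- (b / 2) * s\<^sup>2)"
      by (simp add: exp_add[symmetric] mult.assoc)
    finally show ?thesis .
  qed
  then show "AE y in lborel. norm ((1 + a * norm (y - t)) ^ k * exp (- b * (norm (y - t))\<^sup>2))
      \<le> norm (exp ((real k * a)\<^sup>2 / (4 * (b / 2))) * exp (- (b / 2) * (norm (y - t))\<^sup>2))"
    using assms by (intro AE_I2) simp
qed simp

lemma integrable_std_gauss_power: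
  assumes "0 \<le> a"
  shows "integrable std_gauss (\<lambda>z :: 'a::euclidean_space. (1 + a * norm z) ^ k)"
proof -
  have "integrable lborel (\<lambda>z :: 'a. (1 / sqrt (2 * pi) ^ DIM('a)) *
      ((1 + a * norm (z - 0)) ^ k * exp (- (1 / 2) * (norm (z - 0))\<^sup>2)))"
    using assms by (intro integrable_mult_right integrable_power_exp_neg_norm2) auto
  then show ?thesis
    unfolding std_gauss_def
    by (subst integrable_density) (auto simp: gauss_density_eq[where \<sigma>=1] mult_ac)
qed

text \<open>\<open>matrix_inv\<close> is a choice operator, so the inverse is reached only through
  its defining equation. Note that \<open>v\<close> is a variance here.\<close>

lemma gaussian_isotropic:
  fixes \<mu> :: "real ^ 'n"
  assumes "0 < v"
  shows "gaussian \<mu> (v *\<^sub>R mat 1) = distr std_gauss borel (\<lambda>z. \<mu> + sqrt v *\<^sub>R z)"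
proof -
  let ?A = "v *\<^sub>R mat 1 :: real ^ 'n ^ 'n"
  have A: "?A *v w = v *\<^sub>R w" for w :: "real ^ 'n"
    by (simp add: scaleR_matrix_vector_assoc[symmetric])
  have det: "det ?A = v ^ CARD('n)"
    by (subst det_diagonal) (auto simp: mat_def)
  then have "invertible ?A" using assms by (simp add: invertible_det_nz)
  then have "?A ** matrix_inv ?A = mat 1"
    unfolding invertible_def matrix_inv_def by (rule someI_ex[THEN conjunct1])
  then have "?A *v (matrix_inv ?A *v w) = w" for w
    unfolding matrix_vector_mul_assoc by simp
  then have "v *\<^sub>R (matrix_inv ?A *v w) = w" for w
    unfolding A .
  then have "(1 / v) *\<^sub>R w = (1 / v) *\<^sub>R (v *\<^sub>R (matrix_inv ?A *v w))" for w
    by (rule arg_cong[OF sym])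
  then have inv: "matrix_inv ?A *v w = (1 / v) *\<^sub>R w" for w
    using assms by simp
  have "exp (- ((y - \<mu>) \<bullet> (matrix_inv ?A *v (y - \<mu>))) / 2) / sqrt ((2 * pi) ^ CARD('n) * det ?A)
      = gauss_density (sqrt v) (y - \<mu>)" for y
  proof -
    have "sqrt ((2 * pi) ^ CARD('n) * v ^ CARD('n)) = sqrt (2 * pi * v) ^ CARD('n)"
      by (simp only: power_mult_distrib[symmetric] real_sqrt_power)
    then show ?thesis
      using assms unfolding inv det by (simp add: gauss_density_eq power2_norm_eq_inner)
  qed
  then show ?thesis
    using assms distr_std_gauss_affine[of "sqrt v" \<mu>] by (simp add: gaussian_def)
qed

section \<open>The Gibbs measure and its Metropolis-adjusted Langevin kernel\<close>

definition unit_unif :: "real measure" where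
  "unit_unif = density lborel (indicator {0..1})"

lemma sets_unit_unif [simp, measurable_cong]: "sets unit_unif = sets borel"
  and space_unit_unif [simp]: "space unit_unif = UNIV"
  by (simp_all add: unit_unif_def)

interpretation unit_unif: prob_space unit_unif
  by (rule prob_spaceI) (simp add: unit_unif_def emeasure_density)

lemma nn_integral_unit_unif_threshold:
  assumes "0 \<le> a" "a \<le> 1"
  shows "(\<integral>\<^sup>+u. (if u \<le> a then p else q) \<partial>unit_unif) = ennreal a * p + ennreal (1 - a) * q"
proof -
  have "(\<integral>\<^sup>+u. (if u \<le> a then p else q) \<partial>unit_unif)
      = (\<integral>\<^sup>+u. p * indicator {0..a} u + q * indicator {a<..1} u \<partial>lborel)"
    unfolding unit_unif_def using assms
    by (subst nn_integral_density) (auto intro!: nn_integral_cong simp: indicator_def)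
  also have "\<dots> = p * ennreal a + q * ennreal (1 - a)"
    using assms by (subst nn_integral_add) (auto simp: nn_integral_cmult)
  finally show ?thesis by (simp add: mult.commute)
qed

text \<open>Makes a Metropolis step a deterministic map of the current point and fresh noise: the
  Gaussian increment, which also drives the Euler scheme, and a uniform variable that decides
  acceptance.\<close>

definition noise :: "('a::euclidean_space \<times> real) measure" where
  "noise = std_gauss \<Otimes>\<^sub>M unit_unif"

lemma sets_noise [simp, measurable_cong]: "sets noise = sets (borel \<Otimes>\<^sub>M borel)"
  and space_noise [simp]: "space noise = UNIV"
  unfolding noise_def by (auto intro!: sets_pair_measure_cong simp: space_pair_measure)

interpretation noise: prob_space "noise :: ('a::euclidean_space \<times> real) measure"
  unfolding noise_def by (intro prob_space_pair prob_space_std_gauss unit_unif.prob_space_axioms)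

lemma nn_integral_noise:
  assumes [measurable]: "f \<in> borel_measurable (borel \<Otimes>\<^sub>M borel)"
  shows "(\<integral>\<^sup>+w. f w \<partial>noise) = (\<integral>\<^sup>+z. \<integral>\<^sup>+u. f (z, u) \<partial>unit_unif \<partial>std_gauss)"
  unfolding noise_def by (subst unit_unif.nn_integral_fst[symmetric]) auto

context langevin_potential begin

section \<open>Normalisation and moments of the Gibbs measure\<close>

abbreviation "\<pi> \<equiv> gibbs U"

definition Z :: real where "Z = (LINT y|lborel. exp (- U y))"

lemma integrable_power_exp_U:
  assumes "0 \<le> a"
  shows "integrable lborel (\<lambda>y. (1 + a * norm (y - xs)) ^ k * exp (- U y))"
proof (rule Bochner_Integration.integrable_bound)
  show "integrable lborel (\<lambda>y. exp (- U xs) *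
      ((1 + a * norm (y - xs)) ^ k * exp (- (m / 2) * (norm (y - xs))\<^sup>2)))"
    using assms m_pos by (intro integrable_mult_right integrable_power_exp_neg_norm2) auto
  have "(1 + a * norm (y - xs)) ^ k * exp (- U y)
      \<le> (1 + a * norm (y - xs)) ^ k * (exp (- U xs) * exp (- (m / 2) * (norm (y - xs))\<^sup>2))" for y
    using U_lower[of y] assms by (intro mult_left_mono) (auto simp: exp_add[symmetric])
  then show "AE y in lborel. norm ((1 + a * norm (y - xs)) ^ k * exp (- U y))
      \<le> norm (exp (- U xs) * ((1 + a * norm (y - xs)) ^ k * exp (- (m / 2) * (norm (y - xs))\<^sup>2)))"
    using assms by (intro AE_I2) (simp add: mult_ac)
qed simp

lemma integrable_exp_U: "integrable lborel (\<lambda>y. exp (- U y))"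
  using integrable_power_exp_U[of 0 0] by simp

lemma Z_pos: "0 < Z"
proof -
  have "Z \<noteq> 0"
  proof
    assume "Z = 0"
    then have "AE y in lborel. exp (- U y) = 0"
      unfolding Z_def using integral_nonneg_eq_0_iff_AE[OF integrable_exp_U] by simp
    then have "AE y in (lborel :: (real ^ 'n) measure). False" by simp
    then have "emeasure lborel (UNIV :: (real ^ 'n) set) = 0"
      by (simp add: trivial_limit_def[symmetric] ae_filter_eq_bot_iff)
    then show False by simp
  qed
  moreover have "0 \<le> Z" unfolding Z_def by (rule integral_nonneg_AE) simp
  ultimately show ?thesis by simp
qed

lemma gibbs_eq: "\<pi> = density lborel (\<lambda>x. ennreal (exp (- U x) / Z))"
  by (simp add: gibbs_def Z_def)

lemma sets_gibbs [simp, measurable_cong]: "sets \<pi> = sets borel"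
  and space_gibbs [simp]: "space \<pi> = UNIV"
  by (simp_all add: gibbs_eq)

lemma nn_integral_gibbs:
  "f \<in> borel_measurable borel \<Longrightarrow> (\<integral>\<^sup>+y. f y \<partial>\<pi>) = (\<integral>\<^sup>+y. ennreal (exp (- U y) / Z) * f y \<partial>lborel)"
  unfolding gibbs_eq by (subst nn_integral_density) auto

lemma prob_space_gibbs: "prob_space \<pi>"
proof (rule prob_spaceI)
  have "(\<integral>\<^sup>+y. ennreal (exp (- U y) / Z) \<partial>lborel) = ennreal (LINT y|lborel. exp (- U y) / Z)"
    using Z_pos by (intro nn_integral_eq_integral) (auto intro: integrable_exp_U)
  also have "(LINT y|lborel. exp (- U y) / Z) = 1"
    using Z_pos by (simp add: Z_def[symmetric])
  finally show "emeasure \<pi> (space \<pi>) = 1" by (simp add: gibbs_eq emeasure_density)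
qed

sublocale gibbs: prob_space \<pi>
  by (rule prob_space_gibbs)

lemma integrable_gibbs_power:
  assumes "0 \<le> a"
  shows "integrable \<pi> (\<lambda>y. (1 + a * norm (y - xs)) ^ k)"
proof -
  have "integrable lborel (\<lambda>y. (1 + a * norm (y - xs)) ^ k * exp (- U y) / Z)"
    by (intro integrable_divide_zero integrable_power_exp_U assms)
  then show ?thesis
    unfolding gibbs_eq using Z_pos by (subst integrable_density) (auto simp: mult_ac)
qed

lemma integrable_gibbs_norm_power: "integrable \<pi> (\<lambda>y. norm (y - xs) ^ k)"
proof (rule Bochner_Integration.integrable_bound[OF integrable_gibbs_power[of 1 k]])
  show "AE y in \<pi>. norm (norm (y - xs) ^ k) \<le> norm ((1 + 1 * norm (y - xs)) ^ k)"
    by (intro AE_I2) (auto intro!: power_mono)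
qed auto

lemma sqint_gibbs: "sqint \<pi> (\<lambda>y. y - xs)"
  using integrable_gibbs_norm_power[of 2] by (simp add: sqint_def)

lemma sqint_gibbs_grad: "sqint \<pi> g"
  and l2_gibbs_grad_le: "l2 \<pi> g \<le> L * l2 \<pi> (\<lambda>y. y - xs)"
  using sqint_dominated[of g \<pi> "\<lambda>y. L *\<^sub>R (y - xs)"] sqint_scaleR[OF sqint_gibbs, of L]
    norm_grad_le L_nonneg by auto

text \<open>Dilating by \<open>t > 1\<close> around the minimizer turns the normalising constant into
  \<open>Z = t^d \<integral> exp (- U (xs + t v)) dv\<close>; letting \<open>t\<close> tend to 1 replaces the integration by parts that
  computes \<open>\<integral> grad U y \<bullet> (y - xs)\<close>.\<close>

lemma gibbs_second_moment: "(l2 \<pi> (\<lambda>y. y - xs))\<^sup>2 \<le> real CARD('n) / m"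
proof -
  define V2 where "V2 = (LINT y|\<pi>. (norm (y - xs))\<^sup>2)"
  define V4 where "V4 = (LINT y|\<pi>. (norm (y - xs)) ^ 4)"
  have key: "0 \<le> real CARD('n) - m * V2 + s * (m\<^sup>2 * V4 / 2)" if s: "0 < s" for s
  proof -
    define t where "t = 1 + s"
    have t: "t \<noteq> 0" "0 \<le> t" using s by (simp_all add: t_def)
    \<comment> \<open>The second-order Taylor polynomial of
      \<open>exp (- (s * m * (norm (y - xs))\<^sup>2))\<close>: it dominates the exponential, and
      its integral involves only the moments \<open>V2\<close> and \<open>V4\<close>.\<close>
    define f where "f y = 1 - s * m * (norm (y - xs))\<^sup>2 + s\<^sup>2 * m\<^sup>2 * norm (y - xs) ^ 4 / 2" for y
    have f_ge: "exp (- (s * m * (norm (y - xs))\<^sup>2)) \<le> f y" for y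
    proof -
      define x where "x = s * m * (norm (y - xs))\<^sup>2"
      have x: "0 \<le> x" using s m_pos by (simp add: x_def)
      have "\<exists>b. \<bar>b\<bar> \<le> \<bar>- x\<bar> \<and> exp (- x) = (\<Sum>i<3. (- x) ^ i / fact i) + exp b / fact 3 * (- x) ^ 3"
        using Maclaurin_exp_le[of "- x" 3] by blast
      then obtain b where "exp (- x) = (\<Sum>i<3. (- x) ^ i / fact i) + exp b / fact 3 * (- x) ^ 3"
        by blast
      moreover have "exp b / fact 3 * (- x) ^ 3 \<le> 0"
        using x by (simp add: mult_nonneg_nonpos)
      ultimately have "exp (- x) \<le> 1 - x + x\<^sup>2 / 2"
        by (simp add: numeral_3_eq_3 power2_eq_square)
      then show ?thesis by (simp add: f_def x_def power_mult_distrib power2_eq_square power4_eq_xxxx mult_ac)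
    qed
    have intf: "integrable \<pi> f"
      unfolding f_def using integrable_gibbs_norm_power[of 2] integrable_gibbs_norm_power[of 4] by simp
    have intf_eq: "(LINT y|\<pi>. f y) = 1 - s * m * V2 + s\<^sup>2 * m\<^sup>2 * V4 / 2"
      unfolding f_def V2_def V4_def
      using integrable_gibbs_norm_power[of 2] integrable_gibbs_norm_power[of 4]
      by (simp add: gibbs.prob_space[simplified])
    have f_nonneg: "0 \<le> f y" for y using f_ge[of y] exp_gt_zero order_trans less_imp_le by metis
    have U_dilate: "U y + s * m * (norm (y - xs))\<^sup>2 \<le> U ((xs - t *\<^sub>R xs) + t *\<^sub>R y)" for y
    proof -
      have "(xs - t *\<^sub>R xs) + t *\<^sub>R y - y = s *\<^sub>R (y - xs)" by (simp add: t_def algebra_simps)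
      then have "U y + g y \<bullet> (s *\<^sub>R (y - xs)) \<le> U ((xs - t *\<^sub>R xs) + t *\<^sub>R y)"
        using strongly_convex[of y "(xs - t *\<^sub>R xs) + t *\<^sub>R y"] m_pos
        by (smt (verit) divide_nonneg_pos mult_nonneg_nonneg zero_le_power2)
      moreover have "s * (m * (norm (y - xs))\<^sup>2) \<le> s * (g y \<bullet> (y - xs))"
        using s by (intro mult_left_mono grad_inner_lower) simp
      ultimately show ?thesis by (simp add: mult.assoc)
    qed
    have "ennreal 1 = (\<integral>\<^sup>+y. ennreal (exp (- U y) / Z) \<partial>lborel)"
      using nn_integral_gibbs[of "\<lambda>_. 1"] gibbs.emeasure_space_1 by simp
    also have "\<dots> = ennreal (t ^ CARD('n)) * (\<integral>\<^sup>+y. ennreal (exp (- U ((xs - t *\<^sub>R xs) + t *\<^sub>R y)) / Z) \<partial>lborel)"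
      using nn_integral_lborel_affine[of "\<lambda>y. ennreal (exp (- U y) / Z)" t "xs - t *\<^sub>R xs"] t by simp
    also have "\<dots> \<le> ennreal (t ^ CARD('n)) * (\<integral>\<^sup>+y. ennreal (exp (- U y) / Z) * ennreal (f y) \<partial>lborel)"
    proof (intro mult_left_mono nn_integral_mono)
      fix y
      have "exp (- U ((xs - t *\<^sub>R xs) + t *\<^sub>R y)) \<le> exp (- U y) * exp (- (s * m * (norm (y - xs))\<^sup>2))"
        using U_dilate[of y] by (simp add: exp_add[symmetric])
      also have "\<dots> \<le> exp (- U y) * f y" by (intro mult_left_mono f_ge) simp
      finally show "ennreal (exp (- U ((xs - t *\<^sub>R xs) + t *\<^sub>R y)) / Z) \<le> ennreal (exp (- U y) / Z) * ennreal (f y)"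
        using Z_pos f_nonneg by (simp add: ennreal_mult[symmetric] divide_right_mono)
    qed simp
    also have "(\<integral>\<^sup>+y. ennreal (exp (- U y) / Z) * ennreal (f y) \<partial>lborel) = (\<integral>\<^sup>+y. ennreal (f y) \<partial>\<pi>)"
      by (subst nn_integral_gibbs) (auto simp: f_def)
    also have "\<dots> = ennreal (LINT y|\<pi>. f y)"
      using intf f_nonneg by (intro nn_integral_eq_integral) auto
    finally have "1 \<le> t ^ CARD('n) * (LINT y|\<pi>. f y)"
      using t f_nonneg by (simp add: ennreal_mult[symmetric] integral_nonneg_AE)
    \<comment> \<open>Bounding both factors by exponentials turns 1 \<le> ... into nonnegativity of
      an exponent, from which one factor s can be divided out.\<close>
    also have "\<dots> \<le> exp s ^ CARD('n) * exp (- s * m * V2 + s\<^sup>2 * m\<^sup>2 * V4 / 2)"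
    proof (intro mult_mono power_mono)
      show "t \<le> exp s" unfolding t_def by (rule exp_ge_add_one_self)
      show "(LINT y|\<pi>. f y) \<le> exp (- s * m * V2 + s\<^sup>2 * m\<^sup>2 * V4 / 2)"
        unfolding intf_eq using exp_ge_add_one_self[of "- s * m * V2 + s\<^sup>2 * m\<^sup>2 * V4 / 2"] by linarith
    qed (use t f_nonneg in \<open>auto simp: integral_nonneg_AE\<close>)
    also have "\<dots> = exp (s * (real CARD('n) - m * V2 + s * (m\<^sup>2 * V4 / 2)))"
      unfolding exp_of_nat_mult[symmetric] exp_add[symmetric]
      by (rule arg_cong[of _ _ exp]) (simp add: algebra_simps power2_eq_square)
    finally show ?thesis using s by (simp add: zero_le_mult_iff)
  qed
  have "m * V2 \<le> real CARD('n)"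
  proof (rule field_le_epsilon)
    fix e :: real assume e: "0 < e"
    \<comment> \<open>The fourth moment appears with a factor s, so it disappears as s tends to
      0.\<close>
    define c where "c = m\<^sup>2 * V4 / 2"
    have c: "0 \<le> c" by (simp add: c_def V4_def integral_nonneg_AE)
    have "e / (c + 1) * c \<le> e" using c e by (simp add: field_simps)
    then show "m * V2 \<le> real CARD('n) + e" using key[of "e / (c + 1)"] c e by (simp add: c_def[symmetric])
  qed
  then show ?thesis using m_pos by (simp add: l2_power2 V2_def field_simps)
qed

text \<open>Multiplied by L^2, this is the source of the terms L^4 / m in \<open>u3\<close>.\<close>

lemma l2_gibbs_grad_power2: "(l2 \<pi> g)\<^sup>2 \<le> L\<^sup>2 * real CARD('n) / m"
proof -
  have "(l2 \<pi> g)\<^sup>2 \<le> (L * l2 \<pi> (\<lambda>y. y - xs))\<^sup>2"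
    by (intro power_mono l2_gibbs_grad_le) simp
  also have "\<dots> \<le> L\<^sup>2 * (real CARD('n) / m)"
    unfolding power_mult_distrib by (intro mult_left_mono gibbs_second_moment) simp
  finally show ?thesis by simp
qed

section \<open>The Metropolis step and its invariant measure\<close>

definition propose :: "real \<Rightarrow> real ^ 'n \<Rightarrow> real ^ 'n \<Rightarrow> real ^ 'n" where
  "propose h y z = (y - h *\<^sub>R g y) + sqrt (2 * h) *\<^sub>R z"

text \<open>Up to an additive constant, the logarithm of the density at \<open>(y, y')\<close> of a stationary point
  \<open>y\<close> followed by a proposal \<open>y'\<close>.\<close>

definition log_flow :: "real \<Rightarrow> real ^ 'n \<Rightarrow> real ^ 'n \<Rightarrow> real" where
  "log_flow h y y' = - U y - (norm (y' - (y - h *\<^sub>R g y)))\<^sup>2 / (4 * h)"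

definition acc :: "real \<Rightarrow> real ^ 'n \<Rightarrow> real ^ 'n \<Rightarrow> real" where
  "acc h y y' = min 1 (exp (log_flow h y' y - log_flow h y y'))"

definition mala :: "real \<Rightarrow> real ^ 'n \<Rightarrow> (real ^ 'n) \<times> real \<Rightarrow> real ^ 'n" where
  "mala h y = (\<lambda>(z, u). if u \<le> acc h y (propose h y z) then propose h y z else y)"

text \<open>Splits a Metropolis step into an exact Euler step and a perturbation that vanishes on
  acceptance, so that the analysis of the chain can work with Euler increments.\<close>

definition rej_error :: "real \<Rightarrow> real ^ 'n \<Rightarrow> (real ^ 'n) \<times> real \<Rightarrow> real ^ 'n" where
  "rej_error h y = (\<lambda>(z, u). mala h y (z, u) - propose h y z)"

lemma measurable_propose [measurable]: "(\<lambda>(y, z). propose h y z) \<in> borel \<Otimes>\<^sub>M borel \<rightarrow>\<^sub>M borel"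
  unfolding propose_def by measurable

lemma measurable_acc [measurable]: "(\<lambda>(y, z). acc h y z) \<in> borel \<Otimes>\<^sub>M borel \<rightarrow>\<^sub>M borel"
  unfolding acc_def log_flow_def by measurable

lemma measurable_mala [measurable]: "(\<lambda>(y, w). mala h y w) \<in> borel \<Otimes>\<^sub>M (borel \<Otimes>\<^sub>M borel) \<rightarrow>\<^sub>M borel"
  unfolding mala_def by measurable

lemma measurable_rej_error [measurable]:
  "(\<lambda>(y, w). rej_error h y w) \<in> borel \<Otimes>\<^sub>M (borel \<Otimes>\<^sub>M borel) \<rightarrow>\<^sub>M borel"
  unfolding rej_error_def by measurable

lemma acc_bounds: "0 \<le> acc h y y'" "acc h y y' \<le> 1"
  by (simp_all add: acc_def)

lemma nn_integral_noise_threshold: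
  assumes [measurable]: "p \<in> borel_measurable borel" "q \<in> borel_measurable borel"
  shows "(\<integral>\<^sup>+(z, u). (if u \<le> acc h y (propose h y z) then p z else q z) \<partial>noise)
    = (\<integral>\<^sup>+z. ennreal (acc h y (propose h y z)) * p z + ennreal (1 - acc h y (propose h y z)) * q z \<partial>std_gauss)"
  by (subst nn_integral_noise) (simp_all add: nn_integral_unit_unif_threshold acc_bounds)

text \<open>Accepted moves have density \<open>W y y'\<close>, a constant times the smaller of the
  exponentials of the two log flows. This is symmetric, so exchanging the order of integration
  exchanges the endpoints.\<close>

lemma detailed_balance:
  assumes h: "0 < h" and [measurable]: "(\<lambda>(y, y'). \<Phi> y y') \<in> borel_measurable (borel \<Otimes>\<^sub>M borel)"
  shows "(\<integral>\<^sup>+y. \<integral>\<^sup>+z. ennreal (acc h y (propose h y z)) * \<Phi> y (propose h y z) \<partial>std_gauss \<partial>\<pi>)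
    = (\<integral>\<^sup>+y. \<integral>\<^sup>+z. ennreal (acc h y (propose h y z)) * \<Phi> (propose h y z) y \<partial>std_gauss \<partial>\<pi>)"
proof -
  define W where "W y y' = exp (- U y) / Z * (gauss_density (sqrt (2 * h)) (y' - (y - h *\<^sub>R g y)) * acc h y y')" for y y'
  have W_sym: "W y y' = W y' y" for y y'
  proof -
    have e: "exp a * min 1 (exp (b - a)) = min (exp a) (exp b)" for a b :: real
      by (auto simp: min_def exp_diff)
    have "W y y' = exp (log_flow h y y') * min 1 (exp (log_flow h y' y - log_flow h y y'))
        / (Z * sqrt (2 * pi * (2 * h)) ^ CARD('n))" for y y'
    proof -
      have "exp (log_flow h y y') = exp (- U y) * exp (- (norm (y' - (y - h *\<^sub>R g y)))\<^sup>2 / (4 * h))"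
        unfolding log_flow_def exp_add[symmetric] by simp
      then show ?thesis using h by (simp add: W_def gauss_density_eq acc_def)
    qed
    then show ?thesis by (simp add: e min.commute)
  qed
  have W_meas[measurable]: "(\<lambda>(y, y'). W y y') \<in> borel_measurable (borel \<Otimes>\<^sub>M borel)"
    unfolding W_def by measurable
  have W_ennreal: "ennreal (W y y') = ennreal (exp (- U y) / Z)
      * (ennreal (gauss_density (sqrt (2 * h)) (y' - (y - h *\<^sub>R g y))) * ennreal (acc h y y'))" for y y'
    unfolding W_def using Z_pos by (simp add: ennreal_mult[symmetric] acc_bounds del: times_divide_eq_left)
  have eq: "(\<integral>\<^sup>+y. \<integral>\<^sup>+z. ennreal (acc h y (propose h y z)) * \<Psi> y (propose h y z) \<partial>std_gauss \<partial>\<pi>)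
      = (\<integral>\<^sup>+y. \<integral>\<^sup>+y'. ennreal (W y y') * \<Psi> y y' \<partial>lborel \<partial>lborel)"
    if [measurable]: "(\<lambda>(y, y'). \<Psi> y y') \<in> borel_measurable (borel \<Otimes>\<^sub>M borel)" for \<Psi>
  proof -
    have "(\<integral>\<^sup>+z. ennreal (acc h y (propose h y z)) * \<Psi> y (propose h y z) \<partial>std_gauss)
        = (\<integral>\<^sup>+y'. ennreal (gauss_density (sqrt (2 * h)) (y' - (y - h *\<^sub>R g y))) * (ennreal (acc h y y') * \<Psi> y y') \<partial>lborel)" for y
      using nn_integral_std_gauss_affine[of "\<lambda>y'. ennreal (acc h y y') * \<Psi> y y'" "sqrt (2 * h)" "y - h *\<^sub>R g y"] h
      by (simp add: propose_def)
    then have "(\<integral>\<^sup>+y. \<integral>\<^sup>+z. ennreal (acc h y (propose h y z)) * \<Psi> y (propose h y z) \<partial>std_gauss \<partial>\<pi>)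
      = (\<integral>\<^sup>+y. ennreal (exp (- U y) / Z) *
          (\<integral>\<^sup>+y'. ennreal (gauss_density (sqrt (2 * h)) (y' - (y - h *\<^sub>R g y))) * (ennreal (acc h y y') * \<Psi> y y') \<partial>lborel) \<partial>lborel)"
      by (simp add: nn_integral_gibbs)
    also have "\<dots> = (\<integral>\<^sup>+y. \<integral>\<^sup>+y'. ennreal (W y y') * \<Psi> y y' \<partial>lborel \<partial>lborel)"
      using Z_pos by (subst nn_integral_cmult[symmetric])
        (auto simp: W_ennreal mult.assoc)
    finally show ?thesis .
  qed
  have "(\<integral>\<^sup>+y. \<integral>\<^sup>+z. ennreal (acc h y (propose h y z)) * \<Phi> y (propose h y z) \<partial>std_gauss \<partial>\<pi>)
      = (\<integral>\<^sup>+y. \<integral>\<^sup>+y'. ennreal (W y y') * \<Phi> y y' \<partial>lborel \<partial>lborel)"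
    by (rule eq) simp
  also have "\<dots> = (\<integral>\<^sup>+y'. \<integral>\<^sup>+y. ennreal (W y y') * \<Phi> y y' \<partial>lborel \<partial>lborel)"
    by (rule lborel_pair.Fubini'[symmetric]) simp
  also have "\<dots> = (\<integral>\<^sup>+y. \<integral>\<^sup>+y'. ennreal (W y y') * \<Phi> y' y \<partial>lborel \<partial>lborel)"
    by (simp add: W_sym)
  also have "\<dots> = (\<integral>\<^sup>+y. \<integral>\<^sup>+z. ennreal (acc h y (propose h y z)) * \<Phi> (propose h y z) y \<partial>std_gauss \<partial>\<pi>)"
    by (rule eq[symmetric]) simp
  finally show ?thesis .
qed

text \<open>By detailed balance the accepted mass arriving in \<open>A\<close> equals the accepted
  mass departing from \<open>A\<close>; with the rejected mass that stays put, the total is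
  \<pi>(A). The invariance is exact for every step size.\<close>

lemma mala_invariant:
  assumes h: "0 < h"
  shows "distr (\<pi> \<Otimes>\<^sub>M noise) borel (\<lambda>(y, w). mala h y w) = \<pi>"
proof (rule measure_eqI)
  fix A assume "A \<in> sets (distr (\<pi> \<Otimes>\<^sub>M noise) borel (\<lambda>(y, w). mala h y w))"
  then have A[measurable]: "A \<in> sets borel" by simp
  let ?I = "indicator A :: _ \<Rightarrow> ennreal"
  let ?a = "\<lambda>y z. acc h y (propose h y z)"
  have "emeasure (distr (\<pi> \<Otimes>\<^sub>M noise) borel (\<lambda>(y, w). mala h y w)) A
      = (\<integral>\<^sup>+y. ?I y \<partial>distr (\<pi> \<Otimes>\<^sub>M noise) borel (\<lambda>(y, w). mala h y w))"
    by simp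
  also have "\<dots> = (\<integral>\<^sup>+(y, w). ?I (mala h y w) \<partial>(\<pi> \<Otimes>\<^sub>M noise))"
    by (subst nn_integral_distr) (auto simp: case_prod_unfold)
  also have "\<dots> = (\<integral>\<^sup>+y. \<integral>\<^sup>+w. ?I (mala h y w) \<partial>noise \<partial>\<pi>)"
    by (subst noise.nn_integral_fst[symmetric]) auto
  also have "\<dots> = (\<integral>\<^sup>+y. \<integral>\<^sup>+z. ennreal (?a y z) * ?I (propose h y z) + ennreal (1 - ?a y z) * ?I y \<partial>std_gauss \<partial>\<pi>)"
  proof (intro nn_integral_cong)
    fix y
    have "(\<integral>\<^sup>+w. ?I (mala h y w) \<partial>noise)
        = (\<integral>\<^sup>+(z, u). (if u \<le> ?a y z then ?I (propose h y z) else ?I y) \<partial>noise)"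
      by (intro nn_integral_cong) (auto simp: mala_def)
    then show "(\<integral>\<^sup>+w. ?I (mala h y w) \<partial>noise)
        = (\<integral>\<^sup>+z. ennreal (?a y z) * ?I (propose h y z) + ennreal (1 - ?a y z) * ?I y \<partial>std_gauss)"
      by (simp add: nn_integral_noise_threshold)
  qed
  also have "\<dots> = (\<integral>\<^sup>+y. \<integral>\<^sup>+z. ennreal (?a y z) * ?I (propose h y z) \<partial>std_gauss \<partial>\<pi>)
      + (\<integral>\<^sup>+y. \<integral>\<^sup>+z. ennreal (1 - ?a y z) * ?I y \<partial>std_gauss \<partial>\<pi>)"
    by (simp add: nn_integral_add)
  also have "(\<integral>\<^sup>+y. \<integral>\<^sup>+z. ennreal (?a y z) * ?I (propose h y z) \<partial>std_gauss \<partial>\<pi>)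
      = (\<integral>\<^sup>+y. \<integral>\<^sup>+z. ennreal (?a y z) * ?I y \<partial>std_gauss \<partial>\<pi>)"
    by (rule detailed_balance[OF h, of "\<lambda>y y'. ?I y'"]) simp
  also have "(\<integral>\<^sup>+y. \<integral>\<^sup>+z. ennreal (?a y z) * ?I y \<partial>std_gauss \<partial>\<pi>) +
      (\<integral>\<^sup>+y. \<integral>\<^sup>+z. ennreal (1 - ?a y z) * ?I y \<partial>std_gauss \<partial>\<pi>)
      = (\<integral>\<^sup>+y. \<integral>\<^sup>+z. ennreal (?a y z) * ?I y + ennreal (1 - ?a y z) * ?I y \<partial>std_gauss \<partial>\<pi>)"
    by (simp add: nn_integral_add)
  also have "\<dots> = (\<integral>\<^sup>+y. ?I y \<partial>\<pi>)"
    by (simp add: distrib_right[symmetric] ennreal_plus[symmetric] acc_bounds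
        std_gauss.emeasure_space_1[simplified] del: ennreal_plus)
  also have "\<dots> = emeasure \<pi> A" by simp
  finally show "emeasure (distr (\<pi> \<Otimes>\<^sub>M noise) borel (\<lambda>(y, w). mala h y w)) A = emeasure \<pi> A" .
qed simp

text \<open>The bound is a product of a function of \<open>z\<close> and a function of
  \<open>y\<close>, so its powers integrate separately over the Gaussian and over \<pi>. For h \<le>
  1 the drift fits under sqrt h.\<close>

lemma proposal_distance:
  assumes h: "0 < h" "h \<le> 1"
  shows "norm (propose h y z - y) \<le> sqrt h * ((1 + 2 * norm z) * (1 + norm (g y)))"
proof -
  have "sqrt h * sqrt h \<le> sqrt h * 1" using h by (intro mult_left_mono) auto
  then have sh: "h \<le> sqrt h" using h by simp
  have "sqrt 2 \<le> sqrt 4" by (intro real_sqrt_le_mono) simp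
  then have s2: "sqrt 2 \<le> 2" by simp
  have "norm (propose h y z - y) = norm (sqrt (2 * h) *\<^sub>R z + - (h *\<^sub>R g y))"
    by (simp add: propose_def)
  also have "\<dots> \<le> sqrt (2 * h) * norm z + h * norm (g y)"
    using norm_triangle_ineq[of "sqrt (2 * h) *\<^sub>R z" "- (h *\<^sub>R g y)"] h by simp
  also have "\<dots> \<le> (2 * sqrt h) * norm z + sqrt h * norm (g y)"
    using sh s2 h by (intro add_mono mult_right_mono) (auto simp: real_sqrt_mult)
  also have "\<dots> \<le> sqrt h * ((1 + 2 * norm z) * (1 + norm (g y)))"
    using h by (simp add: algebra_simps)
  finally show ?thesis .
qed

text \<open>The log-acceptance ratio is a trapezoidal quadrature error for \<open>U\<close> plus a term of order
  \<open>h \<bar>y' - y\<bar>\<close>, hence of order \<open>h^(3/2)\<close>; this is what makes the rejections negligible.\<close>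

lemma rejection_probability:
  fixes y z :: "real ^ 'n"
  assumes h: "0 < h" "h \<le> 1"
  defines "q \<equiv> (1 + 2 * norm z) * (1 + norm (g y))"
  shows "1 - acc h y (propose h y z) \<le> (L' + L * (2 + L)) / 4 * (sqrt h * q) ^ 3"
proof -
  define y' where "y' = propose h y z"
  define v where "v = y' - y"
  define r where "r = log_flow h y' y - log_flow h y y'"
  have s: "0 \<le> sqrt h" "sqrt h \<le> 1" "h = sqrt h * sqrt h" using h by simp_all
  have q: "1 \<le> q" unfolding q_def by (simp add: algebra_simps add_increasing2)
  have gq: "norm (g y) \<le> q" unfolding q_def by (simp add: algebra_simps add_increasing2)
  have v: "norm v \<le> sqrt h * q"
    using proposal_distance[OF h, of y z] by (simp add: v_def y'_def q_def)
  have vq: "norm v \<le> q"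
    using v s q mult_right_mono[of "sqrt h" 1 q] by linarith
  \<comment> \<open>In the difference of the two Gaussian exponents the square of \<open>v\<close>
    cancels. The cross terms complete the trapezoidal rule for \<open>U\<close>, and the squared
    gradients leave the term with factor h / 4.\<close>
  have lf: "log_flow h y' y - log_flow h y y' = - (U y' - U y - 1 / 2 * ((g y + g y') \<bullet> v))
      - h / 4 * ((g y' - g y) \<bullet> (g y' + g y))"
  proof -
    have a: "y - (y' - h *\<^sub>R g y') = h *\<^sub>R g y' - v" "y' - (y - h *\<^sub>R g y) = v + h *\<^sub>R g y"
      by (simp_all add: v_def)
    have "(norm (h *\<^sub>R g y' - v))\<^sup>2 - (norm (v + h *\<^sub>R g y))\<^sup>2
        = 4 * h * (- 1 / 2 * ((g y + g y') \<bullet> v) + h / 4 * ((g y' - g y) \<bullet> (g y' + g y)))"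
      unfolding power2_norm_eq_inner
      by (simp add: inner_add_left inner_add_right inner_diff_left inner_diff_right inner_commute algebra_simps)
    then have "((norm (h *\<^sub>R g y' - v))\<^sup>2 - (norm (v + h *\<^sub>R g y))\<^sup>2) / (4 * h)
        = - 1 / 2 * ((g y + g y') \<bullet> v) + h / 4 * ((g y' - g y) \<bullet> (g y' + g y))"
      using h by simp
    then show ?thesis unfolding log_flow_def a by (simp add: diff_divide_distrib)
  qed
  have "\<bar>U y' - U y - 1 / 2 * ((g y + g y') \<bullet> v)\<bar> \<le> L' / 4 * norm v ^ 3"
    using trapezoid_error[of y v] by (simp add: v_def)
  also have "\<dots> \<le> L' / 4 * (sqrt h * q) ^ 3"
    using v L'_nonneg by (intro mult_left_mono power_mono) auto
  finally have 1: "\<bar>U y' - U y - 1 / 2 * ((g y + g y') \<bullet> v)\<bar> \<le> L' / 4 * (sqrt h * q) ^ 3" .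
  have "\<bar>(g y' - g y) \<bullet> (g y' + g y)\<bar> \<le> (L * norm v) * (2 * norm (g y) + L * norm v)"
  proof (rule order_trans[OF Cauchy_Schwarz_ineq2 mult_mono])
    show gd: "norm (g y' - g y) \<le> L * norm v" using grad_lipschitz by (simp add: v_def)
    have "norm (g y' + g y) = norm ((g y' - g y) + 2 *\<^sub>R g y)" by (simp add: scaleR_2 add.commute)
    also have "\<dots> \<le> norm (g y' - g y) + norm (2 *\<^sub>R g y)" by (rule norm_triangle_ineq)
    finally show "norm (g y' + g y) \<le> 2 * norm (g y) + L * norm v" using gd by simp
  qed (use L_nonneg in auto)
  also have "\<dots> \<le> (L * (sqrt h * q)) * (2 * q + L * q)"
    using L_nonneg v vq gq s q by (intro mult_mono add_mono mult_left_mono) auto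
  also have "\<dots> = L * (2 + L) * (sqrt h * q\<^sup>2)"
    by (simp add: algebra_simps power2_eq_square)
  \<comment> \<open>\<open>q\<close> is at least 1, so this contribution can be raised to the same
    power of \<open>q\<close> as the quadrature error.\<close>
  also have "\<dots> \<le> L * (2 + L) * (sqrt h * q ^ 3)"
    using L_nonneg s q by (intro mult_left_mono power_increasing) auto
  finally have "h / 4 * \<bar>(g y' - g y) \<bullet> (g y' + g y)\<bar> \<le> h / 4 * (L * (2 + L) * (sqrt h * q ^ 3))"
    using h by (intro mult_left_mono) auto
  also have "\<dots> = L * (2 + L) / 4 * (sqrt h * q) ^ 3"
    using s(3) by (simp add: power_mult_distrib power3_eq_cube mult_ac)
  finally have 2: "\<bar>h / 4 * ((g y' - g y) \<bullet> (g y' + g y))\<bar> \<le> L * (2 + L) / 4 * (sqrt h * q) ^ 3"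
    using h by (simp add: abs_mult)
  have "\<bar>r\<bar> \<le> (L' + L * (2 + L)) / 4 * (sqrt h * q) ^ 3"
  proof -
    have "\<bar>- a - b\<bar> \<le> \<bar>a\<bar> + \<bar>b\<bar>" for a b :: real by linarith
    then have "\<bar>r\<bar> \<le> \<bar>U y' - U y - 1 / 2 * ((g y + g y') \<bullet> v)\<bar> + \<bar>h / 4 * ((g y' - g y) \<bullet> (g y' + g y))\<bar>"
      unfolding r_def lf by blast
    also note add_mono[OF 1 2]
    finally show ?thesis by (simp add: add_divide_distrib distrib_right)
  qed
  moreover have "1 - min 1 (exp r) \<le> \<bar>r\<bar>"
    using exp_ge_add_one_self[of r] by linarith
  then have "1 - acc h y y' \<le> \<bar>r\<bar>" by (simp add: acc_def r_def)
  ultimately show ?thesis by (simp add: y'_def)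
qed

text \<open>A rejection occurs with probability of order h^(3/2) and then costs a squared proposal
  distance of order h, together h^(5/2). The constant consists of fifth moments and does not depend
  on h.\<close>

lemma rejection_error_l2:
  obtains C where "0 \<le> C"
    "\<And>h. 0 < h \<Longrightarrow> h \<le> 1 \<Longrightarrow> sqint (\<pi> \<Otimes>\<^sub>M noise) (\<lambda>(y, w). rej_error h y w)"
    "\<And>h. 0 < h \<Longrightarrow> h \<le> 1 \<Longrightarrow> (l2 (\<pi> \<Otimes>\<^sub>M noise) (\<lambda>(y, w). rej_error h y w))\<^sup>2 \<le> C * sqrt h ^ 5"
proof -
  define C0 where "C0 = (L' + L * (2 + L)) / 4"
  have C0: "0 \<le> C0" using L_nonneg L'_nonneg by (simp add: C0_def)
  define Qz where "Qz = (LINT z|std_gauss. (1 + 2 * norm (z :: real ^ 'n)) ^ 5)"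
  define Qy where "Qy = (LINT y|\<pi>. (1 + L * norm (y - xs)) ^ 5)"
  have Q: "0 \<le> Qz" "0 \<le> Qy" using L_nonneg by (simp_all add: Qz_def Qy_def integral_nonneg_AE)
  have bound: "(\<integral>\<^sup>+(y, w). ennreal ((norm (rej_error h y w))\<^sup>2) \<partial>(\<pi> \<Otimes>\<^sub>M noise)) \<le> ennreal (C0 * Qz * Qy * sqrt h ^ 5)"
    if h: "0 < h" "h \<le> 1" for h
  proof -
    have pt: "(1 - acc h y (propose h y z)) * (norm (propose h y z - y))\<^sup>2
        \<le> C0 * sqrt h ^ 5 * ((1 + L * norm (y - xs)) ^ 5 * (1 + 2 * norm z) ^ 5)" for y z
    proof -
      define q where "q = (1 + 2 * norm z) * (1 + norm (g y))"
      have "(1 - acc h y (propose h y z)) * (norm (propose h y z - y))\<^sup>2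
          \<le> (C0 * (sqrt h * q) ^ 3) * (sqrt h * q)\<^sup>2"
        unfolding C0_def q_def
        by (intro mult_mono rejection_probability power_mono proposal_distance h)
          (use L_nonneg L'_nonneg h in auto)
      also have "\<dots> = C0 * sqrt h ^ 5 * q ^ 5"
      proof -
        have "C0 * (sqrt h * q) ^ 3 * (sqrt h * q)\<^sup>2 = C0 * (sqrt h * q) ^ (3 + 2)"
          by (simp only: power_add mult.assoc)
        then show ?thesis by (simp add: power_mult_distrib mult.assoc)
      qed
      also have "\<dots> \<le> C0 * sqrt h ^ 5 * ((1 + L * norm (y - xs)) ^ 5 * (1 + 2 * norm z) ^ 5)"
      proof -
        have "(1 + norm (g y)) ^ 5 \<le> (1 + L * norm (y - xs)) ^ 5"
          using norm_grad_le[of y] by (intro power_mono) auto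
        then have "(1 + norm (g y)) ^ 5 * (1 + 2 * norm z) ^ 5 \<le> (1 + L * norm (y - xs)) ^ 5 * (1 + 2 * norm z) ^ 5"
          by (rule mult_right_mono) simp
        then show ?thesis
          unfolding q_def power_mult_distrib using C0 h by (intro mult_left_mono) (simp_all add: mult.commute)
      qed
      finally show ?thesis .
    qed
    have "(\<integral>\<^sup>+(y, w). ennreal ((norm (rej_error h y w))\<^sup>2) \<partial>(\<pi> \<Otimes>\<^sub>M noise))
        = (\<integral>\<^sup>+y. \<integral>\<^sup>+w. ennreal ((norm (rej_error h y w))\<^sup>2) \<partial>noise \<partial>\<pi>)"
      by (subst noise.nn_integral_fst[symmetric]) auto
    also have "\<dots> = (\<integral>\<^sup>+y. \<integral>\<^sup>+z. ennreal ((1 - acc h y (propose h y z)) * (norm (propose h y z - y))\<^sup>2) \<partial>std_gauss \<partial>\<pi>)"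
    proof (intro nn_integral_cong)
      fix y
      have "(\<integral>\<^sup>+w. ennreal ((norm (rej_error h y w))\<^sup>2) \<partial>noise)
          = (\<integral>\<^sup>+(z, u). (if u \<le> acc h y (propose h y z) then 0 else ennreal ((norm (propose h y z - y))\<^sup>2)) \<partial>noise)"
        by (intro nn_integral_cong) (auto simp: rej_error_def mala_def norm_minus_commute)
      then show "(\<integral>\<^sup>+w. ennreal ((norm (rej_error h y w))\<^sup>2) \<partial>noise)
          = (\<integral>\<^sup>+z. ennreal ((1 - acc h y (propose h y z)) * (norm (propose h y z - y))\<^sup>2) \<partial>std_gauss)"
        by (simp add: nn_integral_noise_threshold ennreal_mult acc_bounds)
    qed
    also have "\<dots> \<le> (\<integral>\<^sup>+y. \<integral>\<^sup>+z. ennreal (C0 * sqrt h ^ 5) * (ennreal ((1 + L * norm (y - xs)) ^ 5) * ennreal ((1 + 2 * norm (z :: real ^ 'n)) ^ 5)) \<partial>std_gauss \<partial>\<pi>)"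
    proof (rule nn_integral_mono, rule nn_integral_mono)
      show "ennreal ((1 - acc h y (propose h y z)) * (norm (propose h y z - y))\<^sup>2)
          \<le> ennreal (C0 * sqrt h ^ 5) * (ennreal ((1 + L * norm (y - xs)) ^ 5) * ennreal ((1 + 2 * norm z) ^ 5))" for y z
        using pt[of y z] C0 L_nonneg h by (simp add: ennreal_mult[symmetric])
    qed
    also have "\<dots> = ennreal (C0 * sqrt h ^ 5) * ((\<integral>\<^sup>+y. ennreal ((1 + L * norm (y - xs)) ^ 5) \<partial>\<pi>)
        * (\<integral>\<^sup>+z. ennreal ((1 + 2 * norm (z :: real ^ 'n)) ^ 5) \<partial>std_gauss))"
      by (simp add: nn_integral_cmult nn_integral_multc)
    also have "(\<integral>\<^sup>+z. ennreal ((1 + 2 * norm (z :: real ^ 'n)) ^ 5) \<partial>std_gauss) = ennreal Qz"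
      unfolding Qz_def by (intro nn_integral_eq_integral integrable_std_gauss_power) auto
    also have "(\<integral>\<^sup>+y. ennreal ((1 + L * norm (y - xs)) ^ 5) \<partial>\<pi>) = ennreal Qy"
      unfolding Qy_def using L_nonneg by (intro nn_integral_eq_integral integrable_gibbs_power) auto
    finally show ?thesis
      using C0 Q h by (simp add: ennreal_mult[symmetric] mult_ac)
  qed
  show thesis
  proof (rule that[of "C0 * Qz * Qy"])
    show "0 \<le> C0 * Qz * Qy" using C0 Q by simp
    fix h :: real assume h: "0 < h" "h \<le> 1"
    have meas: "(\<lambda>(y, w). rej_error h y w) \<in> borel_measurable (\<pi> \<Otimes>\<^sub>M noise)" by measurable
    have "(\<integral>\<^sup>+p. ennreal ((norm (case_prod (rej_error h) p))\<^sup>2) \<partial>(\<pi> \<Otimes>\<^sub>M noise)) \<le> ennreal (C0 * Qz * Qy * sqrt h ^ 5)"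
      using bound[OF h] by (simp add: case_prod_unfold)
    moreover from this show int: "sqint (\<pi> \<Otimes>\<^sub>M noise) (\<lambda>(y, w). rej_error h y w)"
      unfolding sqint_def using meas
      by (auto intro!: integrableI_nonneg simp: le_less_trans[OF _ ennreal_less_top])
    ultimately show "(l2 (\<pi> \<Otimes>\<^sub>M noise) (\<lambda>(y, w). rej_error h y w))\<^sup>2 \<le> C0 * Qz * Qy * sqrt h ^ 5"
      using C0 Q h unfolding l2_power2
      by (subst (asm) nn_integral_eq_integral) (auto dest: sqint_integrable)
  qed
qed

end

section \<open>Coupling the Euler scheme with the Metropolis-adjusted chain\<close>

lemma (in prob_space) integral_norm_le_l2:
  assumes "sqint M f"
  shows "integrable M (\<lambda>w. norm (f w))" "(LINT w|M. norm (f w)) \<le> l2 M f"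
proof -
  have f: "sqint M (\<lambda>w. norm (f w))"
    using assms by (auto simp: sqint_def)
  show "integrable M (\<lambda>w. norm (f w))"
    using integrable_inner_sqint[OF f sqint_const[of "1::real"]] by simp
  have "l2 M (\<lambda>_. 1::real) = 1" by (simp add: l2_def prob_space)
  moreover have "l2 M (\<lambda>w. norm (f w)) = l2 M f" by (simp add: l2_def)
  ultimately show "(LINT w|M. norm (f w)) \<le> l2 M f"
    using l2_Cauchy_Schwarz[OF f sqint_const[of "1::real"]] by simp
qed

lemma distr_noise_uminus:
  "distr noise (borel \<Otimes>\<^sub>M borel) (\<lambda>(z, u). (- z, u)) = (noise :: ('a::euclidean_space \<times> real) measure)"
proof -
  have "distr std_gauss borel uminus \<Otimes>\<^sub>M distr unit_unif borel (\<lambda>u. u)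
      = distr (std_gauss \<Otimes>\<^sub>M unit_unif) (borel \<Otimes>\<^sub>M borel) (\<lambda>(z :: 'a, u). (- z, u))"
    by (rule pair_measure_distr)
      (auto intro!: prob_space_imp_sigma_finite unit_unif.prob_space_distr)
  then show ?thesis
    by (simp add: noise_def distr_std_gauss_uminus distr_id2)
qed

text \<open>States \<open>(x0, y0, s, y)\<close> record the starting points of both processes, the accumulated Gaussian
  noise and the current point of the Metropolis-adjusted chain.\<close>

type_synonym 'n state = "(real ^ 'n) \<times> (real ^ 'n) \<times> (real ^ 'n) \<times> (real ^ 'n)"

abbreviation X0 :: "'n state \<Rightarrow> real ^ 'n" where "X0 w \<equiv> fst w"
abbreviation Y0 :: "'n state \<Rightarrow> real ^ 'n" where "Y0 w \<equiv> fst (snd w)"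
abbreviation S :: "'n state \<Rightarrow> real ^ 'n" where "S w \<equiv> fst (snd (snd w))"
abbreviation Y :: "'n state \<Rightarrow> real ^ 'n" where "Y w \<equiv> snd (snd (snd w))"

abbreviation state_space :: "('n::finite) state measure" where
  "state_space \<equiv> borel \<Otimes>\<^sub>M borel \<Otimes>\<^sub>M borel \<Otimes>\<^sub>M borel"

text \<open>\<open>\<zeta>\<close> couples the current law of the Euler scheme with \<pi>. The
  rejection error is known only through the bound \<eta>, so that it can be sent to 0 in the final
  estimate.\<close>

locale mala_chain = langevin_potential U L m L'
  for U :: "real ^ 'n \<Rightarrow> real" and L m L' +
  fixes \<zeta> :: "((real ^ 'n) \<times> (real ^ 'n)) measure" and h \<eta> :: real
  assumes \<zeta>_prob: "prob_space \<zeta>"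
    and \<zeta>_sets [measurable_cong]: "sets \<zeta> = sets (borel \<Otimes>\<^sub>M borel)"
    and \<zeta>_snd: "distr \<zeta> borel snd = gibbs U"
    and \<zeta>_sqint: "sqint \<zeta> (\<lambda>p. snd p - fst p)"
    and h_pos: "0 < h"
    and rej_sqint: "sqint (gibbs U \<Otimes>\<^sub>M noise) (\<lambda>(y, w). rej_error h y w)"
    and rej_l2: "l2 (gibbs U \<Otimes>\<^sub>M noise) (\<lambda>(y, w). rej_error h y w) \<le> \<eta>"
begin

abbreviation "c \<equiv> sqrt (2 * h)"
abbreviation "G \<equiv> l2 \<pi> g"
abbreviation "T \<equiv> l2 \<zeta> (\<lambda>p. snd p - fst p)"

lemma \<eta>_nonneg: "0 \<le> \<eta>"
  using rej_l2 l2_nonneg order_trans by blast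

definition step :: "'n state \<times> ((real ^ 'n) \<times> real) \<Rightarrow> 'n state" where
  "step p = (X0 (fst p), Y0 (fst p), S (fst p) + fst (snd p), mala h (Y (fst p)) (snd p))"

text \<open>Only the law of the current state is kept, no trajectory: every estimate below involves
  at most the start, the accumulated noise, the present point and one fresh increment.\<close>

primrec chain :: "nat \<Rightarrow> 'n state measure" where
  "chain 0 = distr \<zeta> state_space (\<lambda>p. (fst p, snd p, 0, snd p))"
| "chain (Suc k) = distr (chain k \<Otimes>\<^sub>M noise) state_space step"

abbreviation "P k \<equiv> chain k \<Otimes>\<^sub>M (noise :: ((real ^ 'n) \<times> real) measure)"

abbreviation "err p \<equiv> rej_error h (Y (fst p)) (snd p)"

lemma sets_chain [simp, measurable_cong]: "sets (chain k) = sets state_space"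
  by (cases k) simp_all

lemma space_chain [simp]: "space (chain k) = UNIV"
  by (cases k) (simp_all add: space_pair_measure)

lemma measurable_mala' [measurable (raw)]:
  assumes [measurable]: "f \<in> M \<rightarrow>\<^sub>M borel" "w \<in> M \<rightarrow>\<^sub>M borel \<Otimes>\<^sub>M borel"
  shows "(\<lambda>p. mala h (f p) (w p)) \<in> M \<rightarrow>\<^sub>M borel"
proof -
  have "(\<lambda>p. case_prod (mala h) (f p, w p)) \<in> M \<rightarrow>\<^sub>M borel" by measurable
  then show ?thesis by simp
qed

lemma measurable_rej_error' [measurable (raw)]:
  assumes [measurable]: "f \<in> M \<rightarrow>\<^sub>M borel" "w \<in> M \<rightarrow>\<^sub>M borel \<Otimes>\<^sub>M borel"
  shows "(\<lambda>p. rej_error h (f p) (w p)) \<in> M \<rightarrow>\<^sub>M borel"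
proof -
  have "(\<lambda>p. case_prod (rej_error h) (f p, w p)) \<in> M \<rightarrow>\<^sub>M borel" by measurable
  then show ?thesis by simp
qed

lemma measurable_step [measurable]: "step \<in> P k \<rightarrow>\<^sub>M state_space"
  unfolding step_def by measurable

lemma prob_space_chain: "prob_space (chain k)"
proof (induction k)
  case 0
  interpret \<zeta>: prob_space \<zeta> by (rule \<zeta>_prob)
  show ?case unfolding chain.simps by (rule \<zeta>.prob_space_distr) measurable
next
  case (Suc k)
  then interpret P: prob_space "P k"
    by (intro prob_space_pair noise.prob_space_axioms)
  show ?case unfolding chain.simps by (rule P.prob_space_distr) measurable
qed

section \<open>Marginal laws of the chain\<close>

lemma P_fst: "distr (P k) state_space fst = chain k"
proof -
  interpret chain: prob_space "chain k" by (rule prob_space_chain)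
  have "distr (P k) (chain k) fst = chain k"
    by (rule noise.distr_pair_fst)
  moreover have "distr (P k) (chain k) fst = distr (P k) state_space fst"
    by (intro distr_cong) simp_all
  ultimately show ?thesis by simp
qed

lemma distr_P:
  assumes [measurable]: "f \<in> state_space \<rightarrow>\<^sub>M N"
  shows "distr (P k) (N \<Otimes>\<^sub>M (borel \<Otimes>\<^sub>M borel)) (\<lambda>p. (f (fst p), snd p)) = distr (chain k) N f \<Otimes>\<^sub>M noise"
proof -
  have "distr (chain k) N f \<Otimes>\<^sub>M distr noise (borel \<Otimes>\<^sub>M borel) (\<lambda>w. w)
      = distr (P k) (N \<Otimes>\<^sub>M (borel \<Otimes>\<^sub>M borel)) (\<lambda>(x, y). (f x, y))"
    by (rule pair_measure_distr) (auto intro!: prob_space_imp_sigma_finite noise.prob_space_distr)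
  then show ?thesis by (simp add: distr_id2 case_prod_unfold)
qed

lemma law_Y: "distr (chain k) borel Y = \<pi>"
proof (induction k)
  case 0
  show ?case by (simp add: distr_distr comp_def \<zeta>_snd)
next
  case (Suc k)
  have "distr (chain (Suc k)) borel Y = distr (P k) borel (\<lambda>p. mala h (Y (fst p)) (snd p))"
    by (simp add: distr_distr comp_def step_def)
  also have "\<dots> = distr (distr (P k) (borel \<Otimes>\<^sub>M (borel \<Otimes>\<^sub>M borel)) (\<lambda>p. (Y (fst p), snd p))) borel (\<lambda>(y, w). mala h y w)"
    by (subst distr_distr) (auto simp: comp_def)
  also have "\<dots> = \<pi>"
    by (subst distr_P) (simp_all add: Suc mala_invariant[OF h_pos])
  finally show ?case .
qed

lemma law_X0_Y0: "distr (chain k) (borel \<Otimes>\<^sub>M borel) (\<lambda>w. (X0 w, Y0 w)) = \<zeta>"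
proof (induction k)
  case 0
  show ?case by (simp add: distr_distr comp_def distr_id2 \<zeta>_sets)
next
  case (Suc k)
  have "distr (chain (Suc k)) (borel \<Otimes>\<^sub>M borel) (\<lambda>w. (X0 w, Y0 w))
      = distr (distr (P k) state_space fst) (borel \<Otimes>\<^sub>M borel) (\<lambda>w. (X0 w, Y0 w))"
    by (simp add: distr_distr comp_def step_def)
  then show ?case by (simp add: P_fst Suc)
qed

text \<open>The accumulated noise is tied to \<open>Y\<close>, but it stays independent of
  \<open>X0\<close> and Gaussian with covariance k times the identity. This is what makes
  \<open>endpoint\<close> an exact Euler step.\<close>

lemma law_X0_S:
  "distr (chain k) (borel \<Otimes>\<^sub>M borel) (\<lambda>w. (X0 w, S w))
    = distr \<zeta> borel fst \<Otimes>\<^sub>M distr std_gauss borel (\<lambda>z. sqrt (real k) *\<^sub>R z)"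
    (is "_ = ?\<mu> \<Otimes>\<^sub>M ?N k")
proof -
  interpret \<mu>: prob_space ?\<mu> by (intro prob_space.prob_space_distr \<zeta>_prob) measurable
  have N: "prob_space (?N k)" for k by (intro std_gauss.prob_space_distr) measurable
  show ?thesis
  proof (induction k)
    case 0
    show ?case
    proof (rule measure_eqI)
      fix A assume "A \<in> sets (distr (chain 0) (borel \<Otimes>\<^sub>M borel) (\<lambda>w. (X0 w, S w)))"
      then have [measurable]: "A \<in> sets (borel \<Otimes>\<^sub>M borel)" by simp
      interpret N: prob_space "?N 0" by (rule N)
      have "emeasure (distr (chain 0) (borel \<Otimes>\<^sub>M borel) (\<lambda>w. (X0 w, S w))) A
          = (\<integral>\<^sup>+q. indicator A q \<partial>distr \<zeta> (borel \<Otimes>\<^sub>M borel) (\<lambda>p. (fst p, 0)))"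
        by (simp add: distr_distr comp_def)
      also have "\<dots> = (\<integral>\<^sup>+p. indicator A (fst p, 0) \<partial>\<zeta>)"
        by (subst nn_integral_distr) auto
      also have "\<dots> = (\<integral>\<^sup>+x. indicator A (x, 0) \<partial>?\<mu>)"
        by (subst nn_integral_distr) auto
      also have "\<dots> = (\<integral>\<^sup>+x. \<integral>\<^sup>+s. indicator A (x, s) \<partial>?N 0 \<partial>?\<mu>)"
        by (subst nn_integral_distr) (auto simp: std_gauss.emeasure_space_1[simplified])
      also have "\<dots> = emeasure (?\<mu> \<Otimes>\<^sub>M ?N 0) A"
        by (subst N.emeasure_pair_measure) auto
      finally show "emeasure (distr (chain 0) (borel \<Otimes>\<^sub>M borel) (\<lambda>w. (X0 w, S w))) A
          = emeasure (?\<mu> \<Otimes>\<^sub>M ?N 0) A" .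
    qed (auto intro!: sets_pair_measure_cong)
  next
    case (Suc k)
    interpret N: prob_space "?N k" by (rule N)
    interpret N': prob_space "?N (Suc k)" by (rule N)
    interpret \<mu>N: prob_space "?\<mu> \<Otimes>\<^sub>M ?N k" by (intro prob_space_pair \<mu>.prob_space_axioms N)
    have "distr (chain (Suc k)) (borel \<Otimes>\<^sub>M borel) (\<lambda>w. (X0 w, S w))
        = distr (distr (P k) ((borel \<Otimes>\<^sub>M borel) \<Otimes>\<^sub>M (borel \<Otimes>\<^sub>M borel)) (\<lambda>p. ((X0 (fst p), S (fst p)), snd p)))
          (borel \<Otimes>\<^sub>M borel) (\<lambda>q. (fst (fst q), snd (fst q) + fst (snd q)))"
      by (simp add: distr_distr comp_def step_def)
    also have "distr (P k) ((borel \<Otimes>\<^sub>M borel) \<Otimes>\<^sub>M (borel \<Otimes>\<^sub>M borel)) (\<lambda>p. ((X0 (fst p), S (fst p)), snd p))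
        = (?\<mu> \<Otimes>\<^sub>M ?N k) \<Otimes>\<^sub>M noise"
      by (subst distr_P[of "\<lambda>w. (X0 w, S w)"]) (simp_all add: Suc)
    also have "distr ((?\<mu> \<Otimes>\<^sub>M ?N k) \<Otimes>\<^sub>M noise) (borel \<Otimes>\<^sub>M borel) (\<lambda>q. (fst (fst q), snd (fst q) + fst (snd q)))
        = ?\<mu> \<Otimes>\<^sub>M ?N (Suc k)" (is "?D = _")
    proof (rule measure_eqI)
      fix A assume "A \<in> sets ?D"
      then have [measurable]: "A \<in> sets (borel \<Otimes>\<^sub>M borel)" by simp
      have "emeasure ?D A = (\<integral>\<^sup>+q. indicator A q \<partial>?D)" by simp
      also have "\<dots> = (\<integral>\<^sup>+q. indicator A (fst (fst q), snd (fst q) + fst (snd q)) \<partial>((?\<mu> \<Otimes>\<^sub>M ?N k) \<Otimes>\<^sub>M noise))"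
        by (subst nn_integral_distr) auto
      also have "\<dots> = (\<integral>\<^sup>+q. \<integral>\<^sup>+w. indicator A (fst q, snd q + fst w) \<partial>noise \<partial>(?\<mu> \<Otimes>\<^sub>M ?N k))"
        by (subst noise.nn_integral_fst[symmetric]) auto
      also have "\<dots> = (\<integral>\<^sup>+q. \<integral>\<^sup>+z. indicator A (fst q, snd q + z) \<partial>std_gauss \<partial>(?\<mu> \<Otimes>\<^sub>M ?N k))"
        by (subst nn_integral_noise) (auto simp: unit_unif.emeasure_space_1[simplified])
      also have "\<dots> = (\<integral>\<^sup>+x. \<integral>\<^sup>+s. \<integral>\<^sup>+z. indicator A (x, s + z) \<partial>std_gauss \<partial>?N k \<partial>?\<mu>)"
        by (subst N.nn_integral_fst[symmetric]) auto
      also have "\<dots> = (\<integral>\<^sup>+x. \<integral>\<^sup>+s. \<integral>\<^sup>+z. indicator A (x, sqrt (real k) *\<^sub>R s + 1 *\<^sub>R z) \<partial>std_gauss \<partial>std_gauss \<partial>?\<mu>)"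
        by (subst nn_integral_distr) auto
      also have "\<dots> = (\<integral>\<^sup>+x. \<integral>\<^sup>+z. indicator A (x, sqrt (real (Suc k)) *\<^sub>R z) \<partial>std_gauss \<partial>?\<mu>)"
        by (subst nn_integral_std_gauss_sum) (auto simp: add.commute)
      also have "\<dots> = (\<integral>\<^sup>+x. \<integral>\<^sup>+s. indicator A (x, s) \<partial>?N (Suc k) \<partial>?\<mu>)"
        by (subst nn_integral_distr) auto
      also have "\<dots> = emeasure (?\<mu> \<Otimes>\<^sub>M ?N (Suc k)) A"
        by (subst N'.emeasure_pair_measure) auto
      finally show "emeasure ?D A = emeasure (?\<mu> \<Otimes>\<^sub>M ?N (Suc k)) A" .
    qed (auto intro!: sets_pair_measure_cong)
    finally show ?case .
  qed
qed

section \<open>Norms and integrals across one step\<close>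

lemma l2_P_fst:
  fixes f :: "'n state \<Rightarrow> 'b::euclidean_space"
  assumes "f \<in> borel_measurable state_space"
  shows "sqint (P k) (\<lambda>p. f (fst p)) \<longleftrightarrow> sqint (chain k) f" "l2 (P k) (\<lambda>p. f (fst p)) = l2 (chain k) f"
  using l2_comp[OF _ P_fst assms] by auto

lemma l2_P_step:
  fixes f :: "'n state \<Rightarrow> 'b::euclidean_space"
  assumes "f \<in> borel_measurable state_space"
  shows "sqint (P k) (\<lambda>p. f (step p)) \<longleftrightarrow> sqint (chain (Suc k)) f"
    "l2 (P k) (\<lambda>p. f (step p)) = l2 (chain (Suc k)) f"
  using l2_comp[OF measurable_step chain.simps(2)[symmetric] assms] by auto

lemma integral_P_fst:
  fixes f :: "'n state \<Rightarrow> real"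
  assumes "f \<in> borel_measurable state_space"
  shows "(LINT p|P k. f (fst p)) = (LINT w|chain k. f w)"
  using integral_distr[OF _ assms, of fst "P k"] by (simp add: P_fst)

lemma integral_P_step:
  fixes f :: "'n state \<Rightarrow> real"
  assumes "f \<in> borel_measurable state_space"
  shows "(LINT w|chain (Suc k). f w) = (LINT p|P k. f (step p))"
  using integral_distr[OF measurable_step assms] by simp

lemma l2_stationary:
  fixes f :: "real ^ 'n \<Rightarrow> real ^ 'n"
  assumes "f \<in> borel_measurable borel"
  shows "sqint (chain k) (\<lambda>w. f (Y w)) \<longleftrightarrow> sqint \<pi> f" "l2 (chain k) (\<lambda>w. f (Y w)) = l2 \<pi> f"
    "sqint (chain k) (\<lambda>w. f (Y0 w)) \<longleftrightarrow> sqint \<pi> f" "l2 (chain k) (\<lambda>w. f (Y0 w)) = l2 \<pi> f"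
proof -
  have "distr (chain k) borel Y0 = \<pi>"
  proof -
    have "distr (chain k) borel Y0 = distr (distr (chain k) (borel \<Otimes>\<^sub>M borel) (\<lambda>w. (X0 w, Y0 w))) borel snd"
      by (simp add: distr_distr comp_def)
    then show ?thesis by (simp add: law_X0_Y0 \<zeta>_snd)
  qed
  then show "sqint (chain k) (\<lambda>w. f (Y0 w)) \<longleftrightarrow> sqint \<pi> f" "l2 (chain k) (\<lambda>w. f (Y0 w)) = l2 \<pi> f"
    using l2_comp[OF _ _ assms, of Y0 "chain k"] by auto
  show "sqint (chain k) (\<lambda>w. f (Y w)) \<longleftrightarrow> sqint \<pi> f" "l2 (chain k) (\<lambda>w. f (Y w)) = l2 \<pi> f"
    using l2_comp[OF _ law_Y assms] by auto
qed

lemma sqint_gY: "sqint (chain k) (\<lambda>w. g (Y w))" "sqint (chain k) (\<lambda>w. g (Y0 w))"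
  and l2_gY: "l2 (chain k) (\<lambda>w. g (Y w)) = G" "l2 (chain k) (\<lambda>w. g (Y0 w)) = G"
  using l2_stationary[of g] sqint_gibbs_grad by auto

lemma sqint_displacement: "sqint (chain k) (\<lambda>w. Y w - Y0 w)"
  using sqint_diff[of "chain k" "\<lambda>w. Y w - xs" "\<lambda>w. Y0 w - xs"] l2_stationary[of "\<lambda>y. y - xs"] sqint_gibbs
  by simp

lemma sqint_\<Theta>: "sqint (chain k) (\<lambda>w. Y0 w - X0 w)"
  and l2_\<Theta>: "l2 (chain k) (\<lambda>w. Y0 w - X0 w) = T"
  using l2_comp[OF _ law_X0_Y0, where f="\<lambda>p. snd p - fst p"] \<zeta>_sqint by auto

lemma sqint_err: "sqint (P k) (\<lambda>p. err p)"
  and l2_err: "l2 (P k) (\<lambda>p. err p) \<le> \<eta>"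
proof -
  have D: "distr (P k) (borel \<Otimes>\<^sub>M (borel \<Otimes>\<^sub>M borel)) (\<lambda>p. (Y (fst p), snd p)) = \<pi> \<Otimes>\<^sub>M noise"
    by (subst distr_P) (simp_all add: law_Y)
  show "sqint (P k) (\<lambda>p. err p)" "l2 (P k) (\<lambda>p. err p) \<le> \<eta>"
    using l2_comp[OF _ D, of "\<lambda>(y, w). rej_error h y w"] rej_sqint rej_l2 by auto
qed

lemma sqint_gauss: "sqint (P k) (\<lambda>p. fst (snd p))"
  and l2_gauss: "(l2 (P k) (\<lambda>p. fst (snd p)))\<^sup>2 = real CARD('n)"
proof -
  interpret chain: prob_space "chain k" by (rule prob_space_chain)
  have D: "distr (P k) borel (\<lambda>p. fst (snd p)) = (std_gauss :: (real ^ 'n) measure)" (is "?D = _")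
  proof (rule measure_eqI)
    fix A assume "A \<in> sets ?D"
    then have [measurable]: "A \<in> sets borel" by simp
    have "emeasure ?D A = (\<integral>\<^sup>+z. indicator A z \<partial>?D)" by simp
    also have "\<dots> = (\<integral>\<^sup>+p. indicator A (fst (snd p)) \<partial>P k)"
      by (subst nn_integral_distr) auto
    also have "\<dots> = (\<integral>\<^sup>+w. \<integral>\<^sup>+v. indicator A (fst v) \<partial>noise \<partial>chain k)"
      by (subst noise.nn_integral_fst[symmetric]) auto
    also have "(\<integral>\<^sup>+v. indicator A (fst v) \<partial>noise) = emeasure std_gauss A"
      by (subst nn_integral_noise) (simp_all add: unit_unif.emeasure_space_1[simplified])
    also have "(\<integral>\<^sup>+w. emeasure std_gauss A \<partial>chain k) = emeasure std_gauss A"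
      by (simp add: chain.emeasure_space_1[simplified])
    finally show "emeasure ?D A = emeasure std_gauss A" .
  qed simp
  have m: "(\<lambda>p. fst (snd p)) \<in> P k \<rightarrow>\<^sub>M borel" by measurable
  have i: "(\<lambda>z :: real ^ 'n. z) \<in> borel_measurable borel" by measurable
  note eq = l2_comp[OF m D i]
  show "sqint (P k) (\<lambda>p. fst (snd p))"
    unfolding eq(1) by (rule sqint_std_gauss)
  show "(l2 (P k) (\<lambda>p. fst (snd p)))\<^sup>2 = real CARD('n)"
    unfolding eq(2) using l2_std_gauss[where 'a="real ^ 'n"] by simp
qed

text \<open>The fresh Gaussian is symmetric and independent of the state and of the uniform
  variable.\<close>

lemma integral_P_reflect:
  fixes f :: "'n state \<times> ((real ^ 'n) \<times> real) \<Rightarrow> real"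
  assumes [measurable]: "f \<in> borel_measurable (state_space \<Otimes>\<^sub>M (borel \<Otimes>\<^sub>M borel))"
  shows "(LINT p|P k. f (fst p, (- fst (snd p), snd (snd p)))) = (LINT p|P k. f p)"
proof -
  have "distr (chain k) state_space (\<lambda>w. w) \<Otimes>\<^sub>M distr noise (borel \<Otimes>\<^sub>M borel) (\<lambda>(z :: real ^ 'n, u :: real). (- z, u))
      = distr (P k) (state_space \<Otimes>\<^sub>M (borel \<Otimes>\<^sub>M borel)) (\<lambda>(w, v). (w, (\<lambda>(z, u). (- z, u)) v))"
    by (rule pair_measure_distr) (auto intro!: prob_space_imp_sigma_finite noise.prob_space_distr)
  then have "P k = distr (P k) (state_space \<Otimes>\<^sub>M (borel \<Otimes>\<^sub>M borel)) (\<lambda>p. (fst p, (- fst (snd p), snd (snd p))))"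
    unfolding distr_noise_uminus by (simp add: distr_id2 case_prod_unfold)
  then have "(LINT p|P k. f p) = (LINT p|distr (P k) (state_space \<Otimes>\<^sub>M (borel \<Otimes>\<^sub>M borel)) (\<lambda>p. (fst p, (- fst (snd p), snd (snd p)))). f p)"
    by simp
  also have "\<dots> = (LINT p|P k. f (fst p, (- fst (snd p), snd (snd p))))"
    by (rule integral_distr) measurable
  finally show ?thesis by simp
qed

text \<open>The integrand is odd in the Gaussian. Measurability of \<open>F\<close> suffices, since
  the Bochner integral of a non-integrable function is 0.\<close>

lemma gauss_orthogonal:
  assumes [measurable]: "F \<in> borel_measurable state_space"
  shows "(LINT p|P k. F (fst p) \<bullet> fst (snd p)) = 0"
  using integral_P_reflect[of "\<lambda>p. F (fst p) \<bullet> fst (snd p)" k] by simp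

lemma Y_step: "Y (step p) = Y (fst p) - h *\<^sub>R g (Y (fst p)) + c *\<^sub>R fst (snd p) + err p"
  by (cases p) (simp add: step_def rej_error_def propose_def split_def)

text \<open>Independence turns the integral into a product, so only the second moment
  \<open>CARD('n)\<close> of the Gaussian enters; Cauchy-Schwarz applied to the product would bring
  in the fourth.\<close>

lemma expectation_F_gauss2:
  assumes F: "sqint (chain k) F"
  shows "integrable (P k) (\<lambda>p. norm (F (fst p)) * (norm (fst (snd p)))\<^sup>2)"
    "(LINT p|P k. norm (F (fst p)) * (norm (fst (snd p)))\<^sup>2) \<le> real CARD('n) * l2 (chain k) F"
proof -
  interpret chain: prob_space "chain k" by (rule prob_space_chain)
  have [measurable]: "F \<in> borel_measurable state_space"
    using sqint_measurable[OF F] by (simp cong: measurable_cong_sets)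
  note i = chain.integral_norm_le_l2[OF F]
  have "(\<integral>\<^sup>+p. ennreal (norm (F (fst p)) * (norm (fst (snd p)))\<^sup>2) \<partial>P k)
      = (\<integral>\<^sup>+w. \<integral>\<^sup>+v. ennreal (norm (F w)) * ennreal ((norm (fst v))\<^sup>2) \<partial>(noise :: ((real ^ 'n) \<times> real) measure) \<partial>chain k)"
    by (subst noise.nn_integral_fst[symmetric]) (auto simp: ennreal_mult)
  also have "\<dots> = (\<integral>\<^sup>+w. ennreal (norm (F w)) * ennreal (real CARD('n)) \<partial>chain k)"
  proof (rule nn_integral_cong)
    fix w
    have "(\<integral>\<^sup>+v. ennreal ((norm (fst v))\<^sup>2) \<partial>(noise :: ((real ^ 'n) \<times> real) measure)) = ennreal (real CARD('n))"
      using nn_integral_std_gauss_norm2[where 'a="real ^ 'n"]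
      by (subst nn_integral_noise) (auto simp: unit_unif.emeasure_space_1[simplified])
    then show "(\<integral>\<^sup>+v. ennreal (norm (F w)) * ennreal ((norm (fst v))\<^sup>2) \<partial>(noise :: ((real ^ 'n) \<times> real) measure))
        = ennreal (norm (F w)) * ennreal (real CARD('n))"
      by (subst nn_integral_cmult) auto
  qed
  also have "\<dots> = ennreal ((LINT w|chain k. norm (F w)) * real CARD('n))"
    using i(1) by (subst nn_integral_multc) (auto simp: nn_integral_eq_integral ennreal_mult integral_nonneg_AE)
  finally have "has_bochner_integral (P k) (\<lambda>p. norm (F (fst p)) * (norm (fst (snd p)))\<^sup>2) ((LINT w|chain k. norm (F w)) * real CARD('n))"
    by (intro has_bochner_integral_nn_integral) (auto simp: integral_nonneg_AE)
  then have hb: "integrable (P k) (\<lambda>p. norm (F (fst p)) * (norm (fst (snd p)))\<^sup>2)"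
    "(LINT p|P k. norm (F (fst p)) * (norm (fst (snd p)))\<^sup>2) = (LINT w|chain k. norm (F w)) * real CARD('n)"
    by (simp_all only: has_bochner_integral_iff)
  show "integrable (P k) (\<lambda>p. norm (F (fst p)) * (norm (fst (snd p)))\<^sup>2)"
    by (rule hb(1))
  show "(LINT p|P k. norm (F (fst p)) * (norm (fst (snd p)))\<^sup>2) \<le> real CARD('n) * l2 (chain k) F"
    unfolding hb(2) using mult_right_mono[OF i(2), of "real CARD('n)"] by (simp add: mult.commute)
qed

text \<open>Bounds the L^2 norm of the conditional mean of one gradient increment, tested against an
  arbitrary \<open>F\<close>: h d L' comes from the second-order effect of the noise, h L G from the
  drift, and L \<eta> from rejections.\<close>

definition "drift_bound = h * (real CARD('n) * L' + L * G) + L * \<eta>"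

lemma drift_bound_nonneg: "0 \<le> drift_bound"
  using h_pos L'_nonneg L_nonneg \<eta>_nonneg by (simp add: drift_bound_def)

text \<open>Reflecting the Gaussian increment removes the first-order term of \<open>grad U\<close>; this replaces Ito's
  formula for \<open>grad U\<close> along the diffusion.\<close>

lemma gradient_drift:
  assumes F: "sqint (chain k) F"
  shows "\<bar>LINT p|P k. F (fst p) \<bullet> (g (Y (step p)) - g (Y (fst p)))\<bar> \<le> drift_bound * l2 (chain k) F"
proof -
  have Fm[measurable]: "F \<in> borel_measurable state_space"
    using sqint_measurable[OF F] by (simp cong: measurable_cong_sets)
  \<comment> \<open>\<open>W\<close> is the purely Gaussian move and \<open>W'\<close> its mirror
    image; drift and rejection are split off and treated in \<open>l3\<close>.\<close>
  define W where "W p = Y (fst p) + c *\<^sub>R fst (snd p)" for p :: "'n state \<times> ((real ^ 'n) \<times> real)"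
  define W' where "W' p = Y (fst p) - c *\<^sub>R fst (snd p)" for p :: "'n state \<times> ((real ^ 'n) \<times> real)"
  have [measurable]: "W \<in> state_space \<Otimes>\<^sub>M (borel \<Otimes>\<^sub>M borel) \<rightarrow>\<^sub>M borel"
    "W' \<in> state_space \<Otimes>\<^sub>M (borel \<Otimes>\<^sub>M borel) \<rightarrow>\<^sub>M borel"
    unfolding W_def W'_def by measurable
  have FP: "sqint (P k) (\<lambda>p. F (fst p))" "l2 (P k) (\<lambda>p. F (fst p)) = l2 (chain k) F"
    using l2_P_fst[OF Fm] F by auto
  have gP: "sqint (P k) (\<lambda>p. g (Y (fst p)))" "l2 (P k) (\<lambda>p. g (Y (fst p))) = G"
    using l2_P_fst[of "\<lambda>w. g (Y w)" k] sqint_gY l2_gY by auto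
  have dom: "sqint (P k) (\<lambda>p. g (Y (fst p) + s *\<^sub>R fst (snd p)) - g (Y (fst p)))" for s
  proof (rule sqint_dominated(1))
    show "sqint (P k) (\<lambda>p. (L * s) *\<^sub>R fst (snd p))" by (intro sqint_scaleR sqint_gauss)
    show "norm (g (Y (fst p) + s *\<^sub>R fst (snd p)) - g (Y (fst p))) \<le> norm ((L * s) *\<^sub>R fst (snd p))" for p
      using grad_lipschitz[of "Y (fst p) + s *\<^sub>R fst (snd p)" "Y (fst p)"] L_nonneg by (simp add: abs_mult mult.assoc)
  qed measurable
  have d1: "sqint (P k) (\<lambda>p. g (W p) - g (Y (fst p)))"
    using dom[of c] by (simp add: W_def)
  have d2: "sqint (P k) (\<lambda>p. g (W' p) - g (Y (fst p)))"
    using dom[of "- c"] by (simp add: W'_def)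
  have Z: "sqint (P k) (\<lambda>p. L *\<^sub>R (- (h *\<^sub>R g (Y (fst p))) + err p))"
    by (intro sqint_scaleR sqint_add sqint_minus gP sqint_err)
  have m3: "(\<lambda>p. g (Y (step p)) - g (W p)) \<in> borel_measurable (P k)" by measurable
  have bd3: "norm (g (Y (step p)) - g (W p)) \<le> norm (L *\<^sub>R (- (h *\<^sub>R g (Y (fst p))) + err p))" for p
    using grad_lipschitz[of "Y (step p)" "W p"] L_nonneg by (simp add: Y_step W_def)
  note d3 = sqint_dominated[OF m3 Z bd3]
  \<comment> \<open>These parts are already of orders h and \<eta>, so an L^2 norm suffices; only
    the Gaussian part, of order sqrt h, has to go through the reflection.\<close>
  have l3: "l2 (P k) (\<lambda>p. g (Y (step p)) - g (W p)) \<le> L * (h * G + \<eta>)"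
  proof -
    note d3(2)
    also have "l2 (P k) (\<lambda>p. L *\<^sub>R (- (h *\<^sub>R g (Y (fst p))) + err p))
        = L * l2 (P k) (\<lambda>p. (- h) *\<^sub>R g (Y (fst p)) + err p)"
      using sqint_scaleR(2)[OF sqint_add[OF sqint_scaleR(1)[OF gP(1), of "- h"] sqint_err], of L] L_nonneg by simp
    also have "\<dots> \<le> L * (h * G + \<eta>)"
    proof (intro mult_left_mono L_nonneg)
      have "l2 (P k) (\<lambda>p. (- h) *\<^sub>R g (Y (fst p)) + err p) \<le> l2 (P k) (\<lambda>p. (- h) *\<^sub>R g (Y (fst p))) + l2 (P k) (\<lambda>p. err p)"
        by (intro l2_triangle sqint_scaleR gP sqint_err)
      then show "l2 (P k) (\<lambda>p. (- h) *\<^sub>R g (Y (fst p)) + err p) \<le> h * G + \<eta>"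
        using sqint_scaleR(2)[OF gP(1), of "- h"] gP(2) l2_err[of k] h_pos by simp
    qed
    finally show ?thesis .
  qed
  note i1 = integrable_inner_sqint[OF FP(1) d1]
  note i2 = integrable_inner_sqint[OF FP(1) d2]
  note i3 = integrable_inner_sqint[OF FP(1) d3(1)]
  have refl: "(LINT p|P k. F (fst p) \<bullet> (g (W' p) - g (Y (fst p)))) = (LINT p|P k. F (fst p) \<bullet> (g (W p) - g (Y (fst p))))"
    using integral_P_reflect[of "\<lambda>p. F (fst p) \<bullet> (g (W p) - g (Y (fst p)))" k] by (simp add: W_def W'_def)
  have "2 * (LINT p|P k. F (fst p) \<bullet> (g (W p) - g (Y (fst p))))
      = (LINT p|P k. F (fst p) \<bullet> (g (W p) - g (Y (fst p))) + F (fst p) \<bullet> (g (W' p) - g (Y (fst p))))"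
    using i1 i2 refl by simp
  also have "\<bar>\<dots>\<bar> \<le> (LINT p|P k. 2 * (L' * h) * (norm (F (fst p)) * (norm (fst (snd p)))\<^sup>2))"
  proof (rule integral_abs_bound[THEN order_trans], rule integral_mono)
    show "integrable (P k) (\<lambda>p. \<bar>F (fst p) \<bullet> (g (W p) - g (Y (fst p))) + F (fst p) \<bullet> (g (W' p) - g (Y (fst p)))\<bar>)"
      using i1 i2 by simp
    show "integrable (P k) (\<lambda>p. 2 * (L' * h) * (norm (F (fst p)) * (norm (fst (snd p)))\<^sup>2))"
      using expectation_F_gauss2(1)[OF F] by simp
    fix p
    have "F (fst p) \<bullet> (g (W p) - g (Y (fst p))) + F (fst p) \<bullet> (g (W' p) - g (Y (fst p)))
        = 2 * (F (fst p) \<bullet> ((1 / 2) *\<^sub>R (g (W p) + g (W' p)) - g (Y (fst p))))"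
      by (simp add: inner_diff_right inner_add_right)
    also have "\<bar>\<dots>\<bar> \<le> 2 * (norm (F (fst p)) * (L' / 2 * (norm (c *\<^sub>R fst (snd p)))\<^sup>2))"
    proof -
      have "\<bar>F (fst p) \<bullet> ((1 / 2) *\<^sub>R (g (W p) + g (W' p)) - g (Y (fst p)))\<bar>
          \<le> norm (F (fst p)) * (L' / 2 * (norm (c *\<^sub>R fst (snd p)))\<^sup>2)"
        unfolding W_def W'_def
        by (intro order_trans[OF Cauchy_Schwarz_ineq2] mult_left_mono grad_symmetric_difference) simp
      then show ?thesis by (simp add: abs_mult)
    qed
    also have "\<dots> = 2 * (L' * h) * (norm (F (fst p)) * (norm (fst (snd p)))\<^sup>2)"
      using h_pos by (simp add: power_mult_distrib)
    finally show "\<bar>F (fst p) \<bullet> (g (W p) - g (Y (fst p))) + F (fst p) \<bullet> (g (W' p) - g (Y (fst p)))\<bar>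
        \<le> 2 * (L' * h) * (norm (F (fst p)) * (norm (fst (snd p)))\<^sup>2)" .
  qed
  also have "\<dots> \<le> 2 * (L' * h) * (real CARD('n) * l2 (chain k) F)"
    using expectation_F_gauss2[OF F] L'_nonneg h_pos by (simp add: mult_left_mono)
  finally have 1: "\<bar>LINT p|P k. F (fst p) \<bullet> (g (W p) - g (Y (fst p)))\<bar> \<le> L' * h * (real CARD('n) * l2 (chain k) F)"
    by simp
  have "\<bar>LINT p|P k. F (fst p) \<bullet> (g (Y (step p)) - g (W p))\<bar> \<le> l2 (chain k) F * (L * (h * G + \<eta>))"
    using l2_Cauchy_Schwarz[OF FP(1) d3(1)] mult_left_mono[OF l3, of "l2 (chain k) F"] FP(2) by simp
  moreover have "(LINT p|P k. F (fst p) \<bullet> (g (Y (step p)) - g (Y (fst p))))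
      = (LINT p|P k. F (fst p) \<bullet> (g (Y (step p)) - g (W p))) + (LINT p|P k. F (fst p) \<bullet> (g (W p) - g (Y (fst p))))"
    using i1 i3 by (simp add: inner_diff_right flip: Bochner_Integration.integral_add)
  ultimately have "\<bar>LINT p|P k. F (fst p) \<bullet> (g (Y (step p)) - g (Y (fst p)))\<bar>
      \<le> l2 (chain k) F * (L * (h * G + \<eta>)) + L' * h * (real CARD('n) * l2 (chain k) F)"
    using 1 by linarith
  also have "\<dots> = drift_bound * l2 (chain k) F"
    by (simp add: drift_bound_def algebra_simps)
  finally show ?thesis .
qed

section \<open>Correlations with the start and displacement of the chain\<close>

declare chain.simps(2) [simp del]

lemma sqint_gY_step: "sqint (P k) (\<lambda>p. g (Y (step p)))"
  using l2_P_step(1)[of "\<lambda>w. g (Y w)" k] sqint_gY by simp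

lemma sqint_P_fst:
  fixes f :: "'n state \<Rightarrow> 'b::euclidean_space"
  assumes "sqint (chain k) f" shows "sqint (P k) (\<lambda>p. f (fst p))"
proof -
  have "f \<in> borel_measurable state_space"
    using sqint_measurable[OF assms] by (simp cong: measurable_cong_sets)
  then show ?thesis using l2_P_fst(1) assms by blast
qed

lemma X0_step [simp]: "X0 (step p) = X0 (fst p)"
  and Y0_step [simp]: "Y0 (step p) = Y0 (fst p)"
  and S_step [simp]: "S (step p) = S (fst p) + fst (snd p)"
  by (simp_all add: step_def)

text \<open>The initial gap is fixed before all increments, so \<open>gradient_drift\<close> applies
  with this same \<open>F\<close> at each of the k steps.\<close>

lemma start_gradient_correlation:
  "\<bar>LINT w|chain k. (Y0 w - X0 w) \<bullet> (g (Y w) - g (Y0 w))\<bar> \<le> real k * drift_bound * T"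
proof (induction k)
  case 0
  have "(LINT w|chain 0. (Y0 w - X0 w) \<bullet> (g (Y w) - g (Y0 w))) = 0"
    by (simp add: integral_distr)
  then show ?case by simp
next
  case (Suc k)
  let ?F = "\<lambda>w :: 'n state. Y0 w - X0 w"
  have F: "sqint (P k) (\<lambda>p. ?F (fst p))" by (rule sqint_P_fst[OF sqint_\<Theta>])
  have i1: "integrable (P k) (\<lambda>p. ?F (fst p) \<bullet> (g (Y (step p)) - g (Y (fst p))))"
    by (intro integrable_inner_sqint F sqint_diff sqint_gY_step sqint_P_fst[OF sqint_gY(1)])
  have i2: "integrable (P k) (\<lambda>p. ?F (fst p) \<bullet> (g (Y (fst p)) - g (Y0 (fst p))))"
    by (intro integrable_inner_sqint F sqint_diff sqint_P_fst[OF sqint_gY(1)] sqint_P_fst[OF sqint_gY(2)])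
  have "(LINT w|chain (Suc k). ?F w \<bullet> (g (Y w) - g (Y0 w)))
      = (LINT p|P k. ?F (fst p) \<bullet> (g (Y (step p)) - g (Y (fst p))) + ?F (fst p) \<bullet> (g (Y (fst p)) - g (Y0 (fst p))))"
    by (subst integral_P_step) (auto simp: inner_diff_right intro!: Bochner_Integration.integral_cong)
  also have "\<dots> = (LINT p|P k. ?F (fst p) \<bullet> (g (Y (step p)) - g (Y (fst p))))
      + (LINT w|chain k. ?F w \<bullet> (g (Y w) - g (Y0 w)))"
    using integral_P_fst[of "\<lambda>w. ?F w \<bullet> (g (Y w) - g (Y0 w))" k]
    by (subst Bochner_Integration.integral_add[OF i1 i2]) simp
  finally have "\<bar>LINT w|chain (Suc k). ?F w \<bullet> (g (Y w) - g (Y0 w))\<bar>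
      \<le> drift_bound * T + real k * drift_bound * T"
    using gradient_drift[OF sqint_\<Theta>, of k, unfolded l2_\<Theta>] Suc by linarith
  then show ?case by (simp add: algebra_simps)
qed

text \<open>The noise is orthogonal to the start, so only drift and rejections contribute, and
  Cauchy-Schwarz in the stationary law bounds both. \<open>displacement_l2\<close> uses exactly this
  direction.\<close>

lemma displacement_gradient_correlation:
  "- (real k * (h * G\<^sup>2 + \<eta> * G)) \<le> (LINT w|chain k. (Y w - Y0 w) \<bullet> g (Y0 w))"
proof (induction k)
  case 0
  have "(LINT w|chain 0. (Y w - Y0 w) \<bullet> g (Y0 w)) = 0"
    by (simp add: integral_distr)
  then show ?case by simp
next
  case (Suc k)
  have g0: "sqint (P k) (\<lambda>p. g (Y0 (fst p)))" by (rule sqint_P_fst[OF sqint_gY(2)])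
  have g1: "sqint (P k) (\<lambda>p. g (Y (fst p)))" by (rule sqint_P_fst[OF sqint_gY(1)])
  have dd: "sqint (P k) (\<lambda>p. Y (fst p) - Y0 (fst p))" by (rule sqint_P_fst[OF sqint_displacement])
  note i = integrable_inner_sqint[OF dd g0] integrable_inner_sqint[OF g1 g0]
    integrable_inner_sqint[OF sqint_gauss g0] integrable_inner_sqint[OF sqint_err g0]
  have "(LINT w|chain (Suc k). (Y w - Y0 w) \<bullet> g (Y0 w))
      = (LINT p|P k. (Y (fst p) - Y0 (fst p)) \<bullet> g (Y0 (fst p)) - h * (g (Y (fst p)) \<bullet> g (Y0 (fst p)))
          + c * (fst (snd p) \<bullet> g (Y0 (fst p))) + err p \<bullet> g (Y0 (fst p)))"
    by (subst integral_P_step)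
      (auto simp: Y_step inner_diff_left inner_add_left intro!: Bochner_Integration.integral_cong)
  also have "\<dots> = (LINT p|P k. (Y (fst p) - Y0 (fst p)) \<bullet> g (Y0 (fst p)))
      - h * (LINT p|P k. g (Y (fst p)) \<bullet> g (Y0 (fst p)))
      + c * (LINT p|P k. fst (snd p) \<bullet> g (Y0 (fst p))) + (LINT p|P k. err p \<bullet> g (Y0 (fst p)))"
    using i by simp
  also have "(LINT p|P k. fst (snd p) \<bullet> g (Y0 (fst p))) = 0"
    using gauss_orthogonal[of "\<lambda>w. g (Y0 w)" k] by (simp add: inner_commute)
  also have "(LINT p|P k. (Y (fst p) - Y0 (fst p)) \<bullet> g (Y0 (fst p))) = (LINT w|chain k. (Y w - Y0 w) \<bullet> g (Y0 w))"
    by (rule integral_P_fst[of "\<lambda>w. (Y w - Y0 w) \<bullet> g (Y0 w)"]) measurable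
  also have "(LINT p|P k. g (Y (fst p)) \<bullet> g (Y0 (fst p))) = (LINT w|chain k. g (Y w) \<bullet> g (Y0 w))"
    by (rule integral_P_fst[of "\<lambda>w. g (Y w) \<bullet> g (Y0 w)"]) measurable
  finally have eq: "(LINT w|chain (Suc k). (Y w - Y0 w) \<bullet> g (Y0 w))
      = (LINT w|chain k. (Y w - Y0 w) \<bullet> g (Y0 w)) - h * (LINT w|chain k. g (Y w) \<bullet> g (Y0 w))
        + (LINT p|P k. err p \<bullet> g (Y0 (fst p)))" by simp
  have "(LINT w|chain k. g (Y w) \<bullet> g (Y0 w)) \<le> G\<^sup>2"
    using l2_Cauchy_Schwarz[OF sqint_gY(1) sqint_gY(2), of k] by (simp add: l2_gY power2_eq_square)
  then have 1: "h * (LINT w|chain k. g (Y w) \<bullet> g (Y0 w)) \<le> h * G\<^sup>2"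
    using h_pos by (intro mult_left_mono) auto
  have "\<bar>LINT p|P k. err p \<bullet> g (Y0 (fst p))\<bar> \<le> l2 (P k) (\<lambda>p. err p) * l2 (P k) (\<lambda>p. g (Y0 (fst p)))"
    by (rule l2_Cauchy_Schwarz[OF sqint_err g0])
  also have "\<dots> \<le> \<eta> * G"
    using l2_P_fst(2)[of "\<lambda>w. g (Y0 w)" k] l2_gY(2)[of k] l2_err[of k] by (simp add: mult_right_mono)
  finally have 2: "\<bar>LINT p|P k. err p \<bullet> g (Y0 (fst p))\<bar> \<le> \<eta> * G" .
  have "real (Suc k) * (h * G\<^sup>2 + \<eta> * G) = real k * (h * G\<^sup>2 + \<eta> * G) + h * G\<^sup>2 + \<eta> * G"
    by (simp add: algebra_simps)
  then show ?case using eq 1 2 Suc by linarith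
qed

text \<open>With t = k h, the first two terms are 2 d t from the noise and t^2 G^2 from the drift.
  The third absorbs the correlation of rejections with the drift.\<close>

definition displacement_sq :: "nat \<Rightarrow> real" where
  "displacement_sq k = 2 * real CARD('n) * h * real k + h\<^sup>2 * (real k)\<^sup>2 * G\<^sup>2 + h * (real k)\<^sup>2 * G * \<eta>"

lemma displacement_sq_nonneg: "0 \<le> displacement_sq k"
  using h_pos \<eta>_nonneg by (simp add: displacement_sq_def)

text \<open>In the squared step the cross term of displacement and drift has a favourable sign up to
  its value at the start: monotonicity of \<open>g\<close> replaces \<open>g (Y w)\<close> by
  \<open>g (Y0 w)\<close>. So no factor growing with L accumulates. The rejection of each step is
  added afterwards by the triangle inequality, hence the term outside the root.\<close>

lemma displacement_l2:
  "l2 (chain k) (\<lambda>w. Y w - Y0 w) \<le> sqrt (displacement_sq k) + real k * \<eta>"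
proof (induction k)
  case 0
  have "l2 (chain 0) (\<lambda>w. Y w - Y0 w) = 0"
    by (simp add: l2_def integral_distr)
  then show ?case by (simp add: displacement_sq_def)
next
  case (Suc k)
  let ?\<Delta> = "\<lambda>w :: 'n state. Y w - Y0 w"
  define V where "V p = ?\<Delta> (fst p) + (- h) *\<^sub>R g (Y (fst p))" for p :: "'n state \<times> ((real ^ 'n) \<times> real)"
  have dP: "sqint (P k) (\<lambda>p. ?\<Delta> (fst p))" by (rule sqint_P_fst[OF sqint_displacement])
  have gP: "sqint (P k) (\<lambda>p. g (Y (fst p)))" by (rule sqint_P_fst[OF sqint_gY(1)])
  have V: "sqint (P k) V" unfolding V_def by (intro sqint_add sqint_scaleR dP gP)
  have cz: "sqint (P k) (\<lambda>p. c *\<^sub>R fst (snd p))" by (intro sqint_scaleR sqint_gauss)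
  define b where "b = real k * (h * G\<^sup>2 + \<eta> * G)"
  have corr: "- b \<le> (LINT w|chain k. ?\<Delta> w \<bullet> g (Y w))"
  proof -
    have "0 \<le> (LINT w|chain k. ?\<Delta> w \<bullet> (g (Y w) - g (Y0 w)))"
    proof (rule integral_nonneg_AE, rule AE_I2)
      fix w
      have "0 \<le> m * (norm (?\<Delta> w))\<^sup>2" using m_pos by simp
      also have "\<dots> \<le> (g (Y w) - g (Y0 w)) \<bullet> ?\<Delta> w" by (rule strongly_monotone)
      finally show "0 \<le> ?\<Delta> w \<bullet> (g (Y w) - g (Y0 w))" by (simp add: inner_commute)
    qed
    also have "\<dots> = (LINT w|chain k. ?\<Delta> w \<bullet> g (Y w)) - (LINT w|chain k. ?\<Delta> w \<bullet> g (Y0 w))"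
      using integrable_inner_sqint[OF sqint_displacement sqint_gY(1), of k]
        integrable_inner_sqint[OF sqint_displacement sqint_gY(2), of k]
      by (simp add: inner_diff_right)
    finally show ?thesis using displacement_gradient_correlation[of k] by (simp add: b_def)
  qed
  have V2: "(l2 (P k) V)\<^sup>2 \<le> (l2 (chain k) ?\<Delta>)\<^sup>2 + 2 * h * b + h\<^sup>2 * G\<^sup>2"
  proof -
    have "(l2 (P k) V)\<^sup>2 = (l2 (P k) (\<lambda>p. ?\<Delta> (fst p)))\<^sup>2
        + 2 * (LINT p|P k. ?\<Delta> (fst p) \<bullet> ((- h) *\<^sub>R g (Y (fst p)))) + (l2 (P k) (\<lambda>p. (- h) *\<^sub>R g (Y (fst p))))\<^sup>2"
      unfolding V_def by (rule l2_power2_add[OF dP sqint_scaleR(1)[OF gP]])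
    also have "(LINT p|P k. ?\<Delta> (fst p) \<bullet> ((- h) *\<^sub>R g (Y (fst p)))) = - (h * (LINT p|P k. ?\<Delta> (fst p) \<bullet> g (Y (fst p))))"
      by simp
    also have "(LINT p|P k. ?\<Delta> (fst p) \<bullet> g (Y (fst p))) = (LINT w|chain k. ?\<Delta> w \<bullet> g (Y w))"
      by (rule integral_P_fst[of "\<lambda>w. ?\<Delta> w \<bullet> g (Y w)"]) measurable
    also have "l2 (P k) (\<lambda>p. (- h) *\<^sub>R g (Y (fst p))) = h * l2 (P k) (\<lambda>p. g (Y (fst p)))"
      unfolding sqint_scaleR(2)[OF gP] using h_pos by simp
    also have "l2 (P k) (\<lambda>p. g (Y (fst p))) = l2 (chain k) (\<lambda>w. g (Y w))"
      by (rule l2_P_fst(2)[of "\<lambda>w. g (Y w)"]) measurable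
    also have "l2 (P k) (\<lambda>p. ?\<Delta> (fst p)) = l2 (chain k) ?\<Delta>"
      by (rule l2_P_fst(2)) measurable
    finally have "(l2 (P k) V)\<^sup>2 = (l2 (chain k) ?\<Delta>)\<^sup>2 - 2 * (h * (LINT w|chain k. ?\<Delta> w \<bullet> g (Y w))) + h\<^sup>2 * G\<^sup>2"
      by (simp only: l2_gY power_mult_distrib mult_minus_right add_uminus_conv_diff)
    moreover have "- (h * (LINT w|chain k. ?\<Delta> w \<bullet> g (Y w))) \<le> h * b"
      using mult_left_mono[OF corr, of h] h_pos by simp
    ultimately show ?thesis by linarith
  qed
  have W2: "(l2 (P k) (\<lambda>p. V p + c *\<^sub>R fst (snd p)))\<^sup>2 = (l2 (P k) V)\<^sup>2 + 2 * h * real CARD('n)"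
  proof -
    have "(LINT p|P k. V p \<bullet> (c *\<^sub>R fst (snd p))) = c * (LINT p|P k. V p \<bullet> fst (snd p))"
      by simp
    also have "(LINT p|P k. V p \<bullet> fst (snd p)) = 0"
      unfolding V_def by (rule gauss_orthogonal[of "\<lambda>w. ?\<Delta> w + (- h) *\<^sub>R g (Y w)"]) measurable
    finally have 1: "(LINT p|P k. V p \<bullet> (c *\<^sub>R fst (snd p))) = 0" by simp
    have "c\<^sup>2 = 2 * h" using h_pos by simp
    then have 2: "(l2 (P k) (\<lambda>p. c *\<^sub>R fst (snd p)))\<^sup>2 = 2 * h * real CARD('n)"
      unfolding sqint_scaleR(2)[OF sqint_gauss] power_mult_distrib l2_gauss power2_abs by (rule arg_cong)
    show ?thesis unfolding l2_power2_add[OF V cz] 1 2 by simp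
  qed
  \<comment> \<open>The recursion closes because k^2 grows by 2 k + 1. In the term with \<eta> only
    2 k is used up, which leaves h G \<eta>.\<close>
  have B: "displacement_sq k + 2 * h * b + h\<^sup>2 * G\<^sup>2 + 2 * h * real CARD('n) \<le> displacement_sq (Suc k)"
  proof -
    have "displacement_sq (Suc k) - (displacement_sq k + 2 * h * b + h\<^sup>2 * G\<^sup>2 + 2 * h * real CARD('n)) = h * G * \<eta>"
      by (simp add: displacement_sq_def b_def algebra_simps power2_eq_square)
    moreover have "0 \<le> h * G * \<eta>" using h_pos \<eta>_nonneg by simp
    ultimately show ?thesis by linarith
  qed
  have "l2 (P k) (\<lambda>p. V p + c *\<^sub>R fst (snd p)) \<le> sqrt (displacement_sq (Suc k)) + real k * \<eta>"
  proof (rule power2_le_imp_le)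
    define e where "e = real k * \<eta>"
    have e: "0 \<le> e" using \<eta>_nonneg by (simp add: e_def)
    have "(l2 (chain k) ?\<Delta>)\<^sup>2 \<le> (sqrt (displacement_sq k) + e)\<^sup>2"
      using Suc by (intro power_mono) (auto simp: e_def)
    also have "\<dots> = displacement_sq k + 2 * sqrt (displacement_sq k) * e + e\<^sup>2"
      using displacement_sq_nonneg[of k] by (simp add: power2_sum)
    finally have "(l2 (P k) (\<lambda>p. V p + c *\<^sub>R fst (snd p)))\<^sup>2
        \<le> displacement_sq (Suc k) + 2 * sqrt (displacement_sq k) * e + e\<^sup>2"
      using V2 W2 B by linarith
    also have "\<dots> \<le> displacement_sq (Suc k) + 2 * sqrt (displacement_sq (Suc k)) * e + e\<^sup>2"
    proof -
      have "0 \<le> 2 * h * b" "0 \<le> h\<^sup>2 * G\<^sup>2" "0 \<le> 2 * h * real CARD('n)"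
        using h_pos \<eta>_nonneg by (simp_all add: b_def)
      then have "displacement_sq k \<le> displacement_sq (Suc k)"
        using B by linarith
      then show ?thesis using e by (simp add: mult_right_mono)
    qed
    also have "\<dots> = (sqrt (displacement_sq (Suc k)) + e)\<^sup>2"
      using displacement_sq_nonneg[of "Suc k"] by (simp add: power2_sum)
    finally show "(l2 (P k) (\<lambda>p. V p + c *\<^sub>R fst (snd p)))\<^sup>2 \<le> (sqrt (displacement_sq (Suc k)) + real k * \<eta>)\<^sup>2"
      by (simp add: e_def)
  qed (use \<eta>_nonneg displacement_sq_nonneg[of "Suc k"] in simp)
  moreover have "l2 (chain (Suc k)) ?\<Delta> \<le> l2 (P k) (\<lambda>p. V p + c *\<^sub>R fst (snd p)) + l2 (P k) (\<lambda>p. err p)"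
  proof -
    have "l2 (chain (Suc k)) ?\<Delta> = l2 (P k) (\<lambda>p. ?\<Delta> (step p))"
      by (rule l2_P_step(2)[symmetric]) measurable
    also have "(\<lambda>p. ?\<Delta> (step p)) = (\<lambda>p. (V p + c *\<^sub>R fst (snd p)) + err p)"
      by (simp add: fun_eq_iff Y_step V_def)
    also have "l2 (P k) \<dots> \<le> l2 (P k) (\<lambda>p. V p + c *\<^sub>R fst (snd p)) + l2 (P k) (\<lambda>p. err p)"
      by (intro l2_triangle sqint_add V cz sqint_err)
    finally show ?thesis .
  qed
  ultimately show ?case using l2_err[of k] by (simp add: algebra_simps)
qed

text \<open>What is left of the displacement after removing the noise and the drift frozen at the
  start: the difference from an Euler step of size k h started at \<open>Y0\<close>.\<close>

definition remainder :: "nat \<Rightarrow> 'n state \<Rightarrow> real ^ 'n" where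
  "remainder k w = Y w - Y0 w - c *\<^sub>R S w + (real k * h) *\<^sub>R g (Y0 w)"

lemma measurable_remainder [measurable]: "remainder k \<in> state_space \<rightarrow>\<^sub>M borel"
  unfolding remainder_def by measurable

lemma remainder_step:
  "remainder (Suc k) (step p) = remainder k (fst p) + ((- h) *\<^sub>R (g (Y (fst p)) - g (Y0 (fst p))) + err p)"
  by (simp add: remainder_def Y_step algebra_simps)

lemma remainder_0: "sqint (chain 0) (remainder 0)" "l2 (chain 0) (remainder 0) = 0"
  "(LINT w|chain 0. F w \<bullet> remainder 0 w) = 0"
proof -
  have m: "(\<lambda>p. (fst p, snd p, 0, snd p)) \<in> \<zeta> \<rightarrow>\<^sub>M state_space" by measurable
  note eq = l2_comp[OF m chain.simps(1)[symmetric] measurable_remainder[of 0]]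
  show "sqint (chain 0) (remainder 0)" "l2 (chain 0) (remainder 0) = 0"
    using eq by (auto simp: remainder_def sqint_def l2_def)
  have "AE w in chain 0. remainder 0 w = 0"
    unfolding chain.simps(1) by (subst AE_distr_iff) (auto simp: remainder_def)
  then have "AE w in chain 0. F w \<bullet> remainder 0 w = 0" by auto
  then show "(LINT w|chain 0. F w \<bullet> remainder 0 w) = 0" by (rule integral_eq_zero_AE)
qed

lemma remainder_l2:
  "sqint (chain k) (remainder k)"
  "l2 (chain k) (remainder k) \<le> h * L * (\<Sum>j<k. l2 (chain j) (\<lambda>w. Y w - Y0 w)) + real k * \<eta>"
proof (induction k)
  case 0
  { case 1 show ?case by (rule remainder_0) }
  { case 2 show ?case using remainder_0 by simp }
next
  case (Suc k)
  let ?D = "\<lambda>p :: 'n state \<times> ((real ^ 'n) \<times> real). (- h) *\<^sub>R (g (Y (fst p)) - g (Y0 (fst p)))"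
  have r: "sqint (P k) (\<lambda>p. remainder k (fst p))" by (rule sqint_P_fst[OF Suc(1)])
  have D: "sqint (P k) ?D"
    by (intro sqint_scaleR sqint_diff sqint_P_fst[OF sqint_gY(1)] sqint_P_fst[OF sqint_gY(2)])
  have De: "sqint (P k) (\<lambda>p. ?D p + err p)" by (intro sqint_add D sqint_err)
  have eq: "(\<lambda>p. remainder (Suc k) (step p)) = (\<lambda>p. remainder k (fst p) + (?D p + err p))"
    by (simp add: fun_eq_iff remainder_step)
  { case 1
    have "sqint (P k) (\<lambda>p. remainder (Suc k) (step p))"
      unfolding eq by (intro sqint_add r De)
    then show ?case using l2_P_step(1)[OF measurable_remainder] by blast }
  { case 2
    have lD: "l2 (P k) ?D \<le> h * L * l2 (chain k) (\<lambda>w. Y w - Y0 w)"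
    proof -
      have "l2 (P k) ?D \<le> l2 (P k) (\<lambda>p. (h * L) *\<^sub>R (Y (fst p) - Y0 (fst p)))"
      proof (rule sqint_dominated(2))
        show "sqint (P k) (\<lambda>p. (h * L) *\<^sub>R (Y (fst p) - Y0 (fst p)))"
          by (intro sqint_scaleR sqint_P_fst[OF sqint_displacement])
        show "norm (?D p) \<le> norm ((h * L) *\<^sub>R (Y (fst p) - Y0 (fst p)))" for p
          using grad_lipschitz[of "Y (fst p)" "Y0 (fst p)"] h_pos L_nonneg
          by (simp add: abs_mult mult.assoc mult_left_mono)
      qed measurable
      also have "\<dots> = h * L * l2 (chain k) (\<lambda>w. Y w - Y0 w)"
        using sqint_scaleR(2)[OF sqint_P_fst[OF sqint_displacement], of k "h * L"]
          l2_P_fst(2)[of "\<lambda>w. Y w - Y0 w" k] h_pos L_nonneg by simp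
      finally show ?thesis .
    qed
    have "l2 (chain (Suc k)) (remainder (Suc k)) = l2 (P k) (\<lambda>p. remainder k (fst p) + (?D p + err p))"
      unfolding eq[symmetric] by (rule l2_P_step(2)[symmetric]) measurable
    also have "\<dots> \<le> l2 (P k) (\<lambda>p. remainder k (fst p)) + (l2 (P k) ?D + l2 (P k) (\<lambda>p. err p))"
      using l2_triangle[OF r De] l2_triangle[OF D sqint_err] by linarith
    also have "l2 (P k) (\<lambda>p. remainder k (fst p)) = l2 (chain k) (remainder k)"
      by (rule l2_P_fst(2)) measurable
    finally show ?case using Suc(2) lD l2_err[of k] by (simp add: algebra_simps) }
qed

text \<open>Each step adds h times a correlation bounded by j times \<open>drift_bound\<close>. As
  the latter is of order h up to \<eta>, the sum is of order (k h)^2 rather than (k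
  h)^(3/2).\<close>

lemma start_remainder_correlation:
  "\<bar>LINT w|chain k. (Y0 w - X0 w) \<bullet> remainder k w\<bar>
    \<le> T * (h * drift_bound * (\<Sum>j<k. real j) + real k * \<eta>)"
proof (induction k)
  case 0
  then show ?case using remainder_0(3) by simp
next
  case (Suc k)
  let ?F = "\<lambda>w :: 'n state. Y0 w - X0 w"
  have F: "sqint (P k) (\<lambda>p. ?F (fst p))" by (rule sqint_P_fst[OF sqint_\<Theta>])
  have r: "sqint (P k) (\<lambda>p. remainder k (fst p))" by (rule sqint_P_fst[OF remainder_l2(1)])
  have dg: "sqint (P k) (\<lambda>p. g (Y (fst p)) - g (Y0 (fst p)))"
    by (intro sqint_diff sqint_P_fst[OF sqint_gY(1)] sqint_P_fst[OF sqint_gY(2)])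
  note i = integrable_inner_sqint[OF F r] integrable_inner_sqint[OF F dg] integrable_inner_sqint[OF F sqint_err]
  have "(LINT w|chain (Suc k). ?F w \<bullet> remainder (Suc k) w)
      = (LINT p|P k. ?F (fst p) \<bullet> remainder k (fst p) - h * (?F (fst p) \<bullet> (g (Y (fst p)) - g (Y0 (fst p))))
          + ?F (fst p) \<bullet> err p)"
    by (subst integral_P_step)
      (auto simp: remainder_step inner_add_right inner_diff_right intro!: Bochner_Integration.integral_cong)
  also have "\<dots> = (LINT p|P k. ?F (fst p) \<bullet> remainder k (fst p))
      - h * (LINT p|P k. ?F (fst p) \<bullet> (g (Y (fst p)) - g (Y0 (fst p)))) + (LINT p|P k. ?F (fst p) \<bullet> err p)"
    using i by simp
  also have "(LINT p|P k. ?F (fst p) \<bullet> remainder k (fst p)) = (LINT w|chain k. ?F w \<bullet> remainder k w)"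
    by (rule integral_P_fst[of "\<lambda>w. ?F w \<bullet> remainder k w"]) measurable
  also have "(LINT p|P k. ?F (fst p) \<bullet> (g (Y (fst p)) - g (Y0 (fst p)))) = (LINT w|chain k. ?F w \<bullet> (g (Y w) - g (Y0 w)))"
    by (rule integral_P_fst[of "\<lambda>w. ?F w \<bullet> (g (Y w) - g (Y0 w))"]) measurable
  finally have eq: "(LINT w|chain (Suc k). ?F w \<bullet> remainder (Suc k) w)
      = (LINT w|chain k. ?F w \<bullet> remainder k w) - h * (LINT w|chain k. ?F w \<bullet> (g (Y w) - g (Y0 w)))
        + (LINT p|P k. ?F (fst p) \<bullet> err p)" .
  have "\<bar>LINT p|P k. ?F (fst p) \<bullet> err p\<bar> \<le> T * l2 (P k) (\<lambda>p. err p)"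
    using l2_Cauchy_Schwarz[OF F sqint_err] l2_P_fst(2)[of ?F k] l2_\<Theta>[of k] by simp
  then have 1: "\<bar>LINT p|P k. ?F (fst p) \<bullet> err p\<bar> \<le> T * \<eta>"
    using mult_left_mono[OF l2_err[of k], of T] by simp
  have 2: "\<bar>h * (LINT w|chain k. ?F w \<bullet> (g (Y w) - g (Y0 w)))\<bar> \<le> h * (real k * drift_bound * T)"
    using start_gradient_correlation[of k] h_pos by (simp add: abs_mult mult_left_mono)
  have "T * (h * drift_bound * (\<Sum>j<Suc k. real j) + real (Suc k) * \<eta>)
      = T * (h * drift_bound * (\<Sum>j<k. real j) + real k * \<eta>) + h * (real k * drift_bound * T) + T * \<eta>"
    by (simp add: algebra_simps)
  then show ?case using eq 1 2 Suc by linarith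
qed

end

section \<open>Contraction of the Euler map and its kernel\<close>

lemma sum_real_lessThan_le: "(\<Sum>j<N. real j) \<le> (real N)\<^sup>2 / 2"
  and sum_real_squares_lessThan_le: "(\<Sum>j<N. (real j)\<^sup>2) \<le> real N ^ 3 / 3"
proof -
  show "(\<Sum>j<N. real j) \<le> (real N)\<^sup>2 / 2"
    by (induction N) (auto simp: power2_eq_square field_simps)
  show "(\<Sum>j<N. (real j)\<^sup>2) \<le> real N ^ 3 / 3"
    by (induction N) (auto simp: power2_eq_square power3_eq_cube field_simps)
qed

context langevin_potential begin

abbreviation "\<kappa> \<equiv> kappa m L"

lemma kappa_pos: "0 < \<kappa>"
  using m_pos L_pos by (simp add: kappa_def)

lemma kappa_step_le:
  assumes "\<gamma> \<le> 1 / (m + L)" shows "\<kappa> * \<gamma> \<le> 1"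
proof -
  have "\<kappa> * \<gamma> \<le> \<kappa> * (1 / (m + L))"
    using assms kappa_pos by (intro mult_left_mono) auto
  also have "\<dots> = 2 * m * L / (m + L)\<^sup>2"
    by (simp add: kappa_def power2_eq_square)
  also have "\<dots> \<le> 1"
  proof -
    have "0 \<le> m\<^sup>2 + L\<^sup>2" by simp
    then have "2 * m * L \<le> (m + L)\<^sup>2" by (simp add: power2_sum)
    then show ?thesis using m_pos L_pos by (simp add: field_simps)
  qed
  finally show ?thesis .
qed

text \<open>Adding the square of \<open>r + \<gamma> *\<^sub>R q\<close> cancels the cross term of
  \<open>r\<close> and \<open>q\<close>, so the perturbation costs nothing in the contraction rate.
  The price is a second \<gamma>^2 (norm q)^2, and \<gamma> \<le> 1 / (m + L) is what co-coercivity
  can pay for; the contraction alone would allow 2 / (m + L).\<close>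

lemma perturbed_contraction:
  assumes \<gamma>: "0 \<le> \<gamma>" "\<gamma> \<le> 1 / (m + L)"
  shows "(norm ((y - x) - \<gamma> *\<^sub>R (g y - g x) + r))\<^sup>2
    \<le> (1 - \<kappa> * \<gamma>) * (norm (y - x))\<^sup>2 + 2 * ((y - x) \<bullet> r) + 2 * (norm r)\<^sup>2"
proof -
  define w where "w = y - x"
  define q where "q = g y - g x"
  have mL: "0 < m + L" using m_pos L_pos by simp
  have "\<kappa> * (norm w)\<^sup>2 + 2 / (m + L) * (norm q)\<^sup>2 = 2 / (m + L) * (m * L * (norm w)\<^sup>2 + (norm q)\<^sup>2)"
    by (simp add: kappa_def distrib_left)
  also have "\<dots> \<le> 2 / (m + L) * ((m + L) * (q \<bullet> w))"
    using mL cocoercive[of y x] by (intro mult_left_mono) (auto simp: w_def q_def)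
  also have "\<dots> = 2 * (q \<bullet> w)" using mL by simp
  finally have "\<gamma> * (\<kappa> * (norm w)\<^sup>2 + 2 / (m + L) * (norm q)\<^sup>2) \<le> \<gamma> * (2 * (q \<bullet> w))"
    using \<gamma> by (intro mult_left_mono)
  then have "\<gamma> * (\<kappa> * (norm w)\<^sup>2) + \<gamma> * (2 / (m + L) * (norm q)\<^sup>2) \<le> 2 * \<gamma> * (q \<bullet> w)"
    unfolding distrib_left by (simp only: mult_ac)
  moreover have "2 * \<gamma>\<^sup>2 * (norm q)\<^sup>2 \<le> \<gamma> * (2 / (m + L) * (norm q)\<^sup>2)"
  proof -
    have "\<gamma> * \<gamma> \<le> \<gamma> * (1 / (m + L))" using \<gamma> by (intro mult_left_mono)
    from mult_right_mono[OF this, of "2 * (norm q)\<^sup>2"] show ?thesis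
      by (simp add: power2_eq_square mult_ac)
  qed
  moreover have "(norm (w - \<gamma> *\<^sub>R q + r))\<^sup>2 + (norm (r + \<gamma> *\<^sub>R q))\<^sup>2
      = (norm w)\<^sup>2 - 2 * \<gamma> * (q \<bullet> w) + 2 * (w \<bullet> r) + 2 * (norm r)\<^sup>2 + 2 * \<gamma>\<^sup>2 * (norm q)\<^sup>2"
    unfolding power2_norm_eq_inner
    by (simp add: inner_add_left inner_add_right inner_diff_left inner_diff_right inner_commute
        power2_eq_square algebra_simps)
  moreover have "0 \<le> (norm (r + \<gamma> *\<^sub>R q))\<^sup>2" by simp
  ultimately have "(norm (w - \<gamma> *\<^sub>R q + r))\<^sup>2
      \<le> (norm w)\<^sup>2 - \<gamma> * (\<kappa> * (norm w)\<^sup>2) + 2 * (w \<bullet> r) + 2 * (norm r)\<^sup>2"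
    by linarith
  then show ?thesis by (simp add: w_def q_def algebra_simps)
qed

text \<open>\<open>T\<close> is the initial L^2 distance and \<open>E\<close> the total rejection
  error N \<eta>. The second summand bounds twice the correlation of the gap with the remainder, the
  third twice the squared norm of the remainder. Continuity in \<open>E\<close> is what the limit
  needs.\<close>

definition cost_bound :: "real \<Rightarrow> real \<Rightarrow> real \<Rightarrow> real" where
  "cost_bound T \<gamma> E = (1 - \<kappa> * \<gamma>) * T\<^sup>2
     + T * (\<gamma>\<^sup>2 * (real CARD('n) * L' + L * l2 \<pi> g) + (L * \<gamma> + 2) * E)
     + 2 * (L * sqrt (real CARD('n) * \<gamma> ^ 3 + \<gamma> ^ 4 * (l2 \<pi> g)\<^sup>2 / 3 + \<gamma> ^ 3 * l2 \<pi> g * E / 3) + (L * \<gamma> + 1) * E)\<^sup>2"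

lemma ula_kernel_eq:
  assumes "0 < \<gamma>"
  shows "ula_kernel U \<gamma> x = distr std_gauss borel (\<lambda>z. (x - \<gamma> *\<^sub>R g x) + sqrt (2 * \<gamma>) *\<^sub>R z)"
  using assms by (simp add: ula_kernel_def gaussian_isotropic)

lemma measurable_ula_kernel:
  assumes "0 < \<gamma>"
  shows "ula_kernel U \<gamma> \<in> borel \<rightarrow>\<^sub>M prob_algebra borel"
proof -
  have "(\<lambda>x. distr std_gauss borel (\<lambda>z. (x - \<gamma> *\<^sub>R g x) + sqrt (2 * \<gamma>) *\<^sub>R z)) \<in> borel \<rightarrow>\<^sub>M prob_algebra borel"
  proof (rule measurable_prob_algebraI)
    fix x :: "real ^ 'n"
    show "prob_space (distr std_gauss borel (\<lambda>z. (x - \<gamma> *\<^sub>R g x) + sqrt (2 * \<gamma>) *\<^sub>R z))"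
      by (rule std_gauss.prob_space_distr) measurable
  next
    have const: "(\<lambda>_. std_gauss) \<in> borel \<rightarrow>\<^sub>M subprob_algebra (borel :: (real ^ 'n) measure)"
      by (rule measurable_const) (simp add: space_subprob_algebra prob_space_imp_subprob_space prob_space_std_gauss)
    show "(\<lambda>x. distr std_gauss borel (\<lambda>z. (x - \<gamma> *\<^sub>R g x) + sqrt (2 * \<gamma>) *\<^sub>R z)) \<in> borel \<rightarrow>\<^sub>M subprob_algebra borel"
      by (rule measurable_distr2[OF _ const]) measurable
  qed
  then show ?thesis using ula_kernel_eq[OF assms] by (simp cong: measurable_cong)
qed

end

section \<open>Law and cost of the Euler endpoint\<close>

context mala_chain begin

definition endpoint :: "nat \<Rightarrow> 'n state \<Rightarrow> real ^ 'n" where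
  "endpoint k w = (X0 w - (real k * h) *\<^sub>R g (X0 w)) + c *\<^sub>R S w"

lemma measurable_endpoint [measurable]: "endpoint k \<in> state_space \<rightarrow>\<^sub>M borel"
  unfolding endpoint_def by measurable

lemma law_endpoint:
  assumes k: "0 < k"
  shows "distr (chain k) borel (endpoint k) = bind (distr \<zeta> borel fst) (ula_kernel U (real k * h))"
proof -
  define \<mu> where "\<mu> = distr \<zeta> borel fst"
  define \<gamma> where "\<gamma> = real k * h"
  have \<gamma>: "0 < \<gamma>" using k h_pos by (simp add: \<gamma>_def)
  have \<mu>_sets[simp, measurable_cong]: "sets \<mu> = sets borel" by (simp add: \<mu>_def)
  interpret \<mu>: prob_space \<mu> unfolding \<mu>_def by (intro prob_space.prob_space_distr \<zeta>_prob) measurable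
  let ?N = "distr std_gauss borel (\<lambda>z :: real ^ 'n. sqrt (real k) *\<^sub>R z)"
  interpret N: prob_space ?N by (intro std_gauss.prob_space_distr) measurable
  have kernel: "ula_kernel U \<gamma> \<in> \<mu> \<rightarrow>\<^sub>M subprob_algebra borel"
    using measurable_prob_algebraD[OF measurable_ula_kernel[OF \<gamma>]] by (simp cong: measurable_cong_sets)
  have sq: "c * sqrt (real k) = sqrt (2 * \<gamma>)"
    by (simp add: \<gamma>_def real_sqrt_mult[symmetric] mult_ac)
  have "distr (chain k) borel (endpoint k)
      = distr (distr (chain k) (borel \<Otimes>\<^sub>M borel) (\<lambda>w. (X0 w, S w))) borel (\<lambda>p. (fst p - \<gamma> *\<^sub>R g (fst p)) + c *\<^sub>R snd p)"
    by (simp add: distr_distr comp_def endpoint_def[abs_def] \<gamma>_def)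
  also have "\<dots> = distr (\<mu> \<Otimes>\<^sub>M ?N) borel (\<lambda>p. (fst p - \<gamma> *\<^sub>R g (fst p)) + c *\<^sub>R snd p)"
    by (simp add: law_X0_S \<mu>_def)
  also have "\<dots> = bind \<mu> (ula_kernel U \<gamma>)" (is "?D = _")
  proof (rule measure_eqI)
    show "sets ?D = sets (bind \<mu> (ula_kernel U \<gamma>))"
      by (simp add: sets_bind[OF sets_kernel[OF kernel]] \<mu>.not_empty)
    fix A assume "A \<in> sets ?D"
    then have A[measurable]: "A \<in> sets borel" by simp
    have "emeasure ?D A = (\<integral>\<^sup>+x. indicator A x \<partial>?D)" by simp
    also have "\<dots> = (\<integral>\<^sup>+p. indicator A ((fst p - \<gamma> *\<^sub>R g (fst p)) + c *\<^sub>R snd p) \<partial>(\<mu> \<Otimes>\<^sub>M ?N))"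
      by (subst nn_integral_distr) auto
    also have "\<dots> = (\<integral>\<^sup>+x. \<integral>\<^sup>+s. indicator A ((x - \<gamma> *\<^sub>R g x) + c *\<^sub>R s) \<partial>?N \<partial>\<mu>)"
      by (subst N.nn_integral_fst[symmetric]) auto
    also have "\<dots> = (\<integral>\<^sup>+x. \<integral>\<^sup>+z. indicator A ((x - \<gamma> *\<^sub>R g x) + sqrt (2 * \<gamma>) *\<^sub>R z) \<partial>std_gauss \<partial>\<mu>)"
      by (subst nn_integral_distr) (auto simp: sq)
    also have "\<dots> = (\<integral>\<^sup>+x. emeasure (ula_kernel U \<gamma> x) A \<partial>\<mu>)"
    proof (rule nn_integral_cong)
      fix x
      have "emeasure (ula_kernel U \<gamma> x) A = (\<integral>\<^sup>+y. indicator A y \<partial>ula_kernel U \<gamma> x)"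
        by (simp add: ula_kernel_eq[OF \<gamma>])
      also have "\<dots> = (\<integral>\<^sup>+z. indicator A ((x - \<gamma> *\<^sub>R g x) + sqrt (2 * \<gamma>) *\<^sub>R z) \<partial>std_gauss)"
        unfolding ula_kernel_eq[OF \<gamma>] by (rule nn_integral_distr) auto
      finally show "(\<integral>\<^sup>+z. indicator A ((x - \<gamma> *\<^sub>R g x) + sqrt (2 * \<gamma>) *\<^sub>R z) \<partial>std_gauss) = emeasure (ula_kernel U \<gamma> x) A"
        by simp
    qed
    also have "\<dots> = emeasure (bind \<mu> (ula_kernel U \<gamma>)) A"
      by (rule emeasure_bind[symmetric, OF _ kernel A]) (simp add: \<mu>.not_empty)
    finally show "emeasure ?D A = emeasure (bind \<mu> (ula_kernel U \<gamma>)) A" .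
  qed
  finally show ?thesis by (simp add: \<mu>_def \<gamma>_def)
qed

text \<open>The final gap is the Euler map applied to the initial pair plus \<open>remainder\<close>
  (step \<open>eq\<close>), so \<open>perturbed_contraction\<close> holds pointwise and is then
  integrated.\<close>

lemma endpoint_cost:
  assumes \<gamma>: "\<gamma> = real N * h" "\<gamma> \<le> 1 / (m + L)" and E: "E = real N * \<eta>"
  shows "sqint (chain N) (\<lambda>w. Y w - endpoint N w)"
    "(l2 (chain N) (\<lambda>w. Y w - endpoint N w))\<^sup>2 \<le> cost_bound T \<gamma> E"
proof -
  let ?r = "remainder N"
  let ?\<Theta> = "\<lambda>w :: 'n state. Y0 w - X0 w"
  define a where "a j = l2 (chain j) (\<lambda>w. Y w - Y0 w)" for j
  have \<gamma>0: "0 \<le> \<gamma>" using \<gamma> h_pos by simp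
  have E0: "0 \<le> E" using E \<eta>_nonneg by simp
  have eq: "Y w - endpoint N w = ?\<Theta> w - \<gamma> *\<^sub>R (g (Y0 w) - g (X0 w)) + ?r w" for w
    by (simp add: endpoint_def remainder_def \<gamma> algebra_simps)
  have q: "sqint (chain N) (\<lambda>w. g (Y0 w) - g (X0 w))"
  proof (rule sqint_dominated(1))
    show "sqint (chain N) (\<lambda>w. L *\<^sub>R (?\<Theta> w))" by (intro sqint_scaleR sqint_\<Theta>)
    show "norm (g (Y0 w) - g (X0 w)) \<le> norm (L *\<^sub>R (?\<Theta> w))" for w
      using grad_lipschitz[of "Y0 w" "X0 w"] L_nonneg by simp
  qed measurable
  show sq: "sqint (chain N) (\<lambda>w. Y w - endpoint N w)"
    unfolding eq by (intro sqint_add sqint_diff sqint_scaleR sqint_\<Theta> q remainder_l2)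
  have ir: "integrable (chain N) (\<lambda>w. ?\<Theta> w \<bullet> ?r w)"
    by (intro integrable_inner_sqint sqint_\<Theta> remainder_l2)
  have "(l2 (chain N) (\<lambda>w. Y w - endpoint N w))\<^sup>2
      \<le> (LINT w|chain N. (1 - \<kappa> * \<gamma>) * (norm (?\<Theta> w))\<^sup>2 + 2 * (?\<Theta> w \<bullet> ?r w) + 2 * (norm (?r w))\<^sup>2)"
    unfolding l2_power2
  proof (rule integral_mono)
    show "integrable (chain N) (\<lambda>w. (norm (Y w - endpoint N w))\<^sup>2)"
      by (rule sqint_integrable[OF sq])
    show "integrable (chain N) (\<lambda>w. (1 - \<kappa> * \<gamma>) * (norm (?\<Theta> w))\<^sup>2 + 2 * (?\<Theta> w \<bullet> ?r w) + 2 * (norm (?r w))\<^sup>2)"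
      using ir sqint_integrable[OF sqint_\<Theta>, of N] sqint_integrable[OF remainder_l2(1), of N] by simp
    show "(norm (Y w - endpoint N w))\<^sup>2
        \<le> (1 - \<kappa> * \<gamma>) * (norm (?\<Theta> w))\<^sup>2 + 2 * (?\<Theta> w \<bullet> ?r w) + 2 * (norm (?r w))\<^sup>2" for w
      unfolding eq by (rule perturbed_contraction[OF \<gamma>0 \<gamma>(2)])
  qed
  also have "\<dots> = (1 - \<kappa> * \<gamma>) * T\<^sup>2 + 2 * (LINT w|chain N. ?\<Theta> w \<bullet> ?r w) + 2 * (l2 (chain N) ?r)\<^sup>2"
    using ir sqint_integrable[OF sqint_\<Theta>, of N] sqint_integrable[OF remainder_l2(1), of N]
    unfolding l2_\<Theta>[of N, symmetric] l2_power2 by simp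
  finally have main: "(l2 (chain N) (\<lambda>w. Y w - endpoint N w))\<^sup>2
      \<le> (1 - \<kappa> * \<gamma>) * T\<^sup>2 + 2 * (LINT w|chain N. ?\<Theta> w \<bullet> ?r w) + 2 * (l2 (chain N) ?r)\<^sup>2" .
  have 1: "2 * (LINT w|chain N. ?\<Theta> w \<bullet> ?r w)
      \<le> T * (\<gamma>\<^sup>2 * (real CARD('n) * L' + L * G) + (L * \<gamma> + 2) * E)"
  proof -
    have "h * drift_bound * (\<Sum>j<N. real j) + real N * \<eta> \<le> h * drift_bound * ((real N)\<^sup>2 / 2) + E"
      unfolding E using h_pos drift_bound_nonneg
      by (intro add_mono mult_left_mono sum_real_lessThan_le) auto
    then have "2 * (h * drift_bound * (\<Sum>j<N. real j) + real N * \<eta>) \<le> h * drift_bound * (real N)\<^sup>2 + 2 * E"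
      by simp
    also have "h * drift_bound * (real N)\<^sup>2 = \<gamma>\<^sup>2 * (real CARD('n) * L' + L * G) + L * \<gamma> * E"
      by (simp add: drift_bound_def \<gamma> E power2_eq_square algebra_simps)
    also have "\<dots> + 2 * E = \<gamma>\<^sup>2 * (real CARD('n) * L' + L * G) + (L * \<gamma> + 2) * E"
      by (simp add: algebra_simps)
    finally have "T * (2 * (h * drift_bound * (\<Sum>j<N. real j) + real N * \<eta>))
        \<le> T * (\<gamma>\<^sup>2 * (real CARD('n) * L' + L * G) + (L * \<gamma> + 2) * E)"
      by (rule mult_left_mono) simp
    then show ?thesis using start_remainder_correlation[of N] by linarith
  qed
  have 2: "l2 (chain N) ?r \<le> L * sqrt (real CARD('n) * \<gamma> ^ 3 + \<gamma> ^ 4 * G\<^sup>2 / 3 + \<gamma> ^ 3 * G * E / 3) + (L * \<gamma> + 1) * E"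
  proof -
    define s where "s = (\<Sum>j<N. sqrt (displacement_sq j))"
    have s0: "0 \<le> s" unfolding s_def by (intro sum_nonneg) (simp add: displacement_sq_nonneg)
    have "(\<Sum>j<N. a j) \<le> (\<Sum>j<N. sqrt (displacement_sq j) + E)"
    proof (rule sum_mono)
      fix j assume "j \<in> {..<N}"
      then have "real j * \<eta> \<le> E" unfolding E using \<eta>_nonneg by (intro mult_right_mono) auto
      then show "a j \<le> sqrt (displacement_sq j) + E"
        using displacement_l2[of j] by (simp add: a_def)
    qed
    also have "\<dots> = s + real N * E" by (simp add: s_def sum.distrib)
    finally have "h * L * (\<Sum>j<N. a j) \<le> h * L * (s + real N * E)"
      using h_pos L_nonneg by (intro mult_left_mono) auto
    then have r1: "l2 (chain N) ?r \<le> L * (h * s) + (L * \<gamma> + 1) * E"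
      using remainder_l2(2)[of N] by (simp add: a_def \<gamma> E algebra_simps)
    have "h * s \<le> sqrt (real CARD('n) * \<gamma> ^ 3 + \<gamma> ^ 4 * G\<^sup>2 / 3 + \<gamma> ^ 3 * G * E / 3)"
    proof (rule real_le_rsqrt)
      \<comment> \<open>Cauchy-Schwarz costs a factor N. The sum of j then turns the noise part into
        d \<gamma>^3, and the sum of j^2 turns the drift part into \<gamma>^4 G^2 / 3.\<close>
      have "s\<^sup>2 \<le> (\<Sum>j<N. (sqrt (displacement_sq j))\<^sup>2) * real N"
        unfolding s_def using sum_squared_le_sum_of_squares[of "\<lambda>j. sqrt (displacement_sq j)" "{..<N}"] by simp
      also have "(\<Sum>j<N. (sqrt (displacement_sq j))\<^sup>2) = (\<Sum>j<N. displacement_sq j)"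
        by (simp add: displacement_sq_nonneg)
      also have "\<dots> = 2 * real CARD('n) * h * (\<Sum>j<N. real j) + (h\<^sup>2 * G\<^sup>2 + h * G * \<eta>) * (\<Sum>j<N. (real j)\<^sup>2)"
        unfolding displacement_sq_def sum.distrib sum_distrib_left
        by (simp add: sum.distrib[symmetric] algebra_simps)
      also have "\<dots> \<le> 2 * real CARD('n) * h * ((real N)\<^sup>2 / 2) + (h\<^sup>2 * G\<^sup>2 + h * G * \<eta>) * (real N ^ 3 / 3)"
        using h_pos \<eta>_nonneg
        by (intro add_mono mult_left_mono sum_real_lessThan_le sum_real_squares_lessThan_le) auto
      finally have "s\<^sup>2 \<le> (2 * real CARD('n) * h * ((real N)\<^sup>2 / 2)
          + (h\<^sup>2 * G\<^sup>2 + h * G * \<eta>) * (real N ^ 3 / 3)) * real N"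
        by (simp add: mult_right_mono)
      then have "(h * s)\<^sup>2 \<le> h\<^sup>2 * ((2 * real CARD('n) * h * ((real N)\<^sup>2 / 2)
          + (h\<^sup>2 * G\<^sup>2 + h * G * \<eta>) * (real N ^ 3 / 3)) * real N)"
        unfolding power_mult_distrib[of h s] by (rule mult_left_mono) simp
      also have "\<dots> = real CARD('n) * \<gamma> ^ 3 + \<gamma> ^ 4 * G\<^sup>2 / 3 + \<gamma> ^ 3 * G * E / 3"
        by (simp add: \<gamma> E power2_eq_square power3_eq_cube power4_eq_xxxx field_simps)
      finally show "(h * s)\<^sup>2 \<le> real CARD('n) * \<gamma> ^ 3 + \<gamma> ^ 4 * G\<^sup>2 / 3 + \<gamma> ^ 3 * G * E / 3" .
    qed
    from mult_left_mono[OF this L_nonneg] r1 show ?thesis by linarith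
  qed
  have "(l2 (chain N) ?r)\<^sup>2 \<le> (L * sqrt (real CARD('n) * \<gamma> ^ 3 + \<gamma> ^ 4 * G\<^sup>2 / 3 + \<gamma> ^ 3 * G * E / 3) + (L * \<gamma> + 1) * E)\<^sup>2"
    by (rule power_mono[OF 2]) simp
  then show "(l2 (chain N) (\<lambda>w. Y w - endpoint N w))\<^sup>2 \<le> cost_bound T \<gamma> E"
    unfolding cost_bound_def using main 1 by linarith
qed

end

section \<open>From one step to the Wasserstein bound\<close>

context langevin_potential begin

definition local_error :: "real \<Rightarrow> real" where
  "local_error \<gamma> = real CARD('n) * \<gamma> ^ 3 *
     (2 * L\<^sup>2 + \<gamma> * L ^ 4 * (\<gamma> / 6 + inverse m)
      + inverse \<kappa> * (4 * real CARD('n) * L'\<^sup>2 / 3 + \<gamma> * L ^ 4 + 4 * L ^ 4 / (3 * m)))"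

text \<open>Half of the contraction rate is spent, by Young's inequality, on the term linear in
  \<open>T\<close>; hence the \<kappa> \<gamma> / 2 in \<open>u1\<close> and \<open>u3\<close>. The
  constants that result are 1 against 4/3 under \<open>inverse \<kappa>\<close>, and 2/3 against 1
  for \<gamma>^4 L^4 d / m, so \<open>local_error\<close> dominates.\<close>

lemma cost_bound_0:
  assumes \<gamma>: "0 < \<gamma>"
  shows "cost_bound T \<gamma> 0 \<le> (1 - \<kappa> * \<gamma> / 2) * T\<^sup>2 + local_error \<gamma>"
proof -
  define d where "d = real CARD('n)"
  define G where "G = l2 \<pi> g"
  define A where "A = d * L' + L * G"
  define M where "M = L ^ 4 * d / m"
  have d: "0 \<le> d" by (simp add: d_def)
  have G: "L\<^sup>2 * G\<^sup>2 \<le> M"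
    using mult_left_mono[OF l2_gibbs_grad_power2, of "L\<^sup>2"]
    by (simp add: M_def G_def d_def power2_eq_square power4_eq_xxxx mult_ac)
  have M: "0 \<le> M" using G by (rule order_trans[rotated]) simp
  have "0 \<le> \<gamma> / (2 * \<kappa>) * (\<kappa> * T - \<gamma> * A)\<^sup>2"
    using \<gamma> kappa_pos by simp
  also have "\<dots> = \<kappa> * \<gamma> / 2 * T\<^sup>2 - T * (\<gamma>\<^sup>2 * A) + \<gamma> ^ 3 * A\<^sup>2 / (2 * \<kappa>)"
    using kappa_pos by (simp add: power2_eq_square power3_eq_cube field_simps)
  finally have 1: "T * (\<gamma>\<^sup>2 * A) \<le> \<kappa> * \<gamma> / 2 * T\<^sup>2 + \<gamma> ^ 3 * A\<^sup>2 / (2 * \<kappa>)" by simp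
  have "A\<^sup>2 \<le> 2 * ((d * L')\<^sup>2 + (L * G)\<^sup>2)"
    using zero_le_power2[of "d * L' - L * G"] by (simp add: A_def power2_sum power2_diff)
  also have "\<dots> \<le> 2 * (d\<^sup>2 * L'\<^sup>2 + M)" using G by (simp add: power_mult_distrib)
  finally have "\<gamma> ^ 3 * A\<^sup>2 / (2 * \<kappa>) \<le> \<gamma> ^ 3 * (2 * (d\<^sup>2 * L'\<^sup>2 + M)) / (2 * \<kappa>)"
    using \<gamma> kappa_pos by (intro divide_right_mono mult_left_mono) auto
  moreover have "\<gamma> ^ 3 * (2 * c) / (2 * \<kappa>) = \<gamma> ^ 3 * c / \<kappa>" for c by simp
  ultimately have 2: "\<gamma> ^ 3 * A\<^sup>2 / (2 * \<kappa>) \<le> \<gamma> ^ 3 * (d\<^sup>2 * L'\<^sup>2 + M) / \<kappa>"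
    by metis
  have "2 * (L * sqrt (d * \<gamma> ^ 3 + \<gamma> ^ 4 * G\<^sup>2 / 3))\<^sup>2 = 2 * L\<^sup>2 * d * \<gamma> ^ 3 + 2 / 3 * \<gamma> ^ 4 * (L\<^sup>2 * G\<^sup>2)"
    using d \<gamma> by (simp add: power_mult_distrib algebra_simps)
  also have "\<dots> \<le> 2 * L\<^sup>2 * d * \<gamma> ^ 3 + 2 / 3 * \<gamma> ^ 4 * M"
    using G by (intro add_left_mono mult_left_mono) auto
  finally have 3: "2 * (L * sqrt (d * \<gamma> ^ 3 + \<gamma> ^ 4 * G\<^sup>2 / 3))\<^sup>2 \<le> 2 * L\<^sup>2 * d * \<gamma> ^ 3 + 2 / 3 * \<gamma> ^ 4 * M" .
  have "local_error \<gamma> = 2 * L\<^sup>2 * d * \<gamma> ^ 3 + \<gamma> ^ 4 * M + \<gamma> ^ 3 * (4 / 3 * (d\<^sup>2 * L'\<^sup>2) + 4 / 3 * M) / \<kappa>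
      + d * \<gamma> ^ 5 * L ^ 4 / 6 + d * \<gamma> ^ 4 * L ^ 4 / \<kappa>"
    using m_pos kappa_pos unfolding local_error_def d_def[symmetric] M_def
    by (simp add: field_simps eval_nat_numeral)
  moreover have "\<gamma> ^ 3 * (d\<^sup>2 * L'\<^sup>2 + M) / \<kappa> \<le> \<gamma> ^ 3 * (4 / 3 * (d\<^sup>2 * L'\<^sup>2) + 4 / 3 * M) / \<kappa>"
  proof -
    have "0 \<le> d\<^sup>2 * L'\<^sup>2" by simp
    then have "d\<^sup>2 * L'\<^sup>2 + M \<le> 4 / 3 * (d\<^sup>2 * L'\<^sup>2) + 4 / 3 * M" using M by linarith
    then show ?thesis using \<gamma> kappa_pos by (intro divide_right_mono mult_left_mono) auto
  qed
  moreover have "2 / 3 * \<gamma> ^ 4 * M \<le> \<gamma> ^ 4 * M"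
    using M by (simp add: mult_right_mono)
  moreover have "0 \<le> d * \<gamma> ^ 5 * L ^ 4 / 6" "0 \<le> d * \<gamma> ^ 4 * L ^ 4 / \<kappa>"
    using d \<gamma> kappa_pos by simp_all
  moreover have "cost_bound T \<gamma> 0 = (1 - \<kappa> * \<gamma>) * T\<^sup>2 + T * (\<gamma>\<^sup>2 * A) + 2 * (L * sqrt (d * \<gamma> ^ 3 + \<gamma> ^ 4 * G\<^sup>2 / 3))\<^sup>2"
    by (simp add: cost_bound_def A_def d_def G_def)
  moreover have "(1 - \<kappa> * \<gamma> / 2) * T\<^sup>2 = (1 - \<kappa> * \<gamma>) * T\<^sup>2 + \<kappa> * \<gamma> / 2 * T\<^sup>2"
    by (simp add: algebra_simps)
  ultimately show ?thesis using 1 2 3 by linarith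
qed

text \<open>The invariant of the iteration. Square integrability belongs to it so that the
  correlations with the initial gap exist at the next step.\<close>

definition stationary_coupling :: "(real ^ 'n) measure \<Rightarrow> ((real ^ 'n) \<times> (real ^ 'n)) measure \<Rightarrow> bool" where
  "stationary_coupling \<mu> \<zeta> \<longleftrightarrow> prob_space \<zeta> \<and> sets \<zeta> = sets (borel \<Otimes>\<^sub>M borel)
     \<and> distr \<zeta> borel fst = \<mu> \<and> distr \<zeta> borel snd = \<pi> \<and> sqint \<zeta> (\<lambda>p. snd p - fst p)"

text \<open>\<epsilon> pays for stopping at a finite N: the coupling comes from one sufficiently
  fine chain, and only its cost is compared with the limit.\<close>

lemma langevin_step:
  assumes \<zeta>: "stationary_coupling \<mu> \<zeta>" and \<gamma>: "0 < \<gamma>" "\<gamma> \<le> 1 / (m + L)" and \<epsilon>: "0 < \<epsilon>"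
  obtains \<zeta>' where "stationary_coupling (bind \<mu> (ula_kernel U \<gamma>)) \<zeta>'"
    "(l2 \<zeta>' (\<lambda>p. snd p - fst p))\<^sup>2
      \<le> (1 - \<kappa> * \<gamma> / 2) * (l2 \<zeta> (\<lambda>p. snd p - fst p))\<^sup>2 + local_error \<gamma> + \<epsilon>"
proof -
  define T where "T = l2 \<zeta> (\<lambda>p. snd p - fst p)"
  obtain C where C: "0 \<le> C"
    "\<And>h. 0 < h \<Longrightarrow> h \<le> 1 \<Longrightarrow> sqint (\<pi> \<Otimes>\<^sub>M noise) (\<lambda>(y, w). rej_error h y w)"
    "\<And>h. 0 < h \<Longrightarrow> h \<le> 1 \<Longrightarrow> (l2 (\<pi> \<Otimes>\<^sub>M noise) (\<lambda>(y, w). rej_error h y w))\<^sup>2 \<le> C * sqrt h ^ 5"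
    using rejection_error_l2 by blast
  define \<eta> where "\<eta> N = sqrt (C * sqrt (\<gamma> / real N) ^ 5)" for N
  have lim: "(\<lambda>N. real N * \<eta> N) \<longlonglongrightarrow> 0"
  proof (rule Lim_transform_eventually)
    have "(\<lambda>N. sqrt (C * \<gamma>\<^sup>2 * sqrt (\<gamma> / real N))) \<longlonglongrightarrow> sqrt (C * \<gamma>\<^sup>2 * sqrt 0)"
      by (intro tendsto_intros lim_const_over_n)
    then show "(\<lambda>N. sqrt (C * \<gamma>\<^sup>2 * sqrt (\<gamma> / real N))) \<longlonglongrightarrow> 0" by simp
    \<comment> \<open>With s = sqrt (\<gamma> / N) one has N^2 s^5 = \<gamma>^2 s, so N \<eta>
      decays like N^(-1/4).\<close>
    show "\<forall>\<^sub>F N in sequentially. sqrt (C * \<gamma>\<^sup>2 * sqrt (\<gamma> / real N)) = real N * \<eta> N"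
    proof (rule eventually_sequentiallyI[of 1])
      fix N :: nat assume N: "1 \<le> N"
      define s where "s = sqrt (\<gamma> / real N)"
      have "s * s = \<gamma> / real N" using \<gamma> by (simp add: s_def)
      then have ss: "real N * (s * s) = \<gamma>" using N by simp
      have "real N * \<eta> N = sqrt ((real N)\<^sup>2 * (C * s ^ 5))"
        by (simp add: \<eta>_def s_def real_sqrt_mult)
      also have "(real N)\<^sup>2 * (C * s ^ 5) = C * (real N * (s * s))\<^sup>2 * s"
        by (simp add: power2_eq_square eval_nat_numeral)
      finally show "sqrt (C * \<gamma>\<^sup>2 * sqrt (\<gamma> / real N)) = real N * \<eta> N"
        unfolding ss by (simp add: s_def)
    qed
  qed
  have "isCont (cost_bound T \<gamma>) 0"
    unfolding cost_bound_def[abs_def] by (intro continuous_intros) simp_all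
  then have "(\<lambda>N. cost_bound T \<gamma> (real N * \<eta> N)) \<longlonglongrightarrow> cost_bound T \<gamma> 0"
    using lim by (rule isCont_tendsto_compose)
  then have "\<forall>\<^sub>F N in sequentially. cost_bound T \<gamma> (real N * \<eta> N) < cost_bound T \<gamma> 0 + \<epsilon>"
    using \<epsilon> by (intro order_tendstoD) auto
  \<comment> \<open>Ensures 0 < h \<le> 1 for h = \<gamma> / N, the range of the rejection
    estimate.\<close>
  moreover have "\<forall>\<^sub>F N in sequentially. N \<ge> max 1 (nat \<lceil>\<gamma>\<rceil>)"
    by (rule eventually_ge_at_top)
  ultimately have "\<forall>\<^sub>F N in sequentially. cost_bound T \<gamma> (real N * \<eta> N) < cost_bound T \<gamma> 0 + \<epsilon> \<and> N \<ge> max 1 (nat \<lceil>\<gamma>\<rceil>)"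
    by (rule eventually_conj)
  then obtain N where N: "cost_bound T \<gamma> (real N * \<eta> N) < cost_bound T \<gamma> 0 + \<epsilon>" "N \<ge> max 1 (nat \<lceil>\<gamma>\<rceil>)"
    using eventually_happens by force
  define h where "h = \<gamma> / real N"
  have N1: "1 \<le> N" "\<gamma> \<le> real N" using N(2) by linarith+
  have h: "0 < h" "h \<le> 1" "real N * h = \<gamma>" using N1 \<gamma> by (simp_all add: h_def)
  interpret mala_chain U L m L' \<zeta> h "\<eta> N"
  proof (intro mala_chain.intro mala_chain_axioms.intro langevin_potential_axioms)
    show "l2 (\<pi> \<Otimes>\<^sub>M noise) (\<lambda>(y, w). rej_error h y w) \<le> \<eta> N"
      unfolding \<eta>_def h_def[symmetric] using C(3)[OF h(1,2)] by (rule real_le_rsqrt)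
    show "sqint (\<pi> \<Otimes>\<^sub>M noise) (\<lambda>(y, w). rej_error h y w)" by (rule C(2)[OF h(1,2)])
    show "0 < h" by (rule h(1))
    show "prob_space \<zeta>" "sets \<zeta> = sets (borel \<Otimes>\<^sub>M borel)" "distr \<zeta> borel snd = \<pi>" "sqint \<zeta> (\<lambda>p. snd p - fst p)"
      using \<zeta> unfolding stationary_coupling_def by blast+
  qed
  define \<zeta>' where "\<zeta>' = distr (chain N) (borel \<Otimes>\<^sub>M borel) (\<lambda>w. (endpoint N w, Y w))"
  have m: "(\<lambda>w. (endpoint N w, Y w)) \<in> chain N \<rightarrow>\<^sub>M borel \<Otimes>\<^sub>M borel" by measurable
  have f: "(\<lambda>p. snd p - fst p) \<in> borel_measurable (borel \<Otimes>\<^sub>M borel :: ((real ^ 'n) \<times> (real ^ 'n)) measure)"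
    by measurable
  have \<mu>: "distr \<zeta> borel fst = \<mu>" using \<zeta> by (simp add: stationary_coupling_def)
  note eq = l2_comp[OF m \<zeta>'_def[symmetric] f, unfolded fst_conv snd_conv]
  note cost = endpoint_cost[OF h(3)[symmetric] \<gamma>(2) refl]
  show thesis
  proof (rule that)
    show "stationary_coupling (bind \<mu> (ula_kernel U \<gamma>)) \<zeta>'"
      unfolding stationary_coupling_def
    proof (intro conjI)
      show "prob_space \<zeta>'" unfolding \<zeta>'_def by (rule prob_space.prob_space_distr[OF prob_space_chain m])
      show "sets \<zeta>' = sets (borel \<Otimes>\<^sub>M borel)" by (simp add: \<zeta>'_def)
      show "distr \<zeta>' borel fst = bind \<mu> (ula_kernel U \<gamma>)"
      proof -
        have "distr \<zeta>' borel fst = distr (chain N) borel (endpoint N)"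
          unfolding \<zeta>'_def by (subst distr_distr) (auto simp: comp_def)
        then show ?thesis using law_endpoint[of N] N1 by (simp add: \<mu> h)
      qed
      have "distr \<zeta>' borel snd = distr (chain N) borel Y"
        unfolding \<zeta>'_def by (subst distr_distr) (auto simp: comp_def)
      then show "distr \<zeta>' borel snd = \<pi>" by (simp add: law_Y)
      show "sqint \<zeta>' (\<lambda>p. snd p - fst p)" using cost(1) eq(1) by blast
    qed
    have "(l2 \<zeta>' (\<lambda>p. snd p - fst p))\<^sup>2 \<le> cost_bound T \<gamma> (real N * \<eta> N)"
      using cost(2) unfolding eq(2) T_def .
    then show "(l2 \<zeta>' (\<lambda>p. snd p - fst p))\<^sup>2
      \<le> (1 - \<kappa> * \<gamma> / 2) * (l2 \<zeta> (\<lambda>p. snd p - fst p))\<^sup>2 + local_error \<gamma> + \<epsilon>"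
      using N(1) cost_bound_0[OF \<gamma>(1), of T] unfolding T_def by linarith
  qed
qed

text \<open>A Dirac mass is coupled by the product measure. Splitting y - x at the minimizer and (a
  + b)^2 \<le> 2 a^2 + 2 b^2 produce the factor 2 of \<open>u1\<close>.\<close>

lemma start_coupling:
  "stationary_coupling (return borel x) (return borel x \<Otimes>\<^sub>M \<pi>)"
  "(l2 (return borel x \<Otimes>\<^sub>M \<pi>) (\<lambda>p. snd p - fst p))\<^sup>2 \<le> 2 * ((norm (x - xs))\<^sup>2 + real CARD('n) / m)"
proof -
  let ?\<zeta> = "return borel x \<Otimes>\<^sub>M \<pi>"
  interpret r: prob_space "return borel x :: (real ^ 'n) measure" by (rule prob_space_return) simp
  interpret \<zeta>: prob_space ?\<zeta> by (intro prob_space_pair r.prob_space_axioms prob_space_gibbs)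
  have eq: "?\<zeta> = distr \<pi> (borel \<Otimes>\<^sub>M borel) (\<lambda>y. (x, y))"
  proof (rule measure_eqI)
    fix A assume "A \<in> sets ?\<zeta>"
    then have A[measurable]: "A \<in> sets (borel \<Otimes>\<^sub>M borel)" by (simp cong: sets_pair_measure_cong)
    have "emeasure ?\<zeta> A = (\<integral>\<^sup>+x. \<integral>\<^sup>+y. indicator A (x, y) \<partial>\<pi> \<partial>return borel x)"
      by (rule gibbs.emeasure_pair_measure) simp
    also have "\<dots> = (\<integral>\<^sup>+y. indicator A (x, y) \<partial>\<pi>)"
      by (subst nn_integral_return) auto
    also have "\<dots> = (\<integral>\<^sup>+p. indicator A p \<partial>distr \<pi> (borel \<Otimes>\<^sub>M borel) (\<lambda>y. (x, y)))"
      by (subst nn_integral_distr) auto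
    finally show "emeasure ?\<zeta> A = emeasure (distr \<pi> (borel \<Otimes>\<^sub>M borel) (\<lambda>y. (x, y))) A" by simp
  qed (auto intro!: sets_pair_measure_cong)
  have m: "(\<lambda>y. (x, y)) \<in> \<pi> \<rightarrow>\<^sub>M borel \<Otimes>\<^sub>M borel" by measurable
  have f: "(\<lambda>p. snd p - fst p) \<in> borel_measurable (borel \<Otimes>\<^sub>M borel :: ((real ^ 'n) \<times> (real ^ 'n)) measure)"
    by measurable
  note comp = l2_comp[OF m eq[symmetric] f, unfolded fst_conv snd_conv]
  have c: "sqint \<pi> (\<lambda>y. xs - x)" by (rule gibbs.sqint_const)
  have e: "(\<lambda>y. y - x) = (\<lambda>y. (y - xs) + (xs - x))" by simp
  have sq: "sqint \<pi> (\<lambda>y. y - x)"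
    unfolding e by (rule sqint_add[OF sqint_gibbs c])
  show "stationary_coupling (return borel x) ?\<zeta>"
    unfolding stationary_coupling_def
  proof (intro conjI)
    show "prob_space ?\<zeta>" by (rule \<zeta>.prob_space_axioms)
    show "sets ?\<zeta> = sets (borel \<Otimes>\<^sub>M borel)" by (intro sets_pair_measure_cong) simp_all
    show "distr ?\<zeta> borel fst = return borel x"
      unfolding eq by (subst distr_distr) (auto simp: comp_def gibbs.distr_const)
    show "distr ?\<zeta> borel snd = \<pi>"
      unfolding eq by (subst distr_distr) (auto simp: comp_def distr_id2)
    show "sqint ?\<zeta> (\<lambda>p. snd p - fst p)" using comp(1) sq by blast
  qed
  have cc: "l2 \<pi> (\<lambda>y. xs - x) = norm (x - xs)"
    by (simp add: l2_def gibbs.prob_space[simplified] norm_minus_commute)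
  have "l2 \<pi> (\<lambda>y. y - x) \<le> l2 \<pi> (\<lambda>y. y - xs) + norm (x - xs)"
    using l2_triangle[OF sqint_gibbs c] cc by simp
  then have "(l2 \<pi> (\<lambda>y. y - x))\<^sup>2 \<le> (l2 \<pi> (\<lambda>y. y - xs) + norm (x - xs))\<^sup>2"
    by (intro power_mono) simp_all
  also have "\<dots> \<le> 2 * ((norm (x - xs))\<^sup>2 + (l2 \<pi> (\<lambda>y. y - xs))\<^sup>2)"
    using sum_squares_bound[of "l2 \<pi> (\<lambda>y. y - xs)" "norm (x - xs)"] by (simp add: power2_sum)
  also have "\<dots> \<le> 2 * ((norm (x - xs))\<^sup>2 + real CARD('n) / m)"
    using gibbs_second_moment by simp
  finally show "(l2 ?\<zeta> (\<lambda>p. snd p - fst p))\<^sup>2 \<le> 2 * ((norm (x - xs))\<^sup>2 + real CARD('n) / m)"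
    unfolding comp(2) .
qed

section \<open>Iteration of the one-step bound\<close>

lemma u1_Suc: "u1 m L \<gamma> (Suc n) = (1 - \<kappa> * \<gamma> (Suc n) / 2) * u1 m L \<gamma> n"
  by (simp add: u1_def)

text \<open>Older summands gain the newest contraction factor; the newest one carries an empty
  product. This is the recursion produced by \<open>langevin_step\<close>.\<close>

lemma u3_Suc:
  "u3 (real CARD('n)) m L L' \<gamma> (Suc n)
    = (1 - \<kappa> * \<gamma> (Suc n) / 2) * u3 (real CARD('n)) m L L' \<gamma> n + local_error (\<gamma> (Suc n))"
proof -
  define q where "q k = 1 - \<kappa> * \<gamma> k / 2" for k
  have "u3 (real CARD('n)) m L L' \<gamma> N = (\<Sum>i=1..N. local_error (\<gamma> i) * (\<Prod>k=i+1..N. q k))" for N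
    by (simp add: u3_def local_error_def q_def)
  moreover have "(\<Sum>i=1..n. local_error (\<gamma> i) * (\<Prod>k=i+1..Suc n. q k))
      = q (Suc n) * (\<Sum>i=1..n. local_error (\<gamma> i) * (\<Prod>k=i+1..n. q k))"
    unfolding sum_distrib_left by (rule sum.cong) auto
  ultimately show ?thesis by (simp add: q_def)
qed

lemma ula_coupling:
  assumes \<gamma>: "\<And>k. 1 \<le> k \<Longrightarrow> 0 < \<gamma> k \<and> \<gamma> k \<le> 1 / (m + L)" and \<epsilon>: "0 < \<epsilon>"
  shows "\<exists>\<zeta>. stationary_coupling (ula_iter U \<gamma> n x) \<zeta> \<and> (l2 \<zeta> (\<lambda>p. snd p - fst p))\<^sup>2
    \<le> u1 m L \<gamma> n * ((norm (x - xs))\<^sup>2 + real CARD('n) / m) + u3 (real CARD('n)) m L L' \<gamma> n + \<epsilon>"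
  using \<epsilon>
proof (induction n arbitrary: \<epsilon>)
  case 0
  show ?case
    using start_coupling[of x] 0 by (intro exI[of _ "return borel x \<Otimes>\<^sub>M \<pi>"]) (simp add: u1_def u3_def)
next
  case (Suc n)
  let ?B = "\<lambda>n. u1 m L \<gamma> n * ((norm (x - xs))\<^sup>2 + real CARD('n) / m) + u3 (real CARD('n)) m L L' \<gamma> n"
  define q where "q = 1 - \<kappa> * \<gamma> (Suc n) / 2"
  have \<gamma>n: "0 < \<gamma> (Suc n)" "\<gamma> (Suc n) \<le> 1 / (m + L)" using \<gamma>[of "Suc n"] by auto
  have q: "0 \<le> q" "q \<le> 1"
    using kappa_step_le[OF \<gamma>n(2)] kappa_pos \<gamma>n(1) by (auto simp: q_def)
  \<comment> \<open>Half of \<epsilon> is granted to the previous n steps, where the factor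
    \<open>q \<le> 1\<close> cannot enlarge it, and half to the present step.\<close>
  obtain \<zeta> where \<zeta>: "stationary_coupling (ula_iter U \<gamma> n x) \<zeta>" "(l2 \<zeta> (\<lambda>p. snd p - fst p))\<^sup>2 \<le> ?B n + \<epsilon> / 2"
    using Suc.IH[of "\<epsilon> / 2"] Suc.prems by auto
  have "0 < \<epsilon> / 2" using Suc.prems by simp
  then obtain \<zeta>' where \<zeta>': "stationary_coupling (bind (ula_iter U \<gamma> n x) (ula_kernel U (\<gamma> (Suc n)))) \<zeta>'"
    "(l2 \<zeta>' (\<lambda>p. snd p - fst p))\<^sup>2 \<le> q * (l2 \<zeta> (\<lambda>p. snd p - fst p))\<^sup>2 + local_error (\<gamma> (Suc n)) + \<epsilon> / 2"
    using langevin_step[OF \<zeta>(1) \<gamma>n] unfolding q_def by blast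
  have "q * (l2 \<zeta> (\<lambda>p. snd p - fst p))\<^sup>2 \<le> q * (?B n + \<epsilon> / 2)"
    using \<zeta>(2) q(1) by (rule mult_left_mono)
  also have "\<dots> = q * ?B n + q * (\<epsilon> / 2)" by (rule distrib_left)
  also have "\<dots> \<le> q * ?B n + \<epsilon> / 2"
    using q Suc.prems by (simp add: mult_left_le_one_le)
  also have "q * ?B n = ?B (Suc n) - local_error (\<gamma> (Suc n))"
    unfolding u1_Suc u3_Suc q_def by (simp add: algebra_simps)
  finally have "(l2 \<zeta>' (\<lambda>p. snd p - fst p))\<^sup>2 \<le> ?B (Suc n) + \<epsilon>" using \<zeta>'(2) by simp
  then show ?case using \<zeta>'(1) by (intro exI[of _ \<zeta>']) simp
qed

lemma measurable_ula_iter: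
  assumes "\<And>k. 1 \<le> k \<Longrightarrow> 0 < \<gamma> k"
  shows "ula_iter U \<gamma> n \<in> borel \<rightarrow>\<^sub>M prob_algebra borel"
proof (induction n)
  case 0
  have "ula_iter U \<gamma> 0 = return borel" by (rule ext) simp
  then show ?case by (simp add: measurable_return_prob_space)
next
  case (Suc n)
  have "(\<lambda>x. bind (ula_iter U \<gamma> n x) (ula_kernel U (\<gamma> (Suc n)))) \<in> borel \<rightarrow>\<^sub>M prob_algebra borel"
    by (rule measurable_bind_prob_space[OF Suc measurable_ula_kernel]) (use assms[of "Suc n"] in simp)
  moreover have "ula_iter U \<gamma> (Suc n) = (\<lambda>x. bind (ula_iter U \<gamma> n x) (ula_kernel U (\<gamma> (Suc n))))"
    by (rule ext) simp
  ultimately show ?case by simp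
qed

text \<open>The theorem writes the law as a Dirac measure followed by the kernel, whereas the
  induction runs on the iterate itself.\<close>

lemma bind_return_ula_iter:
  assumes "\<And>k. 1 \<le> k \<Longrightarrow> 0 < \<gamma> k"
  shows "bind (return borel x) (ula_iter U \<gamma> n) = ula_iter U \<gamma> n x"
  using measurable_prob_algebraD[OF measurable_ula_iter[OF assms]] by (intro bind_return) auto

lemma W2_power2_le:
  assumes \<mu>: "sets \<mu> = sets borel"
    and ex: "\<And>\<epsilon>. 0 < \<epsilon> \<Longrightarrow> \<exists>\<zeta>. stationary_coupling \<mu> \<zeta> \<and> (l2 \<zeta> (\<lambda>p. snd p - fst p))\<^sup>2 \<le> B + \<epsilon>"
  shows "(W2 \<mu> \<pi>)\<^sup>2 \<le> ennreal B"
proof -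
  let ?I = "INF \<zeta>\<in>couplings \<mu> \<pi>. \<integral>\<^sup>+ (x, y). ennreal ((norm (x - y))\<^sup>2) \<partial>\<zeta>"
  \<comment> \<open>\<open>ennreal\<close> truncates negative numbers at 0, so
    \<open>ennreal B + ennreal e\<close> is split from \<open>ennreal (B + e)\<close> using this
    sign.\<close>
  have B: "0 \<le> B"
  proof (rule field_le_epsilon)
    fix e :: real assume "0 < e"
    then obtain \<zeta> where "(l2 \<zeta> (\<lambda>p :: (real ^ 'n) \<times> (real ^ 'n). snd p - fst p))\<^sup>2 \<le> B + e" using ex by blast
    then show "0 \<le> B + e" by (rule order_trans[rotated]) simp
  qed
  have le: "?I \<le> ennreal B"
  proof (rule ennreal_le_epsilon)
    fix e :: real assume e: "0 < e"
    then obtain \<zeta> where \<zeta>: "stationary_coupling \<mu> \<zeta>" and le: "(l2 \<zeta> (\<lambda>p. snd p - fst p))\<^sup>2 \<le> B + e"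
      using ex by blast
    have s: "sets \<zeta> = sets (borel \<Otimes>\<^sub>M borel)" "distr \<zeta> borel fst = \<mu>" "distr \<zeta> borel snd = \<pi>"
      "sqint \<zeta> (\<lambda>p. snd p - fst p)"
      using \<zeta> by (auto simp: stationary_coupling_def)
    have "\<zeta> \<in> couplings \<mu> \<pi>"
      unfolding couplings_def
    proof (intro CollectI conjI)
      show "sets \<zeta> = sets (\<mu> \<Otimes>\<^sub>M \<pi>)"
        unfolding s(1) by (intro sets_pair_measure_cong) (simp_all add: \<mu>)
      have "distr \<zeta> \<mu> fst = distr \<zeta> borel fst" by (intro distr_cong) (simp_all add: \<mu>)
      then show "distr \<zeta> \<mu> fst = \<mu>" using s(2) by simp
      have "distr \<zeta> \<pi> snd = distr \<zeta> borel snd" by (intro distr_cong) simp_all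
      then show "distr \<zeta> \<pi> snd = \<pi>" using s(3) by simp
    qed
    then have "?I \<le> (\<integral>\<^sup>+ (x, y). ennreal ((norm (x - y))\<^sup>2) \<partial>\<zeta>)" by (rule INF_lower)
    also have "\<dots> = (\<integral>\<^sup>+ p. ennreal ((norm (snd p - fst p))\<^sup>2) \<partial>\<zeta>)"
      by (simp add: case_prod_unfold norm_minus_commute)
    also have "\<dots> = ennreal ((l2 \<zeta> (\<lambda>p. snd p - fst p))\<^sup>2)"
      unfolding l2_power2 by (rule nn_integral_eq_integral[OF sqint_integrable[OF s(4)]]) simp
    also have "\<dots> \<le> ennreal B + ennreal e"
      using le B e by (simp add: ennreal_leI flip: ennreal_plus)
    finally show "?I \<le> ennreal B + ennreal e" .
  qed
  \<comment> \<open>Selects the finite branch of \<open>ennreal_sqrt\<close>, where squaring undoes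
    the root.\<close>
  then have fin: "?I \<noteq> \<infinity>" by (metis ennreal_less_top infinity_ennreal_def leD)
  have "(W2 \<mu> \<pi>)\<^sup>2 = ennreal (sqrt (enn2real ?I)) ^ 2"
    using fin by (simp add: W2_def ennreal_sqrt_def)
  also have "\<dots> = ennreal (enn2real ?I)" by (simp add: ennreal_power)
  also have "\<dots> = ?I" using fin by (simp add: ennreal_enn2real_if)
  finally show ?thesis using le by simp
qed

end

theorem theorem8:
  fixes U :: "real ^ 'n \<Rightarrow> real" and L m L' :: real and \<gamma> :: "nat \<Rightarrow> real"
    and x :: "real ^ 'n" and n :: nat
  assumes "Ck 3 U"
    and "L \<ge> 0" and "m > 0" and "L' \<ge> 0"
    and "\<And>x y. norm (grad U x - grad U y) \<le> L * norm (x - y)"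
    and "\<And>x y. U y \<ge> U x + grad U x \<bullet> (y - x) + (m / 2) * (norm (x - y))\<^sup>2"
    and "\<And>x y. op_norm (hessian U x - hessian U y) \<le> L' * norm (x - y)"
    and "\<And>k. k \<ge> 1 \<Longrightarrow> \<gamma> k > 0"
    and "\<And>j k. 1 \<le> j \<Longrightarrow> j \<le> k \<Longrightarrow> \<gamma> k \<le> \<gamma> j"
    and "\<gamma> 1 \<le> 1 / (m + L)"
    and "n \<ge> 1"
  shows "(W2 (bind (return borel x) (ula_iter U \<gamma> n)) (gibbs U))\<^sup>2
    \<le> ennreal (u1 m L \<gamma> n * ((norm (x - minimizer U))\<^sup>2 + real CARD('n) / m)
                + u3 (real CARD('n)) m L L' \<gamma> n)"
proof -
  interpret langevin_potential U L m L'
    using assms(1-7) by unfold_locales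
  have \<gamma>: "0 < \<gamma> k \<and> \<gamma> k \<le> 1 / (m + L)" if "1 \<le> k" for k
    using assms(8)[OF that] assms(9)[of 1 k] assms(10) that by simp
  have "sets (ula_iter U \<gamma> n x) = sets borel"
    using measurable_space[OF measurable_ula_iter[of \<gamma> n], of x] \<gamma> by (simp add: space_prob_algebra)
  moreover have "bind (return borel x) (ula_iter U \<gamma> n) = ula_iter U \<gamma> n x"
    by (rule bind_return_ula_iter) (use \<gamma> in blast)
  ultimately show ?thesis
    using W2_power2_le[OF _ ula_coupling[of \<gamma>]] \<gamma> by simp
qed

end
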